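(* Let $\gamma=\pm\frac12$ and let $w$ be a nonnegative weight function on $[-1,1]$ with finite moments. In the orthonormal basis of $\mathcal{V}_m(\mathcal{W}_{\gamma})$ given by $${}_1Q_{k,2n}(x,y)=P_{k,n}^{(\gamma)}[w](2xy,x^2+y^2-1)\ (0\le k\le n),\quad {}_2Q_{k,2n}(x,y)=b^{(1,1)}_\gamma(x^2-y^2)P_{k,n-1}^{(\gamma)}[w^{(1,1)}](2xy,x^2+y^2-1)\ (0\le k\le n-1)$$ for $m=2n$, and by $${}_1Q_{k,2n+1}(x,y)=b^{(0,1)}_\gamma(x+y)P_{k,n}^{(\gamma)}[w^{(0,1)}](2xy,x^2+y^2-1),\quad {}_2Q_{k,2n+1}(x,y)=b^{(1,0)}_\gamma(x-y)P_{k,n}^{(\gamma)}[w^{(1,0)}](2xy,x^2+y^2-1)\quad(0\le k\le n)$$ for $m=2n+1$, the functions are given explicitly, under $x=\cos\theta$, $y=\cos\phi$, $0\le\theta,\phi\le\pi$, by the following relations, applied to $w$ and with $w^{(i,j)}$ in place of $w$. For $0\le k\le n$, $$P_{k,n}^{(-\frac12)}[w](2xy,x^2+y^2-1)=\frac1{\sqrt2}\left[p_n(\cos(\theta-\phi))p_k(\cos(\theta+\phi))+p_k(\cos(\theta-\phi))p_n(\cos(\theta+\phi))\right],$$ where for $k=n$ the right-hand side is to be multiplied by $\frac1{\sqrt2}$; and, for $0\le k\le n$ (and $\sin\theta\sin\phi\ne0$), $$P_{k,n}^{(\frac12)}[w](2xy,x^2+y^2-1)=\sqrt{\frac{a_w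^{-1/2}}{2a_w^{1/2}}}\;\frac{p_{n+1}(\cos(\theta-\phi))p_k(\cos(\theta+\phi))-p_k(\cos(\theta-\phi))p_{n+1}(\cos(\theta+\phi))}{2\sin\theta\sin\phi}.$$
   Context: For $\gamma=\pm\frac12$, $a_w^\gamma=\left(\int_{[-1,1]^2}w(x)w(y)|x-y|^{2\gamma+1}dxdy\right)^{-1}$. Let $\Omega=\{(u,v):1+u+v>0,\;1-u+v>0,\;u^2>4v\}$, the bijective image of $\{-1<s<t<1\}$ under $(s,t)\mapsto(s+t,st)$; $W_\gamma(u,v)=2a_w^\gamma w(s)w(t)(u^2-4v)^\gamma$ with $u=s+t$, $v=st$; and $\mathcal{W}_\gamma(x,y)=W_\gamma(2xy,x^2+y^2-1)|x^2-y^2|$ on $[-1,1]^2$. $p_n$ is the orthonormal polynomial of degree $n$ (positive leading coefficient) with respect to $w$ normalized to have integral $1$, i.e. $\int_{-1}^1p_np_mw\,dx=\delta_{n,m}\int_{-1}^1w\,dx$. An orthonormal basis with respect to $W_{-\frac12}$ is $$P_{k,n}^{(-\frac12)}[w](s+t,st)=\tfrac1{\sqrt2}\left(p_n(s)p_k(t)+p_n(t)p_k(s)\right)\ (0\le k<n),\qquad P_{n,n}^{(-\frac12)}[w](s+t,st)=p_n(s)p_n(t),$$ and with respect to $W_{\frac12}$ is $$P_{k,n}^{(\frac12)}[w](s+t,st)=\sqrt{\frac{a_w^{-1/2}}{2a_w^{1/2}}}\;\frac{p_{n+1}(s)p_k(t)-p_{n+1}(t)p_k(s)}{s-t}\quad(0\le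 k\le n).$$ For $i,j\in\{0,1\}$, $w^{(i,j)}(x)=(1-x)^i(1+x)^jw(x)$, $b_\gamma^{(i,j)}=\sqrt{a_{w^{(i,j)}}^\gamma/a_w^\gamma}$, and $P_{k,n}^{(\gamma)}[w^{(i,j)}]$ is the corresponding polynomial built from $w^{(i,j)}$. $\mathcal{V}_m(\mathcal{W}_\gamma)$ is the space of polynomials of total degree at most $m$ in two variables orthogonal, in $\langle f,g\rangle=\int_{[-1,1]^2}fg\,\mathcal{W}_\gamma$, to all polynomials of total degree at most $m-1$. *)

theory Defs
  imports "HOL-Analysis.Analysis" "HOL-Computational_Algebra.Polynomial"
begin

section \<open>Weights on the interval and their orthonormal polynomials\<close>

definition weight_function :: "(real \<Rightarrow> real) \<Rightarrow> bool" where
  "weight_function w \<longleftrightarrow>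
     (\<forall>x\<in>{-1..1}. 0 \<le> w x) \<and>
     (\<forall>n. set_integrable lebesgue {-1..1} (\<lambda>x. x ^ n * w x)) \<and>
     0 < (LINT x:{-1..1}|lebesgue. w x)"

text \<open>The weight \<open>w\<^sup>(\<^sup>i\<^sup>,\<^sup>j\<^sup>)\<close>.\<close>

definition shifted_weight :: "nat \<Rightarrow> nat \<Rightarrow> (real \<Rightarrow> real) \<Rightarrow> real \<Rightarrow> real" where
  "shifted_weight i j w = (\<lambda>x. (1 - x) ^ i * (1 + x) ^ j * w x)"

definition is_orthonormal_sequence :: "(real \<Rightarrow> real) \<Rightarrow> (nat \<Rightarrow> real poly) \<Rightarrow> bool" where
  "is_orthonormal_sequence w p \<longleftrightarrow>
     (\<forall>n. degree (p n) = n \<and> 0 < lead_coeff (p n)) \<and>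
     (\<forall>n m. (LINT x:{-1..1}|lebesgue. poly (p n) x * poly (p m) x * w x) =
        (if n = m then LINT x:{-1..1}|lebesgue. w x else 0))"

definition orthonormal_poly :: "(real \<Rightarrow> real) \<Rightarrow> nat \<Rightarrow> real poly" where
  "orthonormal_poly w = (THE p. is_orthonormal_sequence w p)"

abbreviation orth_eval :: "(real \<Rightarrow> real) \<Rightarrow> nat \<Rightarrow> real \<Rightarrow> real" where
  "orth_eval w n x \<equiv> poly (orthonormal_poly w n) x"

text \<open>The constant \<open>a\<^sub>w\<^sup>\<gamma>\<close>; here \<open>\<gamma>\<close> is a superscript index, not an exponent.  For
  \<open>\<gamma> = -1/2\<close> the convention \<open>0 powr 0 = 0\<close> changes the integrand only on the diagonal,
  which is a null set.\<close>

definition a_const :: "real \<Rightarrow> (real \<Rightarrow> real) \<Rightarrow> real" where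
  "a_const \<gamma> w = inverse
     (LINT z:{-1..1} \<times> {-1..1}|lebesgue.
        (case z of (x, y) \<Rightarrow> w x * w y * \<bar>x - y\<bar> powr (2 * \<gamma> + 1)))"

definition b_const :: "real \<Rightarrow> (real \<Rightarrow> real) \<Rightarrow> nat \<Rightarrow> nat \<Rightarrow> real" where
  "b_const \<gamma> w i j = sqrt (a_const \<gamma> (shifted_weight i j w) / a_const \<gamma> w)"


section \<open>Weights in two variables\<close>

definition triangle :: "(real \<times> real) set" where
  "triangle = {(s, t). -1 < s \<and> s < t \<and> t < 1}"

definition sum_prod :: "real \<times> real \<Rightarrow> real \<times> real" where
  "sum_prod = (\<lambda>(s, t). (s + t, s * t))"

text \<open>This is the bounded component of
  \<open>{(u, v). 1 + u + v > 0 \<and> 1 - u + v > 0 \<and> u\<^sup>2 > 4 * v}\<close>; the remaining components of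
  that set satisfy \<open>\<bar>u\<bar> > 2\<close> and come from \<open>s < t < -1\<close> and \<open>1 < s < t\<close>.\<close>

definition Omega :: "(real \<times> real) set" where
  "Omega = sum_prod ` triangle"

text \<open>The weight \<open>W\<^sub>\<gamma>\<close>, extended by zero outside of its domain.\<close>

definition W_weight :: "real \<Rightarrow> (real \<Rightarrow> real) \<Rightarrow> real \<Rightarrow> real \<Rightarrow> real" where
  "W_weight \<gamma> w u v =
     (if (u, v) \<in> Omega
      then (case the_inv_into triangle sum_prod (u, v) of (s, t) \<Rightarrow>
              2 * a_const \<gamma> w * w s * w t * (u\<^sup>2 - 4 * v) powr \<gamma>)
      else 0)"

text \<open>The weight \<open>\<W>\<^sub>\<gamma>\<close> on the square.\<close>

definition square_weight :: "real \<Rightarrow> (real \<Rightarrow> real) \<Rightarrow> real \<Rightarrow> real \<Rightarrow> real" where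
  "square_weight \<gamma> w x y = W_weight \<gamma> w (2 * x * y) (x\<^sup>2 + y\<^sup>2 - 1) * \<bar>x\<^sup>2 - y\<^sup>2\<bar>"

definition square_inner ::
    "real \<Rightarrow> (real \<Rightarrow> real) \<Rightarrow> (real \<Rightarrow> real \<Rightarrow> real) \<Rightarrow> (real \<Rightarrow> real \<Rightarrow> real) \<Rightarrow> real" where
  "square_inner \<gamma> w f g =
     (LINT z:{-1..1} \<times> {-1..1}|lebesgue.
        (case z of (x, y) \<Rightarrow> f x y * g x y * square_weight \<gamma> w x y))"


section \<open>Polynomials in two variables\<close>

text \<open>Real polynomials in two variables of total degree at most \<open>m\<close>, as functions.\<close>

definition polys2 :: "nat \<Rightarrow> (real \<Rightarrow> real \<Rightarrow> real) set" where
  "polys2 m = {f. \<exists>c :: nat \<Rightarrow> nat \<Rightarrow> real.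
     \<forall>x y. f x y = (\<Sum>i\<le>m. \<Sum>j\<le>m - i. c i j * x ^ i * y ^ j)}"

text \<open>The space \<open>\<V>\<^sub>m(\<W>\<^sub>\<gamma>)\<close>.  Quantifying over all \<open>l < m\<close> avoids the truncated \<open>m - 1\<close>
  when \<open>m = 0\<close>.\<close>

definition orth_space :: "real \<Rightarrow> (real \<Rightarrow> real) \<Rightarrow> nat \<Rightarrow> (real \<Rightarrow> real \<Rightarrow> real) set" where
  "orth_space \<gamma> w m =
     {f \<in> polys2 m. \<forall>l<m. \<forall>g\<in>polys2 l. square_inner \<gamma> w f g = 0}"

definition orthonormal_basis_on ::
    "((real \<Rightarrow> real \<Rightarrow> real) \<Rightarrow> (real \<Rightarrow> real \<Rightarrow> real) \<Rightarrow> real) \<Rightarrow> (real \<Rightarrow> real \<Rightarrow> real) set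
      \<Rightarrow> 'i set \<Rightarrow> ('i \<Rightarrow> real \<Rightarrow> real \<Rightarrow> real) \<Rightarrow> bool" where
  "orthonormal_basis_on ip V I e \<longleftrightarrow>
     finite I \<and>
     (\<forall>i\<in>I. e i \<in> V) \<and>
     (\<forall>i\<in>I. \<forall>j\<in>I. ip (e i) (e j) = (if i = j then 1 else 0)) \<and>
     (\<forall>f\<in>V. \<exists>c. \<forall>x y. f x y = (\<Sum>i\<in>I. c i * e i x y))"

text \<open>The polynomials \<open>P\<^sub>k\<^sub>,\<^sub>n\<close> for \<open>\<gamma> = -1/2\<close> and \<open>\<gamma> = 1/2\<close>, each the unique polynomial in
  \<open>(u, v)\<close> with prescribed values at \<open>(s + t, s * t)\<close>.\<close>

definition P_minus :: "(real \<Rightarrow> real) \<Rightarrow> nat \<Rightarrow> nat \<Rightarrow> real \<Rightarrow> real \<Rightarrow> real" where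
  "P_minus w k n = (THE P. (\<exists>d. P \<in> polys2 d) \<and>
     (\<forall>s t. P (s + t) (s * t) =
        (if k = n then orth_eval w n s * orth_eval w n t
         else 1 / sqrt 2 *
           (orth_eval w n s * orth_eval w k t + orth_eval w n t * orth_eval w k s))))"

definition P_plus :: "(real \<Rightarrow> real) \<Rightarrow> nat \<Rightarrow> nat \<Rightarrow> real \<Rightarrow> real \<Rightarrow> real" where
  "P_plus w k n = (THE P. (\<exists>d. P \<in> polys2 d) \<and>
     (\<forall>s t. s \<noteq> t \<longrightarrow> P (s + t) (s * t) =
        sqrt (a_const (-1/2) w / (2 * a_const (1/2) w)) *
        ((orth_eval w (n + 1) s * orth_eval w k t - orth_eval w (n + 1) t * orth_eval w k s)
           / (s - t))))"

text \<open>Only meant for \<open>\<gamma> = -1/2\<close> and \<open>\<gamma> = 1/2\<close>.\<close>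

definition P_gamma :: "real \<Rightarrow> (real \<Rightarrow> real) \<Rightarrow> nat \<Rightarrow> nat \<Rightarrow> real \<Rightarrow> real \<Rightarrow> real" where
  "P_gamma \<gamma> w k n = (if \<gamma> = -1/2 then P_minus w k n else P_plus w k n)"

text \<open>The functions \<open>\<^sub>1Q\<^sub>k\<^sub>,\<^sub>m\<close> and \<open>\<^sub>2Q\<^sub>k\<^sub>,\<^sub>m\<close> for \<open>m = 2 * n\<close> and for \<open>m = 2 * n + 1\<close>.\<close>

definition Q1_even :: "real \<Rightarrow> (real \<Rightarrow> real) \<Rightarrow> nat \<Rightarrow> nat \<Rightarrow> real \<Rightarrow> real \<Rightarrow> real" where
  "Q1_even \<gamma> w n k x y = P_gamma \<gamma> w k n (2 * x * y) (x\<^sup>2 + y\<^sup>2 - 1)"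

definition Q2_even :: "real \<Rightarrow> (real \<Rightarrow> real) \<Rightarrow> nat \<Rightarrow> nat \<Rightarrow> real \<Rightarrow> real \<Rightarrow> real" where
  "Q2_even \<gamma> w n k x y = b_const \<gamma> w 1 1 * (x\<^sup>2 - y\<^sup>2) *
     P_gamma \<gamma> (shifted_weight 1 1 w) k (n - 1) (2 * x * y) (x\<^sup>2 + y\<^sup>2 - 1)"

definition Q1_odd :: "real \<Rightarrow> (real \<Rightarrow> real) \<Rightarrow> nat \<Rightarrow> nat \<Rightarrow> real \<Rightarrow> real \<Rightarrow> real" where
  "Q1_odd \<gamma> w n k x y = b_const \<gamma> w 0 1 * (x + y) *
     P_gamma \<gamma> (shifted_weight 0 1 w) k n (2 * x * y) (x\<^sup>2 + y\<^sup>2 - 1)"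

definition Q2_odd :: "real \<Rightarrow> (real \<Rightarrow> real) \<Rightarrow> nat \<Rightarrow> nat \<Rightarrow> real \<Rightarrow> real \<Rightarrow> real" where
  "Q2_odd \<gamma> w n k x y = b_const \<gamma> w 1 0 * (x - y) *
     P_gamma \<gamma> (shifted_weight 1 0 w) k n (2 * x * y) (x\<^sup>2 + y\<^sup>2 - 1)"

end

theory Submission imports Defs "HOL-Library.Function_Algebras" begin

text \<open>
  Put \<open>x = cos \<theta>\<close> and \<open>y = cos \<phi>\<close>.  Then \<open>2 * x * y = s + t\<close> and \<open>x\<^sup>2 + y\<^sup>2 - 1 = s * t\<close> with
  \<open>s = cos (\<theta> - \<phi>)\<close> and \<open>t = cos (\<theta> + \<phi>)\<close> (\<open>cos_sum_prod\<close>), so the trigonometric formulas merely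
  evaluate the polynomials \<open>P\<^sub>k\<^sub>,\<^sub>n\<close> at \<open>(s + t, s * t)\<close>.  The substance of the theorem lies in the
  orthonormal bases.

  The central analytic fact is a change of variables (\<open>integral_square_roots\<close>): for symmetric
  \<open>G\<close>, twice the integral of \<open>G s t * \<bar>x\<^sup>2 - y\<^sup>2\<bar>\<close> over the square in \<open>(x, y)\<close> is the integral of
  \<open>G s t * \<bar>s - t\<bar>\<close> over the square in \<open>(s, t)\<close>.  In angles it says that the rotation
  \<open>(\<theta>, \<phi>) \<mapsto> (\<theta> - \<phi>, \<theta> + \<phi>)\<close> preserves integrals over the torus, which follows from Fubini
  and shifts (\<open>nn_integral_torus_rotation\<close>).  Consequently, inner products of functions of
  \<open>(2 * x * y, x\<^sup>2 + y\<^sup>2 - 1)\<close> on the square become integrals against the kernel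
  \<open>w s * w t * \<bar>s - t\<bar> powr (2 * \<gamma> + 1)\<close>.  For \<open>\<gamma> = -1/2\<close> and \<open>\<gamma> = 1/2\<close> the last factor is \<open>1\<close> or
  \<open>(s - t)\<^sup>2\<close>; the latter cancels the denominators of \<open>P_plus\<close>, and the orthonormality of the
  \<open>P\<^sub>k\<^sub>,\<^sub>n\<close> reduces to that of the polynomials in one variable (\<open>P_gamma_orthonormal\<close>).

  The prefactors \<open>x - y\<close> and \<open>x + y\<close> change the weight: their squares are \<open>(1 - s) * (1 - t)\<close> and
  \<open>(1 + s) * (1 + t)\<close>, which turns \<open>w\<close> into \<open>shifted_weight i j w\<close> (\<open>square_weight_shifted\<close>).
  Functions with different prefactors are orthogonal because the weight is invariant under
  \<open>(x, y) \<mapsto> (y, x)\<close> and \<open>(x, y) \<mapsto> (-x, -y)\<close>.  Hence the functions of all degrees form one orthonormal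
  system with \<open>m + 1\<close> members of degree \<open>m\<close>, for every \<open>m\<close>.  These are as many as there are monomials, so
  a dimension count shows that they form bases (\<open>graded_orthonormal_basis\<close>).

  The integrals are computed for Borel measurable weights; an arbitrary weight agrees
  almost everywhere with such a weight, and nothing in the theorem distinguishes the two.
\<close>

section \<open>Polynomials in two variables\<close>

lemma polys2_I:
  assumes "\<And>x y. f x y = (\<Sum>i\<le>m. \<Sum>j\<le>m - i. c i j * x ^ i * y ^ j)"
  shows "f \<in> polys2 m"
  unfolding polys2_def using assms by blast

text \<open>A functional normal form, so that a polynomial can be replaced by its expansion
  with \<open>unfolding\<close>; the monomials are bracketed to match \<open>polys2_monom\<close>.\<close>

lemma polys2_E:
  assumes "f \<in> polys2 m"
  obtains c where "f = (\<lambda>x y. \<Sum>i\<le>m. \<Sum>j\<le>m - i. c i j * (x ^ i * y ^ j))"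
  using assms unfolding polys2_def by (auto simp: fun_eq_iff mult.assoc)

lemma polys2_monom:
  assumes "i + j \<le> m"
  shows "(\<lambda>x y. x ^ i * y ^ j) \<in> polys2 m"
proof (rule polys2_I)
  fix x y :: real
  have "(\<Sum>a\<le>m. \<Sum>b\<le>m - a. (if a = i \<and> b = j then 1 else 0) * x ^ a * y ^ b)
      = (\<Sum>a\<le>m. if a = i then \<Sum>b\<le>m - i. if b = j then x ^ i * y ^ j else 0 else 0)"
    by (intro sum.cong refl) (auto intro!: sum.neutral sum.cong simp del: sum.delta sum.delta')
  then show "x ^ i * y ^ j = (\<Sum>a\<le>m. \<Sum>b\<le>m - a. (if a = i \<and> b = j then 1 else 0) * x ^ a * y ^ b)"
    using assms by simp
qed

lemma polys2_add:
  assumes "f \<in> polys2 m" "g \<in> polys2 m"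
  shows "(\<lambda>x y. f x y + g x y) \<in> polys2 m"
proof -
  obtain c where c: "f = (\<lambda>x y. \<Sum>i\<le>m. \<Sum>j\<le>m - i. c i j * (x ^ i * y ^ j))" using assms by (elim polys2_E)
  obtain d where d: "g = (\<lambda>x y. \<Sum>i\<le>m. \<Sum>j\<le>m - i. d i j * (x ^ i * y ^ j))" using assms by (elim polys2_E)
  show ?thesis
    by (rule polys2_I[where c = "\<lambda>i j. c i j + d i j"]) (simp add: c d sum.distrib algebra_simps)
qed

lemma polys2_scale:
  assumes "f \<in> polys2 m"
  shows "(\<lambda>x y. a * f x y) \<in> polys2 m"
proof -
  obtain c where c: "f = (\<lambda>x y. \<Sum>i\<le>m. \<Sum>j\<le>m - i. c i j * (x ^ i * y ^ j))" using assms by (elim polys2_E)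
  show ?thesis
    by (rule polys2_I[where c = "\<lambda>i j. a * c i j"]) (simp add: c sum_distrib_left mult_ac)
qed

lemma polys2_diff:
  assumes "f \<in> polys2 m" "g \<in> polys2 m"
  shows "(\<lambda>x y. f x y - g x y) \<in> polys2 m"
  using polys2_add[OF assms(1) polys2_scale[OF assms(2), of "-1"]] by simp

lemma polys2_const: "(\<lambda>x y. a) \<in> polys2 m"
  using polys2_scale[OF polys2_monom[of 0 0 m], of a] by simp

lemma polys2_sum:
  assumes "\<And>i. i \<in> I \<Longrightarrow> f i \<in> polys2 m"
  shows "(\<lambda>x y. \<Sum>i\<in>I. f i x y) \<in> polys2 m"
  using assms
proof (induction I rule: infinite_finite_induct)
  case (insert i I)
  then show ?case using polys2_add[of "f i" m "\<lambda>x y. \<Sum>i\<in>I. f i x y"] by simp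
qed (simp_all add: polys2_const)

lemma polys2_mono:
  assumes "f \<in> polys2 m" "m \<le> n"
  shows "f \<in> polys2 n"
proof -
  obtain c where c: "f = (\<lambda>x y. \<Sum>i\<le>m. \<Sum>j\<le>m - i. c i j * (x ^ i * y ^ j))" using assms by (elim polys2_E)
  show ?thesis
    unfolding c using \<open>m \<le> n\<close> by (intro polys2_sum polys2_scale polys2_monom) auto
qed

lemma polys2_mult:
  assumes "f \<in> polys2 m" "g \<in> polys2 n"
  shows "(\<lambda>x y. f x y * g x y) \<in> polys2 (m + n)"
proof -
  obtain c where c: "f = (\<lambda>x y. \<Sum>i\<le>m. \<Sum>j\<le>m - i. c i j * (x ^ i * y ^ j))" using assms by (elim polys2_E)
  obtain d where d: "g = (\<lambda>x y. \<Sum>i\<le>n. \<Sum>j\<le>n - i. d i j * (x ^ i * y ^ j))" using assms by (elim polys2_E)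
  have "f x y * g x y = (\<Sum>i\<le>m. \<Sum>j\<le>m - i. (c i j * (x ^ i * y ^ j)) * g x y)" for x y
    by (simp add: c sum_distrib_right)
  then have "(\<lambda>x y. f x y * g x y) = (\<lambda>x y. \<Sum>i\<le>m. \<Sum>j\<le>m - i. \<Sum>k\<le>n. \<Sum>l\<le>n - k.
      (c i j * d k l) * (x ^ (i + k) * y ^ (j + l)))"
    by (simp add: d fun_eq_iff sum_distrib_left power_add mult_ac)
  also have "\<dots> \<in> polys2 (m + n)"
    by (intro polys2_sum polys2_scale polys2_monom) auto
  finally show ?thesis .
qed

lemma polys2_power:
  assumes "f \<in> polys2 d"
  shows "(\<lambda>x y. f x y ^ k) \<in> polys2 (d * k)"
proof (induction k)
  case (Suc k)
  then show ?case using polys2_mult[OF assms] by simp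
qed (simp add: polys2_const)

lemma polys2_compose:
  assumes "P \<in> polys2 n" "U \<in> polys2 d" "V \<in> polys2 d"
  shows "(\<lambda>x y. P (U x y) (V x y)) \<in> polys2 (d * n)"
proof -
  obtain c where c: "P = (\<lambda>x y. \<Sum>i\<le>n. \<Sum>j\<le>n - i. c i j * (x ^ i * y ^ j))" using assms by (elim polys2_E)
  have "(\<lambda>x y. U x y ^ i * V x y ^ j) \<in> polys2 (d * n)" if "i \<le> n" "j \<le> n - i" for i j
  proof (rule polys2_mono)
    show "(\<lambda>x y. U x y ^ i * V x y ^ j) \<in> polys2 (d * i + d * j)"
      using assms by (intro polys2_mult polys2_power)
    show "d * i + d * j \<le> d * n"
      using that mult_le_mono2[of "i + j" n d] by (simp add: distrib_left)
  qed
  then show ?thesis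
    unfolding c by (intro polys2_sum polys2_scale) auto
qed

lemma polys2_continuous: "f \<in> polys2 m \<Longrightarrow> continuous_on A (\<lambda>z. f (fst z) (snd z))"
  by (elim polys2_E) (auto intro!: continuous_intros)

section \<open>Symmetric functions as polynomials in the sum and the product\<close>

text \<open>For fixed \<open>u\<close>, every \<open>v < u\<^sup>2 / 4\<close> is the product of two distinct reals with sum \<open>u\<close>.
  Two polynomials that agree at all points \<open>(s + t, s * t)\<close> thus agree, as polynomials in
  \<open>v\<close>, at infinitely many places.  This is the uniqueness hidden in the definite
  descriptions of \<open>P_minus\<close> and \<open>P_plus\<close>.\<close>

lemma polys2_eqI:
  assumes "P \<in> polys2 m" "Q \<in> polys2 n"
    and eq: "\<And>s t. s \<noteq> t \<Longrightarrow> P (s + t) (s * t) = Q (s + t) (s * t)"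
  shows "P = Q"
proof (intro ext)
  fix u v :: real
  have poly_v: "\<exists>r. \<forall>v. f u v = poly r v" if "f \<in> polys2 k" for f k
    using that
  proof (elim polys2_E)
    fix c assume "f = (\<lambda>x y. \<Sum>i\<le>k. \<Sum>j\<le>k - i. c i j * (x ^ i * y ^ j))"
    then have "f u v = poly (\<Sum>i\<le>k. \<Sum>j\<le>k - i. monom (c i j * u ^ i) j) v" for v
      by (simp add: poly_sum poly_monom mult_ac)
    then show ?thesis by blast
  qed
  obtain p q where p: "\<And>v. P u v = poly p v" and q: "\<And>v. Q u v = poly q v"
    using poly_v[OF assms(1)] poly_v[OF assms(2)] by blast
  have "{..<u\<^sup>2 / 4} \<subseteq> {v. poly (p - q) v = 0}"
  proof
    fix v assume "v \<in> {..<u\<^sup>2 / 4}"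
    then have pos: "u\<^sup>2 - 4 * v > 0" by simp
    define s t where "s = (u + sqrt (u\<^sup>2 - 4 * v)) / 2" and "t = (u - sqrt (u\<^sup>2 - 4 * v)) / 2"
    have "s + t = u" by (simp add: s_def t_def field_simps)
    moreover have "s * t = (u\<^sup>2 - (sqrt (u\<^sup>2 - 4 * v))\<^sup>2) / 4"
      unfolding s_def t_def power2_eq_square by (simp add: algebra_simps)
    then have "s * t = v" using pos by simp
    moreover have "s \<noteq> t" using pos by (simp add: s_def t_def)
    ultimately have "P u v = Q u v" using eq[of s t] by simp
    then show "v \<in> {v. poly (p - q) v = 0}" by (simp add: p q)
  qed
  then have "infinite {v. poly (p - q) v = 0}"
    using infinite_Iio infinite_super by blast
  then have "p - q = 0"
    using poly_roots_finite by blast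
  then show "P u v = Q u v" by (simp add: p q)
qed

text \<open>Newton's recurrence: with \<open>u = s + t\<close> and \<open>v = s * t\<close>, the numbers \<open>h m = s ^ m + t ^ m\<close> satisfy
  \<open>h (m + 2) = u * h (m + 1) - v * h m\<close>, so the degree in \<open>(u, v)\<close> grows by at most one per
  step, although \<open>v\<close> itself has degree two in \<open>(s, t)\<close>.\<close>

lemma polys2_power_sum:
  "\<exists>P\<in>polys2 m. \<forall>s t. P (s + t) (s * t) = s ^ m + t ^ m"
proof (induction m rule: induct_nat_012)
  case 0
  show ?case by (intro bexI[of _ "\<lambda>u v. 2"]) (auto simp: polys2_const)
next
  case 1
  show ?case using polys2_monom[of 1 0 "Suc 0"] by (intro bexI[of _ "\<lambda>u v. u"]) auto
next
  case (ge2 m)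
  then obtain P Q where P: "P \<in> polys2 m" "\<And>s t. P (s + t) (s * t) = s ^ m + t ^ m"
    and Q: "Q \<in> polys2 (Suc m)" "\<And>s t. Q (s + t) (s * t) = s ^ Suc m + t ^ Suc m" by blast
  have "(\<lambda>u v. u * Q u v - v * P u v) \<in> polys2 (Suc (Suc m))"
    using polys2_mult[OF polys2_monom[of 1 0 1] Q(1)] polys2_mult[OF polys2_monom[of 0 1 2] P(1)]
    by (intro polys2_diff) simp_all
  then show ?case
    by (rule bexI[rotated]) (auto simp: P Q algebra_simps)
qed

text \<open>The same recurrence with other initial values: \<open>(s ^ (m + 1) - t ^ (m + 1)) / (s - t)\<close>
  takes the values \<open>1\<close> and \<open>u\<close> for \<open>m = 0\<close> and \<open>m = 1\<close>.\<close>

lemma polys2_power_difference_quotient: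
  "\<exists>P\<in>polys2 m. \<forall>s t. P (s + t) (s * t) * (s - t) = s ^ Suc m - t ^ Suc m"
proof (induction m rule: induct_nat_012)
  case 0
  show ?case by (intro bexI[of _ "\<lambda>u v. 1"]) (auto simp: polys2_const)
next
  case 1
  show ?case using polys2_monom[of 1 0 "Suc 0"]
    by (intro bexI[of _ "\<lambda>u v. u"]) (auto simp: algebra_simps)
next
  case (ge2 m)
  then obtain P Q where P: "P \<in> polys2 m" "\<And>s t. P (s + t) (s * t) * (s - t) = s ^ Suc m - t ^ Suc m"
    and Q: "Q \<in> polys2 (Suc m)" "\<And>s t. Q (s + t) (s * t) * (s - t) = s ^ Suc (Suc m) - t ^ Suc (Suc m)" by blast
  have "(\<lambda>u v. u * Q u v - v * P u v) \<in> polys2 (Suc (Suc m))"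
    using polys2_mult[OF polys2_monom[of 1 0 1] Q(1)] polys2_mult[OF polys2_monom[of 0 1 2] P(1)]
    by (intro polys2_diff) simp_all
  moreover have "((s + t) * Q (s + t) (s * t) - s * t * P (s + t) (s * t)) * (s - t)
      = s ^ Suc (Suc (Suc m)) - t ^ Suc (Suc (Suc m))" for s t :: real
  proof -
    have "((s + t) * Q (s + t) (s * t) - s * t * P (s + t) (s * t)) * (s - t)
        = (s + t) * (Q (s + t) (s * t) * (s - t)) - s * t * (P (s + t) (s * t) * (s - t))"
      by (simp add: algebra_simps)
    then show ?thesis unfolding P Q by (simp add: algebra_simps)
  qed
  ultimately show ?case
    by (intro bexI[of _ "\<lambda>u v. u * Q u v - v * P u v"]) auto
qed

text \<open>Pulling out the smaller exponent, \<open>s ^ i * t ^ j + t ^ i * s ^ j\<close> is \<open>v ^ j\<close> times a power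
  sum of order \<open>i - j\<close>.  Its degree in \<open>(u, v)\<close> is therefore \<open>max i j\<close> and not \<open>i + j\<close>; this
  is why \<open>P\<^sub>k\<^sub>,\<^sub>n\<close> has degree \<open>n\<close>.\<close>

lemma polys2_symmetric_monomials:
  assumes "i \<le> n" "j \<le> n"
  shows "\<exists>P\<in>polys2 n. \<forall>s t. P (s + t) (s * t) = s ^ i * t ^ j + t ^ i * s ^ j"
proof -
  have *: "\<exists>P\<in>polys2 n. \<forall>s t. P (s + t) (s * t) = s ^ i * t ^ j + t ^ i * s ^ j"
    if "j \<le> i" "i \<le> n" for i j
  proof -
    obtain P where P: "P \<in> polys2 (i - j)" "\<And>s t. P (s + t) (s * t) = s ^ (i - j) + t ^ (i - j)"
      using polys2_power_sum by blast
    have "(\<lambda>u v. u ^ 0 * v ^ j * P u v) \<in> polys2 (j + (i - j))"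
      using P by (intro polys2_mult polys2_monom) auto
    then have "(\<lambda>u v. v ^ j * P u v) \<in> polys2 n"
      using that by (auto intro: polys2_mono)
    moreover have "(s * t) ^ j * P (s + t) (s * t) = s ^ i * t ^ j + t ^ i * s ^ j" for s t
    proof -
      have "x ^ i = x ^ (i - j) * x ^ j" for x :: real
        using that by (simp flip: power_add)
      then show ?thesis by (simp add: P power_mult_distrib algebra_simps)
    qed
    ultimately show ?thesis
      by (intro bexI[of _ "\<lambda>u v. v ^ j * P u v"]) auto
  qed
  show ?thesis
  proof (cases "j \<le> i")
    case False
    with *[of i j] assms show ?thesis by (auto simp: mult.commute add.commute)
  qed (use * assms in simp)
qed

text \<open>As in the symmetric case, but the division by \<open>s - t\<close> lowers the degree by one.\<close>

lemma polys2_antisymmetric_monomials: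
  assumes "i \<le> Suc n" "j \<le> Suc n"
  shows "\<exists>P\<in>polys2 n. \<forall>s t. P (s + t) (s * t) * (s - t) = s ^ i * t ^ j - t ^ i * s ^ j"
proof -
  have *: "\<exists>P\<in>polys2 n. \<forall>s t. P (s + t) (s * t) * (s - t) = s ^ i * t ^ j - t ^ i * s ^ j"
    if "j < i" "i \<le> Suc n" for i j
  proof -
    obtain P where P: "P \<in> polys2 (i - Suc j)"
      "\<And>s t. P (s + t) (s * t) * (s - t) = s ^ Suc (i - Suc j) - t ^ Suc (i - Suc j)"
      using polys2_power_difference_quotient by blast
    have "(\<lambda>u v. u ^ 0 * v ^ j * P u v) \<in> polys2 (j + (i - Suc j))"
      using P by (intro polys2_mult polys2_monom) auto
    then have "(\<lambda>u v. v ^ j * P u v) \<in> polys2 n"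
      using that by (auto intro: polys2_mono)
    moreover have "(s * t) ^ j * P (s + t) (s * t) * (s - t) = s ^ i * t ^ j - t ^ i * s ^ j" for s t
    proof -
      have "x ^ i = x ^ Suc (i - Suc j) * x ^ j" for x :: real
        using that by (subst power_add[symmetric]) (simp del: power_Suc add: Suc_diff_Suc)
      moreover have "(s * t) ^ j * P (s + t) (s * t) * (s - t) = (s * t) ^ j * (P (s + t) (s * t) * (s - t))"
        by simp
      ultimately show ?thesis
        unfolding P by (simp add: power_mult_distrib right_diff_distrib mult_ac del: power_Suc)
    qed
    ultimately show ?thesis
      by (intro bexI[of _ "\<lambda>u v. v ^ j * P u v"]) auto
  qed
  consider "j < i" | "i = j" | "i < j" by linarith
  then show ?thesis
  proof cases
    case 1
    with * assms show ?thesis by simp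
  next
    case 2
    then show ?thesis by (intro bexI[of _ "\<lambda>u v. 0"]) (auto simp: polys2_const)
  next
    case 3
    with *[of i j] assms obtain P where P: "P \<in> polys2 n"
      "\<And>s t. P (s + t) (s * t) * (s - t) = s ^ j * t ^ i - t ^ j * s ^ i" by blast
    show ?thesis
      using polys2_scale[OF P(1), of "-1"] P(2)
      by (intro bexI[of _ "\<lambda>u v. -1 * P u v"]) (auto simp: mult.commute)
  qed
qed

lemma polys2_symmetrize:
  assumes "degree p \<le> n" "degree q \<le> n"
  shows "\<exists>P\<in>polys2 n. \<forall>s t. P (s + t) (s * t) = poly p s * poly q t + poly p t * poly q s"
proof -
  obtain M where M: "\<And>i j. i \<le> n \<Longrightarrow> j \<le> n \<Longrightarrow> M i j \<in> polys2 n"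
    "\<And>i j s t. i \<le> n \<Longrightarrow> j \<le> n \<Longrightarrow> M i j (s + t) (s * t) = s ^ i * t ^ j + t ^ i * s ^ j"
    using polys2_symmetric_monomials[of _ n] by metis
  define P where "P = (\<lambda>u v. \<Sum>i\<le>degree p. \<Sum>j\<le>degree q. coeff p i * coeff q j * M i j u v)"
  have "P \<in> polys2 n"
    unfolding P_def using assms by (intro polys2_sum polys2_scale M) auto
  moreover have "P (s + t) (s * t) = poly p s * poly q t + poly p t * poly q s" for s t
  proof -
    have "P (s + t) (s * t) = (\<Sum>i\<le>degree p. \<Sum>j\<le>degree q. coeff p i * coeff q j * (s ^ i * t ^ j + t ^ i * s ^ j))"
      unfolding P_def using assms by (intro sum.cong refl) (simp add: M)
    also have "\<dots> = poly p s * poly q t + poly p t * poly q s"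
      unfolding poly_altdef sum_product sum.distrib[symmetric] by (intro sum.cong refl) (simp add: algebra_simps)
    finally show ?thesis .
  qed
  ultimately show ?thesis by blast
qed

lemma polys2_divided_antisymmetrization:
  assumes "degree p \<le> Suc n" "degree q \<le> Suc n"
  shows "\<exists>P\<in>polys2 n. \<forall>s t. P (s + t) (s * t) * (s - t) = poly p s * poly q t - poly p t * poly q s"
proof -
  obtain M where M: "\<And>i j. i \<le> Suc n \<Longrightarrow> j \<le> Suc n \<Longrightarrow> M i j \<in> polys2 n"
    "\<And>i j s t. i \<le> Suc n \<Longrightarrow> j \<le> Suc n \<Longrightarrow> M i j (s + t) (s * t) * (s - t) = s ^ i * t ^ j - t ^ i * s ^ j"
    using polys2_antisymmetric_monomials[of _ n] by metis
  define P where "P = (\<lambda>u v. \<Sum>i\<le>degree p. \<Sum>j\<le>degree q. coeff p i * coeff q j * M i j u v)"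
  have "P \<in> polys2 n"
    unfolding P_def using assms by (intro polys2_sum polys2_scale M) auto
  moreover have "P (s + t) (s * t) * (s - t) = poly p s * poly q t - poly p t * poly q s" for s t
  proof -
    have "P (s + t) (s * t) * (s - t) = (\<Sum>i\<le>degree p. \<Sum>j\<le>degree q. coeff p i * coeff q j * (s ^ i * t ^ j - t ^ i * s ^ j))"
      unfolding P_def sum_distrib_right using assms by (intro sum.cong refl) (simp add: M mult.assoc)
    also have "\<dots> = poly p s * poly q t - poly p t * poly q s"
      unfolding poly_altdef sum_product sum_subtractf[symmetric] by (intro sum.cong refl) (simp add: algebra_simps)
    finally show ?thesis .
  qed
  ultimately show ?thesis by blast
qed

section \<open>Existence and uniqueness of orthonormal polynomials\<close>

text \<open>A polynomial orthogonal to \<open>q 0, \<dots>, q (n - 1)\<close> is orthogonal to everything of degree below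
  \<open>n\<close>: subtract the multiple of \<open>q (n - 1)\<close> that removes the top coefficient and repeat.
  The bound on the degree is stated through coefficients because \<open>degree r < 0\<close> cannot hold,
  whereas the zero polynomial must be included for \<open>n = 0\<close>.\<close>

lemma orthogonal_lower_degree:
  fixes L :: "real poly \<Rightarrow> real"
  assumes add: "\<And>p q. L (p + q) = L p + L q" and smult: "\<And>c p. L (Polynomial.smult c p) = c * L p"
    and deg: "\<And>k. k < n \<Longrightarrow> degree (q k) = k \<and> lead_coeff (q k) \<noteq> 0"
    and orth: "\<And>k. k < n \<Longrightarrow> L (f * q k) = 0"
    and r: "\<forall>i\<ge>n. coeff r i = 0"
  shows "L (f * r) = 0"
  using deg orth r
proof (induction n arbitrary: r)
  case 0
  then have "r = 0" by (simp add: poly_eq_iff)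
  then show ?case using smult[of 0 0] by simp
next
  case (Suc n)
  define c where "c = coeff r n / coeff (q n) n"
  have q: "degree (q n) = n" "coeff (q n) n \<noteq> 0" "L (f * q n) = 0" using Suc.prems by (metis lessI)+
  have "\<forall>i\<ge>n. coeff (r - Polynomial.smult c (q n)) i = 0"
  proof (intro allI impI)
    fix i assume "i \<ge> n"
    then show "coeff (r - Polynomial.smult c (q n)) i = 0"
      using Suc.prems(3) q by (cases "i = n") (auto simp: c_def coeff_eq_0)
  qed
  then have "L (f * (r - Polynomial.smult c (q n))) = 0"
    by (rule Suc.IH[rotated 2]) (use Suc.prems(1,2) less_SucI in blast)+
  moreover have "f * r = f * (r - Polynomial.smult c (q n)) + Polynomial.smult c (f * q n)"
    by (simp add: algebra_simps)
  then have "L (f * r) = L (f * (r - Polynomial.smult c (q n))) + c * L (f * q n)"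
    by (simp add: add smult)
  ultimately show ?case using q by simp
qed

text \<open>One Gram--Schmidt step: correct the monomial of degree \<open>n\<close> by its projections to the
  monic orthogonal polynomials of smaller degree.\<close>

lemma orthogonal_monic_exists:
  fixes L :: "real poly \<Rightarrow> real"
  assumes add: "\<And>p q. L (p + q) = L p + L q" and smult: "\<And>c p. L (Polynomial.smult c p) = c * L p"
    and pos: "\<And>p. p \<noteq> 0 \<Longrightarrow> L (p * p) > 0"
  shows "\<exists>q. degree q = n \<and> lead_coeff q = 1 \<and> (\<forall>r. (\<forall>i\<ge>n. coeff r i = 0) \<longrightarrow> L (q * r) = 0)"
proof (induction n rule: less_induct)
  case (less n)
  have L0: "L 0 = 0" using smult[of 0 0] by simp
  have L_sum: "L (\<Sum>i\<in>I. f i) = (\<Sum>i\<in>I. L (f i))" for I :: "nat set" and f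
    by (induction I rule: infinite_finite_induct) (simp_all add: L0 add)
  obtain q where q: "\<And>k. k < n \<Longrightarrow> degree (q k) = k" "\<And>k. k < n \<Longrightarrow> lead_coeff (q k) = 1"
    "\<And>k r. k < n \<Longrightarrow> (\<forall>i\<ge>k. coeff r i = 0) \<Longrightarrow> L (q k * r) = 0"
    using less.IH by metis
  have q0: "q k \<noteq> 0" if "k < n" for k using q(2)[OF that] by auto
  have orth: "L (q j * q k) = 0" if "j < n" "k < n" "j \<noteq> k" for j k
  proof (cases "j < k")
    case True
    then have "\<forall>i\<ge>k. coeff (q j) i = 0" using q(1)[of j] that by (auto intro: coeff_eq_0)
    with q(3)[of k "q j"] that show ?thesis by (simp add: mult.commute)
  next
    case False
    then have "\<forall>i\<ge>j. coeff (q k) i = 0" using q(1)[of k] that by (auto intro: coeff_eq_0)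
    with q(3)[of j "q k"] that show ?thesis by simp
  qed
  define X where "X = monom (1::real) n"
  define a where "a = (\<lambda>k. - L (X * q k) / L (q k * q k))"
  define S where "S = (\<Sum>k<n. Polynomial.smult (a k) (q k))"
  have S: "coeff S i = 0" if "i \<ge> n" for i
    unfolding S_def coeff_sum using that q(1) by (intro sum.neutral) (auto simp: coeff_eq_0)
  have coeff: "coeff (X + S) n = 1" "\<And>i. i > n \<Longrightarrow> coeff (X + S) i = 0"
    using S by (auto simp: X_def)
  have deg: "degree (X + S) = n"
    using coeff by (intro antisym degree_le le_degree) auto
  have S_orth: "L ((X + S) * q k) = 0" if "k < n" for k
  proof -
    have "L (S * q k) = (\<Sum>j<n. a j * L (q j * q k))"
      by (simp add: S_def sum_distrib_right L_sum smult)
    also have "\<dots> = (\<Sum>j<n. if j = k then a k * L (q k * q k) else 0)"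
      using orth that by (intro sum.cong) auto
    also have "\<dots> = - L (X * q k)"
      using that pos[OF q0[OF that]] by (simp add: a_def)
    finally show ?thesis by (simp add: distrib_right add)
  qed
  have "L ((X + S) * r) = 0" if "\<forall>i\<ge>n. coeff r i = 0" for r
  proof (rule orthogonal_lower_degree[of L n q, OF add smult _ S_orth that])
    show "degree (q k) = k \<and> lead_coeff (q k) \<noteq> 0" if "k < n" for k
      using q(1)[OF that] q(2)[OF that] by linarith
  qed
  with deg coeff(1) show ?case by (intro exI[of _ "X + S"]) auto
qed

text \<open>Existence rescales the monic orthogonal polynomials.  For uniqueness, the multiple of
  \<open>p' n\<close> with the leading coefficient of \<open>p n\<close> differs from \<open>p n\<close> by a polynomial of lower
  degree; this difference is orthogonal to both, hence to itself, hence zero.  The norms force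
  the factor to be \<open>1\<close> or \<open>-1\<close> and the signs of the leading coefficients exclude \<open>-1\<close>.\<close>

lemma orthonormal_sequence_ex1:
  fixes L :: "real poly \<Rightarrow> real"
  assumes add: "\<And>p q. L (p + q) = L p + L q" and smult: "\<And>c p. L (Polynomial.smult c p) = c * L p"
    and pos: "\<And>p. p \<noteq> 0 \<Longrightarrow> L (p * p) > 0"
  shows "\<exists>!p. (\<forall>n. degree (p n) = n \<and> 0 < lead_coeff (p n)) \<and>
     (\<forall>n m. L (p n * p m) = (if n = m then L 1 else 0))"
proof (rule ex_ex1I)
  have L1: "L 1 > 0" using pos[of 1] by simp
  obtain q where q: "\<And>n. degree (q n) = n" "\<And>n. lead_coeff (q n) = 1"
    "\<And>n r. (\<forall>i\<ge>n. coeff r i = 0) \<Longrightarrow> L (q n * r) = 0"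
    using orthogonal_monic_exists[of L, OF assms] by metis
  have pos_q: "L (q n * q n) > 0" for n using q(2)[of n] by (intro pos) auto
  define c where "c = (\<lambda>n. sqrt (L 1 / L (q n * q n)))"
  have c: "c n > 0" "c n * c n = L 1 / L (q n * q n)" for n
    using L1 pos_q[of n] by (simp_all add: c_def)
  have orth: "L (q n * q m) = 0" if "n \<noteq> m" for n m
  proof (cases "n < m")
    case True
    then have "\<forall>i\<ge>m. coeff (q n) i = 0" using q(1)[of n] by (auto intro: coeff_eq_0)
    with q(3)[of m "q n"] show ?thesis by (simp add: mult.commute)
  next
    case False
    then have "\<forall>i\<ge>n. coeff (q m) i = 0" using q(1)[of m] that by (auto intro: coeff_eq_0)
    with q(3)[of n "q m"] show ?thesis by simp
  qed
  define p where "p = (\<lambda>n. Polynomial.smult (c n) (q n))"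
  have "L (p n * p m) = (if n = m then L 1 else 0)" for n m
  proof (cases "n = m")
    case True
    have "L (p n * p n) = (c n * c n) * L (q n * q n)" by (simp add: p_def smult)
    then show ?thesis using True c(2)[of n] pos_q[of n] by simp
  qed (simp add: p_def smult orth)
  moreover have "degree (p n) = n" "lead_coeff (p n) > 0" for n
    using c(1)[of n] q(1,2)[of n] by (simp_all add: p_def)
  ultimately show "\<exists>p. (\<forall>n. degree (p n) = n \<and> 0 < lead_coeff (p n)) \<and>
     (\<forall>n m. L (p n * p m) = (if n = m then L 1 else 0))" by blast
next
  fix p p' :: "nat \<Rightarrow> real poly"
  assume p: "(\<forall>n. degree (p n) = n \<and> 0 < lead_coeff (p n)) \<and>
     (\<forall>n m. L (p n * p m) = (if n = m then L 1 else 0))"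
    and p': "(\<forall>n. degree (p' n) = n \<and> 0 < lead_coeff (p' n)) \<and>
     (\<forall>n m. L (p' n * p' m) = (if n = m then L 1 else 0))"
  show "p = p'"
  proof
    fix n
    have dp: "degree (p n) = n" "degree (p' n) = n" and lp: "coeff (p n) n > 0" "coeff (p' n) n > 0"
      using p p' by metis+
    define c where "c = coeff (p n) n / coeff (p' n) n"
    have "c > 0" using lp by (simp add: c_def)
    define d where "d = p n - Polynomial.smult c (p' n)"
    have d: "\<forall>i\<ge>n. coeff d i = 0"
    proof (intro allI impI)
      fix i assume "i \<ge> n"
      then show "coeff d i = 0"
        using dp lp by (cases "i = n") (auto simp: d_def c_def coeff_eq_0)
    qed
    have "L (p n * d) = 0"
    proof (rule orthogonal_lower_degree[of L n p, OF add smult _ _ d])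
      show "degree (p k) = k \<and> lead_coeff (p k) \<noteq> 0" for k using p by (metis less_irrefl)
      show "L (p n * p k) = 0" if "k < n" for k using p that by simp
    qed
    moreover have "L (p' n * d) = 0"
    proof (rule orthogonal_lower_degree[of L n p', OF add smult _ _ d])
      show "degree (p' k) = k \<and> lead_coeff (p' k) \<noteq> 0" for k using p' by (metis less_irrefl)
      show "L (p' n * p' k) = 0" if "k < n" for k using p' that by simp
    qed
    moreover have "d * d = p n * d + Polynomial.smult (- c) (p' n * d)"
    proof -
      have "d * d = (p n - Polynomial.smult c (p' n)) * d" by (simp only: d_def)
      then show ?thesis by (simp add: left_diff_distrib)
    qed
    ultimately have "L (d * d) = 0" by (simp only: add smult)
    then have "d = 0" using pos[of d] by fastforce
    then have pc: "p n = Polynomial.smult c (p' n)" by (simp add: d_def)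
    have "L (p n * p n) = c * (c * L (p' n * p' n))"
      by (simp add: pc smult)
    then have "L 1 = c * c * L 1" using p p' by simp
    then have "c\<^sup>2 = 1" using pos[of 1] by (simp add: power2_eq_square)
    then have "c = 1" using \<open>c > 0\<close> by (simp add: power2_eq_1_iff)
    with pc show "p n = p' n" by simp
  qed
qed

section \<open>Integration of polynomials against a weight\<close>

definition weight_integral :: "(real \<Rightarrow> real) \<Rightarrow> real poly \<Rightarrow> real" where
  "weight_integral w p = (LINT x:{-1..1}|lebesgue. poly p x * w x)"

lemma weight_integrable_poly:
  assumes "weight_function w"
  shows "set_integrable lebesgue {-1..1} (\<lambda>x. poly p x * w x)"
proof -
  have "set_integrable lebesgue {-1..1} (\<lambda>x. coeff p i * (x ^ i * w x))" for i
    using assms unfolding weight_function_def by simp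
  then have "integrable lebesgue (\<lambda>x. \<Sum>i\<le>degree p. indicator {-1..1} x *\<^sub>R (coeff p i * (x ^ i * w x)))"
    unfolding set_integrable_def by (intro Bochner_Integration.integrable_sum) simp
  then show ?thesis
    by (simp add: set_integrable_def poly_altdef sum_distrib_right sum_distrib_left mult_ac)
qed

lemma weight_integral_add:
  "weight_function w \<Longrightarrow> weight_integral w (p + q) = weight_integral w p + weight_integral w q"
  using set_integral_add(2)[OF weight_integrable_poly weight_integrable_poly, of w w p q]
  by (simp add: weight_integral_def distrib_right)

lemma weight_integral_smult: "weight_integral w (Polynomial.smult c p) = c * weight_integral w p"
  by (simp add: weight_integral_def mult.assoc)

text \<open>A nonzero polynomial vanishes only on a finite set, which is negligible.  If the integral
  were zero, the weight would vanish almost everywhere and its total mass would be zero.\<close>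

lemma weight_integral_nonneg_pos:
  assumes w: "weight_function w" and nn: "\<And>x. x \<in> {-1..1} \<Longrightarrow> 0 \<le> poly p x" and "p \<noteq> 0"
  shows "0 < weight_integral w p"
proof (rule ccontr)
  have w0: "\<And>x. x \<in> {-1..1} \<Longrightarrow> 0 \<le> w x" using w by (simp add: weight_function_def)
  assume "\<not> 0 < weight_integral w p"
  moreover have "0 \<le> weight_integral w p"
    unfolding weight_integral_def set_lebesgue_integral_def
    by (intro Bochner_Integration.integral_nonneg) (use nn w0 in \<open>auto simp: indicator_def\<close>)
  ultimately have "integral\<^sup>L lebesgue (\<lambda>x. indicator {-1..1} x *\<^sub>R (poly p x * w x)) = 0"
    by (simp add: weight_integral_def set_lebesgue_integral_def)
  then have "AE x in lebesgue. indicator {-1..1} x *\<^sub>R (poly p x * w x) = 0"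
    using weight_integrable_poly[OF w, of p] nn w0 unfolding set_integrable_def
    by (subst (asm) integral_nonneg_eq_0_iff_AE) (auto simp: indicator_def)
  moreover have "AE x in lebesgue. poly p x \<noteq> 0"
  proof (rule AE_I')
    have "negligible {x. poly p x = 0}"
      using poly_roots_finite[OF \<open>p \<noteq> 0\<close>] by (rule negligible_finite)
    then show "{x. poly p x = 0} \<in> null_sets lebesgue"
      by (simp add: negligible_iff_null_sets)
  qed auto
  ultimately have "AE x in lebesgue. indicator {-1..1} x *\<^sub>R w x = 0"
    by eventually_elim auto
  then have "(LINT x:{-1..1}|lebesgue. w x) = 0"
    unfolding set_lebesgue_integral_def by (intro integral_eq_zero_AE)
  with w show False by (simp add: weight_function_def)
qed

lemma orthonormal_poly:
  assumes "weight_function w"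
  shows "degree (orthonormal_poly w n) = n"
    and "weight_integral w (orthonormal_poly w n * orthonormal_poly w m) = (if n = m then weight_integral w 1 else 0)"
proof -
  have "weight_integral w (p * p) > 0" if "p \<noteq> 0" for p
    using that by (intro weight_integral_nonneg_pos[OF assms]) auto
  moreover have "is_orthonormal_sequence w p \<longleftrightarrow> (\<forall>n. degree (p n) = n \<and> 0 < lead_coeff (p n)) \<and>
     (\<forall>n m. weight_integral w (p n * p m) = (if n = m then weight_integral w 1 else 0))" for p
    unfolding is_orthonormal_sequence_def weight_integral_def poly_mult by simp
  ultimately have "\<exists>!p. is_orthonormal_sequence w p"
    using orthonormal_sequence_ex1[of "weight_integral w", OF weight_integral_add[OF assms] weight_integral_smult]
    by simp
  then have "is_orthonormal_sequence w (orthonormal_poly w)"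
    unfolding orthonormal_poly_def by (rule theI')
  then show "degree (orthonormal_poly w n) = n"
    and "weight_integral w (orthonormal_poly w n * orthonormal_poly w m) = (if n = m then weight_integral w 1 else 0)"
    by (simp_all add: is_orthonormal_sequence_def weight_integral_def)
qed

lemma weight_integral_1_pos: "weight_function w \<Longrightarrow> 0 < weight_integral w 1"
  by (intro weight_integral_nonneg_pos) auto

lemma weight_function_shifted:
  assumes w: "weight_function w"
  shows "weight_function (shifted_weight i j w)"
proof -
  define P :: "real poly" where "P = [:1, -1:] ^ i * [:1, 1:] ^ j"
  have P: "shifted_weight i j w x = poly P x * w x" for x
    by (simp add: shifted_weight_def P_def)
  have "set_integrable lebesgue {-1..1} (\<lambda>x. x ^ n * shifted_weight i j w x)" for n
    using weight_integrable_poly[OF w, of "monom 1 n * P"] by (simp add: P poly_monom mult.assoc)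
  moreover have "0 < weight_integral w P"
    by (intro weight_integral_nonneg_pos[OF w]) (auto simp: P_def)
  ultimately show ?thesis
    using w by (auto simp: weight_function_def weight_integral_def P) (simp add: P_def)
qed

section \<open>The polynomials on the image of the triangle and their trigonometric form\<close>

text \<open>For \<open>k = n\<close> the two summands coincide, and the factor \<open>1 / 2\<close> allows one formula for both
  cases.\<close>

lemma P_minus:
  assumes w: "weight_function w" and "k \<le> n"
  shows "P_minus w k n \<in> polys2 n"
    and "P_minus w k n (s + t) (s * t) = (if k = n then 1 / 2 else 1 / sqrt 2) *
      (orth_eval w n s * orth_eval w k t + orth_eval w n t * orth_eval w k s)"
proof -
  let ?R = "\<lambda>P. \<forall>s t. P (s + t) (s * t) =
        (if k = n then orth_eval w n s * orth_eval w n t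
         else 1 / sqrt 2 *
           (orth_eval w n s * orth_eval w k t + orth_eval w n t * orth_eval w k s))"
  obtain P where P: "P \<in> polys2 n"
    "\<And>s t. P (s + t) (s * t) = orth_eval w n s * orth_eval w k t + orth_eval w n t * orth_eval w k s"
    using polys2_symmetrize[of "orthonormal_poly w n" n "orthonormal_poly w k"] orthonormal_poly(1)[OF w] \<open>k \<le> n\<close> by auto
  define P' where "P' = (\<lambda>u v. (if k = n then 1 / 2 else 1 / sqrt 2) * P u v)"
  have P'_in: "P' \<in> polys2 n" unfolding P'_def by (rule polys2_scale[OF P(1)])
  have P'_val: "P' (s + t) (s * t) = (if k = n then 1 / 2 else 1 / sqrt 2) *
      (orth_eval w n s * orth_eval w k t + orth_eval w n t * orth_eval w k s)" for s t
    by (simp add: P'_def P)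
  then have "?R P'" by simp
  have "P_minus w k n = P'"
    unfolding P_minus_def
  proof (rule the_equality)
    show "(\<exists>d. P' \<in> polys2 d) \<and> ?R P'" using P'_in \<open>?R P'\<close> by blast
  next
    fix Q assume "(\<exists>d. Q \<in> polys2 d) \<and> ?R Q"
    then obtain d where "Q \<in> polys2 d" "?R Q" by blast
    then show "Q = P'"
      using \<open>?R P'\<close> by (intro polys2_eqI[OF _ P'_in]) simp_all
  qed
  with P'_in P'_val show "P_minus w k n \<in> polys2 n"
    "P_minus w k n (s + t) (s * t) = (if k = n then 1 / 2 else 1 / sqrt 2) *
      (orth_eval w n s * orth_eval w k t + orth_eval w n t * orth_eval w k s)" by simp_all
qed

text \<open>The values are stated without the division by \<open>s - t\<close>, which makes the formula valid on
  the diagonal too and is the form that enters inner products, where the kernel for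
  \<open>\<gamma> = 1/2\<close> supplies the factor \<open>(s - t)\<^sup>2\<close>.\<close>

lemma P_plus:
  assumes w: "weight_function w" and "k \<le> n"
  shows "P_plus w k n \<in> polys2 n"
    and "P_plus w k n (s + t) (s * t) * (s - t) = sqrt (a_const (-1/2) w / (2 * a_const (1/2) w)) *
      (orth_eval w (n + 1) s * orth_eval w k t - orth_eval w (n + 1) t * orth_eval w k s)"
proof -
  let ?c = "sqrt (a_const (-1/2) w / (2 * a_const (1/2) w))"
  let ?R = "\<lambda>P. \<forall>s t. s \<noteq> t \<longrightarrow> P (s + t) (s * t) = ?c *
        ((orth_eval w (n + 1) s * orth_eval w k t - orth_eval w (n + 1) t * orth_eval w k s) / (s - t))"
  obtain P where P: "P \<in> polys2 n"
    "\<And>s t. P (s + t) (s * t) * (s - t)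
        = orth_eval w (n + 1) s * orth_eval w k t - orth_eval w (n + 1) t * orth_eval w k s"
    using polys2_divided_antisymmetrization[of "orthonormal_poly w (n + 1)" n "orthonormal_poly w k"]
      orthonormal_poly(1)[OF w] \<open>k \<le> n\<close> by auto
  define P' where "P' = (\<lambda>u v. ?c * P u v)"
  have P'_in: "P' \<in> polys2 n" unfolding P'_def by (rule polys2_scale[OF P(1)])
  have P'_val: "P' (s + t) (s * t) * (s - t) = ?c *
      (orth_eval w (n + 1) s * orth_eval w k t - orth_eval w (n + 1) t * orth_eval w k s)" for s t
    by (simp add: P'_def mult.assoc P(2)[unfolded Suc_eq_plus1])
  have "?R P'"
  proof (intro allI impI)
    fix s t :: real assume "s \<noteq> t"
    then have "P' (s + t) (s * t) = (P' (s + t) (s * t) * (s - t)) / (s - t)" by simp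
    then show "P' (s + t) (s * t) = ?c *
        ((orth_eval w (n + 1) s * orth_eval w k t - orth_eval w (n + 1) t * orth_eval w k s) / (s - t))"
      unfolding P'_val by simp
  qed
  have "P_plus w k n = P'"
    unfolding P_plus_def
  proof (rule the_equality)
    show "(\<exists>d. P' \<in> polys2 d) \<and> ?R P'" using P'_in \<open>?R P'\<close> by blast
  next
    fix Q assume "(\<exists>d. Q \<in> polys2 d) \<and> ?R Q"
    then obtain d where "Q \<in> polys2 d" "?R Q" by blast
    then show "Q = P'"
      using \<open>?R P'\<close> by (intro polys2_eqI[OF _ P'_in]) simp_all
  qed
  with P'_in P'_val show "P_plus w k n \<in> polys2 n"
    "P_plus w k n (s + t) (s * t) * (s - t) = ?c *
      (orth_eval w (n + 1) s * orth_eval w k t - orth_eval w (n + 1) t * orth_eval w k s)" by simp_all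
qed

lemma P_gamma_in_polys2: "weight_function w \<Longrightarrow> k \<le> n \<Longrightarrow> P_gamma \<gamma> w k n \<in> polys2 n"
  by (simp add: P_gamma_def P_minus(1) P_plus(1))

text \<open>The substitution that turns \<open>(2 * x * y, x\<^sup>2 + y\<^sup>2 - 1)\<close> into \<open>(s + t, s * t)\<close> with
  \<open>s = cos (\<theta> - \<phi>)\<close> and \<open>t = cos (\<theta> + \<phi>)\<close>; the explicit formulas follow from it by
  inserting these values into the definition of \<open>P\<^sub>k\<^sub>,\<^sub>n\<close>.\<close>

lemma cos_sum_prod:
  "2 * cos \<theta> * cos \<phi> = cos (\<theta> - \<phi>) + cos (\<theta> + \<phi>)"
  "(cos \<theta>)\<^sup>2 + (cos \<phi>)\<^sup>2 - 1 = cos (\<theta> - \<phi>) * cos (\<theta> + \<phi>)"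
  "cos (\<theta> - \<phi>) - cos (\<theta> + \<phi>) = 2 * sin \<theta> * sin \<phi>" for \<theta> \<phi> :: real
proof -
  show "2 * cos \<theta> * cos \<phi> = cos (\<theta> - \<phi>) + cos (\<theta> + \<phi>)" "cos (\<theta> - \<phi>) - cos (\<theta> + \<phi>) = 2 * sin \<theta> * sin \<phi>"
    by (simp_all add: cos_diff cos_add)
  have "cos (\<theta> - \<phi>) * cos (\<theta> + \<phi>) = (cos \<theta>)\<^sup>2 * (cos \<phi>)\<^sup>2 - (sin \<theta>)\<^sup>2 * (sin \<phi>)\<^sup>2"
    by (simp add: cos_diff cos_add algebra_simps power2_eq_square)
  then show "(cos \<theta>)\<^sup>2 + (cos \<phi>)\<^sup>2 - 1 = cos (\<theta> - \<phi>) * cos (\<theta> + \<phi>)"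
    by (simp add: sin_squared_eq algebra_simps)
qed

lemma P_gamma_minus_trig:
  assumes "weight_function w" "k \<le> n"
  shows "P_gamma (-1/2) w k n (2 * cos \<theta> * cos \<phi>) ((cos \<theta>)\<^sup>2 + (cos \<phi>)\<^sup>2 - 1) =
    (if k = n then 1 / sqrt 2 else 1) * (1 / sqrt 2 *
      (orth_eval w n (cos (\<theta> - \<phi>)) * orth_eval w k (cos (\<theta> + \<phi>)) +
       orth_eval w k (cos (\<theta> - \<phi>)) * orth_eval w n (cos (\<theta> + \<phi>))))"
  unfolding cos_sum_prod P_gamma_def by (simp add: P_minus(2)[OF assms] mult.commute)

lemma P_gamma_plus_trig:
  assumes "weight_function w" "k \<le> n" and "sin \<theta> * sin \<phi> \<noteq> 0"
  shows "P_gamma (1/2) w k n (2 * cos \<theta> * cos \<phi>) ((cos \<theta>)\<^sup>2 + (cos \<phi>)\<^sup>2 - 1) =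
    sqrt (a_const (-1/2) w / (2 * a_const (1/2) w)) *
      ((orth_eval w (n + 1) (cos (\<theta> - \<phi>)) * orth_eval w k (cos (\<theta> + \<phi>)) -
        orth_eval w k (cos (\<theta> - \<phi>)) * orth_eval w (n + 1) (cos (\<theta> + \<phi>))) / (2 * sin \<theta> * sin \<phi>))"
proof -
  have "2 * sin \<theta> * sin \<phi> \<noteq> 0" using assms by simp
  with P_plus(2)[OF assms(1,2), of "cos (\<theta> - \<phi>)" "cos (\<theta> + \<phi>)"] show ?thesis
    unfolding cos_sum_prod P_gamma_def by (simp add: eq_divide_eq mult.commute[of "orth_eval w k (cos (\<theta> - \<phi>))"])
qed

section \<open>Integrals of periodic functions\<close>

lemma nn_integral_interval_split:
  fixes f :: "real \<Rightarrow> ennreal"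
  assumes [measurable]: "f \<in> borel_measurable borel" and "a \<le> b" "b \<le> c"
  shows "(\<integral>\<^sup>+x\<in>{a..c}. f x \<partial>lborel) = (\<integral>\<^sup>+x\<in>{a..b}. f x \<partial>lborel) + (\<integral>\<^sup>+x\<in>{b..c}. f x \<partial>lborel)"
proof -
  have "(\<integral>\<^sup>+x\<in>{a..c}. f x \<partial>lborel) = (\<integral>\<^sup>+x. f x * indicator {a..b} x + f x * indicator {b..c} x \<partial>lborel)"
  proof (rule nn_integral_cong_AE)
    show "AE x in lborel. f x * indicator {a..c} x = f x * indicator {a..b} x + f x * indicator {b..c} x"
      using AE_lborel_singleton[of b] by eventually_elim (use assms in \<open>auto simp: indicator_def\<close>)
  qed
  then show ?thesis by (simp add: nn_integral_add)
qed

lemma nn_integral_interval_affine: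
  fixes f :: "real \<Rightarrow> ennreal"
  assumes [measurable]: "f \<in> borel_measurable borel" and "c > 0"
  shows "(\<integral>\<^sup>+x\<in>{c * a + t..c * b + t}. f x \<partial>lborel) = ennreal c * (\<integral>\<^sup>+x\<in>{a..b}. f (c * x + t) \<partial>lborel)"
proof -
  have "(\<integral>\<^sup>+x\<in>{c * a + t..c * b + t}. f x \<partial>lborel)
      = ennreal c * (\<integral>\<^sup>+x. f (t + c * x) * indicator {c * a + t..c * b + t} (t + c * x) \<partial>lborel)"
    using \<open>c > 0\<close> by (subst nn_integral_real_affine[of _ c t]) auto
  also have "(\<integral>\<^sup>+x. f (t + c * x) * indicator {c * a + t..c * b + t} (t + c * x) \<partial>lborel)
      = (\<integral>\<^sup>+x\<in>{a..b}. f (c * x + t) \<partial>lborel)"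
    using \<open>c > 0\<close> by (intro nn_integral_cong) (auto simp: indicator_def add.commute)
  finally show ?thesis .
qed

lemma nn_integral_interval_reflect:
  fixes f :: "real \<Rightarrow> ennreal"
  assumes [measurable]: "f \<in> borel_measurable borel"
  shows "(\<integral>\<^sup>+x\<in>{t - b..t - a}. f x \<partial>lborel) = (\<integral>\<^sup>+x\<in>{a..b}. f (t - x) \<partial>lborel)"
  by (subst nn_integral_real_affine[of _ "-1" t]) (auto intro!: nn_integral_cong simp: indicator_def)

text \<open>After reducing the shift modulo the period, cut the shifted interval at \<open>p\<close> and move the
  part beyond it back by one period.\<close>

lemma nn_integral_period_shift:
  fixes f :: "real \<Rightarrow> ennreal"
  assumes [measurable]: "f \<in> borel_measurable borel" and "p > 0" and per: "\<And>x. f (x + p) = f x"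
  shows "(\<integral>\<^sup>+x\<in>{0..p}. f (x + c) \<partial>lborel) = (\<integral>\<^sup>+x\<in>{0..p}. f x \<partial>lborel)"
proof -
  have pern: "f (x + of_nat n * p) = f x" for x n
  proof (induction n)
    case (Suc n)
    have "f (x + of_nat (Suc n) * p) = f ((x + of_nat n * p) + p)" by (simp add: algebra_simps)
    then show ?case using Suc by (simp add: per)
  qed simp
  have peri: "f (x + of_int k * p) = f x" for x k
  proof (cases "k \<ge> 0")
    case True
    then show ?thesis using pern[of x "nat k"] by simp
  next
    case False
    then show ?thesis using pern[of "x + of_int k * p" "nat (- k)"] by simp
  qed
  define r where "r = c - of_int \<lfloor>c / p\<rfloor> * p"
  have "0 \<le> r"
    using floor_divide_lower[OF \<open>p > 0\<close>, of c] by (simp add: r_def)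
  have "r \<le> p"
    using floor_divide_upper[OF \<open>p > 0\<close>, of c] by (simp add: r_def algebra_simps)
  have "(\<integral>\<^sup>+x\<in>{0..p}. f (x + c) \<partial>lborel) = (\<integral>\<^sup>+x\<in>{0..p}. f (x + r) \<partial>lborel)"
    using peri[of "_ + r" "\<lfloor>c / p\<rfloor>"] by (simp add: r_def algebra_simps)
  also have "\<dots> = (\<integral>\<^sup>+x\<in>{r..p + r}. f x \<partial>lborel)"
    using nn_integral_interval_affine[of f 1 0 r p] by simp
  also have "\<dots> = (\<integral>\<^sup>+x\<in>{r..p}. f x \<partial>lborel) + (\<integral>\<^sup>+x\<in>{p..p + r}. f x \<partial>lborel)"
    using \<open>0 \<le> r\<close> \<open>r \<le> p\<close> by (intro nn_integral_interval_split) auto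
  also have "(\<integral>\<^sup>+x\<in>{p..p + r}. f x \<partial>lborel) = (\<integral>\<^sup>+x\<in>{0..r}. f x \<partial>lborel)"
    using nn_integral_interval_affine[of f 1 0 p r] by (simp add: per add.commute)
  also have "(\<integral>\<^sup>+x\<in>{r..p}. f x \<partial>lborel) + \<dots> = (\<integral>\<^sup>+x\<in>{0..p}. f x \<partial>lborel)"
    using \<open>0 \<le> r\<close> \<open>r \<le> p\<close> by (subst (3) nn_integral_interval_split[of _ _ r]) (auto simp: add.commute)
  finally show ?thesis .
qed

lemma ennreal_two_cancel: "2 * a = 2 * (b :: ennreal) \<Longrightarrow> a = b"
  by (simp add: ennreal_mult_cancel_left)

lemma nn_integral_period_double:
  fixes f :: "real \<Rightarrow> ennreal"
  assumes [measurable]: "f \<in> borel_measurable borel" and "p > 0" and per: "\<And>x. f (x + p) = f x"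
  shows "(\<integral>\<^sup>+x\<in>{0..p}. f (2 * x + c) \<partial>lborel) = (\<integral>\<^sup>+x\<in>{0..p}. f x \<partial>lborel)"
proof -
  have "2 * (\<integral>\<^sup>+x\<in>{0..p}. f (2 * x + c) \<partial>lborel) = (\<integral>\<^sup>+x\<in>{c..2 * p + c}. f x \<partial>lborel)"
    using nn_integral_interval_affine[of f 2 0 c p] by simp
  also have "\<dots> = (\<integral>\<^sup>+x\<in>{c..p + c}. f x \<partial>lborel) + (\<integral>\<^sup>+x\<in>{p + c..2 * p + c}. f x \<partial>lborel)"
    using \<open>p > 0\<close> by (intro nn_integral_interval_split) auto
  also have "(\<integral>\<^sup>+x\<in>{c..p + c}. f x \<partial>lborel) = (\<integral>\<^sup>+x\<in>{0..p}. f x \<partial>lborel)"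
    using nn_integral_interval_affine[of f 1 0 c p] nn_integral_period_shift[OF assms, of c] by simp
  also have "(\<integral>\<^sup>+x\<in>{p + c..2 * p + c}. f x \<partial>lborel) = (\<integral>\<^sup>+x\<in>{0..p}. f x \<partial>lborel)"
    using nn_integral_interval_affine[of f 1 0 "p + c" p] nn_integral_period_shift[OF assms, of "p + c"]
    by (simp add: add.assoc)
  finally show ?thesis by (simp add: ennreal_two_cancel mult_2[symmetric])
qed

lemma nn_integral_even_period:
  fixes f :: "real \<Rightarrow> ennreal"
  assumes [measurable]: "f \<in> borel_measurable borel" and "p > 0"
    and per: "\<And>x. f (x + 2 * p) = f x" and even: "\<And>x. f (- x) = f x"
  shows "(\<integral>\<^sup>+x\<in>{0..2 * p}. f x \<partial>lborel) = 2 * (\<integral>\<^sup>+x\<in>{0..p}. f x \<partial>lborel)"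
proof -
  have refl: "f (2 * p - x) = f x" for x
    using per[of "- x"] even[of x] by (simp add: add.commute)
  have "(\<integral>\<^sup>+x\<in>{0..2 * p}. f x \<partial>lborel) = (\<integral>\<^sup>+x\<in>{0..p}. f x \<partial>lborel) + (\<integral>\<^sup>+x\<in>{p..2 * p}. f x \<partial>lborel)"
    using \<open>p > 0\<close> by (intro nn_integral_interval_split) auto
  also have "(\<integral>\<^sup>+x\<in>{p..2 * p}. f x \<partial>lborel) = (\<integral>\<^sup>+x\<in>{0..p}. f x \<partial>lborel)"
    using nn_integral_interval_reflect[of f "2 * p" p 0] by (simp add: refl)
  finally show ?thesis unfolding mult_2[symmetric] .
qed

lemma nn_integral_rectangle:
  fixes f :: "real \<Rightarrow> real \<Rightarrow> ennreal"
  assumes m: "(\<lambda>(x, y). f x y) \<in> borel_measurable (borel \<Otimes>\<^sub>M borel)"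
    and [measurable]: "A \<in> sets borel" "B \<in> sets borel"
  shows "(\<integral>\<^sup>+x\<in>A. (\<integral>\<^sup>+y\<in>B. f x y \<partial>lborel) \<partial>lborel) = (\<integral>\<^sup>+z\<in>A \<times> B. (case z of (x, y) \<Rightarrow> f x y) \<partial>lborel)"
    and "(\<integral>\<^sup>+y\<in>B. (\<integral>\<^sup>+x\<in>A. f x y \<partial>lborel) \<partial>lborel) = (\<integral>\<^sup>+z\<in>A \<times> B. (case z of (x, y) \<Rightarrow> f x y) \<partial>lborel)"
proof -
  have [measurable]: "(\<lambda>z. case z of (x, y) \<Rightarrow> f x y) \<in> borel_measurable (lborel \<Otimes>\<^sub>M lborel)"
    using m by (simp cong: measurable_cong_sets)
  have [measurable]: "f x \<in> borel_measurable borel" "(\<lambda>x. f x y) \<in> borel_measurable borel" for x y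
    using measurable_compose[OF measurable_Pair1' m, of x] measurable_compose[OF measurable_Pair2' m, of y] by simp_all
  have F: "(\<lambda>z. (case z of (x, y) \<Rightarrow> f x y) * indicator (A \<times> B) z) \<in> borel_measurable (lborel \<Otimes>\<^sub>M lborel)"
    by measurable
  show "(\<integral>\<^sup>+x\<in>A. (\<integral>\<^sup>+y\<in>B. f x y \<partial>lborel) \<partial>lborel) = (\<integral>\<^sup>+z\<in>A \<times> B. (case z of (x, y) \<Rightarrow> f x y) \<partial>lborel)"
    unfolding lborel_prod[symmetric] lborel.nn_integral_fst[OF F, symmetric]
    by (intro nn_integral_cong) (simp add: indicator_times mult_ac flip: nn_integral_multc nn_integral_cmult)
  show "(\<integral>\<^sup>+y\<in>B. (\<integral>\<^sup>+x\<in>A. f x y \<partial>lborel) \<partial>lborel) = (\<integral>\<^sup>+z\<in>A \<times> B. (case z of (x, y) \<Rightarrow> f x y) \<partial>lborel)"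
    unfolding lborel_prod[symmetric] lborel_pair.nn_integral_snd[OF F, symmetric]
    by (intro nn_integral_cong) (simp add: indicator_times mult_ac flip: nn_integral_multc nn_integral_cmult)
qed

text \<open>The map \<open>(\<theta>, \<phi>) \<mapsto> (\<theta> - \<phi>, \<theta> + \<phi>)\<close> preserves Haar measure on the torus.  By Fubini it
  factors into the shift \<open>\<theta> \<mapsto> \<theta> + \<phi>\<close> for fixed \<open>\<phi>\<close> and the map \<open>\<phi> \<mapsto> \<theta> + 2 * \<phi>\<close> for fixed
  \<open>\<theta>\<close>, and both preserve integrals over a period.  Evenness and symmetry of \<open>H\<close> make both
  integrands even in each variable, so that each integral over \<open>[0, p]\<^sup>2\<close> is a quarter of one
  over the torus.\<close>

lemma nn_integral_torus_rotation:
  fixes H :: "real \<Rightarrow> real \<Rightarrow> ennreal"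
  assumes [measurable]: "(\<lambda>(a, b). H a b) \<in> borel_measurable (borel \<Otimes>\<^sub>M borel)"
    and p: "p > 0"
    and per: "\<And>a b. H (a + 2 * p) b = H a b" and even: "\<And>a b. H (- a) b = H a b"
    and sym: "\<And>a b. H a b = H b a"
  shows "(\<integral>\<^sup>+\<theta>\<in>{0..p}. (\<integral>\<^sup>+\<phi>\<in>{0..p}. H (\<theta> - \<phi>) (\<theta> + \<phi>) \<partial>lborel) \<partial>lborel)
       = (\<integral>\<^sup>+\<theta>\<in>{0..p}. (\<integral>\<^sup>+\<phi>\<in>{0..p}. H \<theta> \<phi> \<partial>lborel) \<partial>lborel)"
proof -
  have H_comp: "(\<lambda>x. H (f x) (g x)) \<in> borel_measurable M"
    if [measurable]: "f \<in> borel_measurable M" "g \<in> borel_measurable M" for f g and M :: "'z measure"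
  proof -
    have "(\<lambda>x. (\<lambda>(a, b). H a b) (f x, g x)) \<in> borel_measurable M" by measurable
    then show ?thesis by simp
  qed
  note [measurable] = H_comp
  have per2: "H a (b + 2 * p) = H a b" for a b by (metis per sym)
  have even2: "H a (- b) = H a b" for a b by (metis even sym)
  \<comment> \<open>for \<open>K\<close> even and periodic in each variable; applied below to \<open>H\<close> and to the rotated \<open>H\<close>\<close>
  have quarter: "(\<integral>\<^sup>+\<theta>\<in>{0..2 * p}. (\<integral>\<^sup>+\<phi>\<in>{0..2 * p}. K \<theta> \<phi> \<partial>lborel) \<partial>lborel)
      = 2 * (2 * (\<integral>\<^sup>+\<theta>\<in>{0..p}. (\<integral>\<^sup>+\<phi>\<in>{0..p}. K \<theta> \<phi> \<partial>lborel) \<partial>lborel))"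
    if m: "(\<lambda>(a, b). K a b) \<in> borel_measurable (borel \<Otimes>\<^sub>M borel)"
      and K: "\<And>a b. K (a + 2 * p) b = K a b" "\<And>a b. K (- a) b = K a b"
        "\<And>a b. K a (b + 2 * p) = K a b" "\<And>a b. K a (- b) = K a b"
    for K :: "real \<Rightarrow> real \<Rightarrow> ennreal"
  proof -
    have [measurable]: "(\<lambda>b. K a b) \<in> borel_measurable borel" for a
      using measurable_compose[OF measurable_Pair1' m, of a] by simp
    have m'[measurable]: "(\<lambda>(a, b). K a b) \<in> borel_measurable (borel \<Otimes>\<^sub>M lborel)"
      using m by (simp cong: measurable_cong_sets)
    have inner: "(\<integral>\<^sup>+\<phi>\<in>{0..2 * p}. K \<theta> \<phi> \<partial>lborel) = 2 * (\<integral>\<^sup>+\<phi>\<in>{0..p}. K \<theta> \<phi> \<partial>lborel)" for \<theta>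
      using p by (intro nn_integral_even_period) (auto simp: K)
    have [measurable]: "(\<lambda>\<theta>. \<integral>\<^sup>+\<phi>\<in>{0..p}. K \<theta> \<phi> \<partial>lborel) \<in> borel_measurable borel"
      by measurable
    have "(\<integral>\<^sup>+\<theta>\<in>{0..2 * p}. (\<integral>\<^sup>+\<phi>\<in>{0..2 * p}. K \<theta> \<phi> \<partial>lborel) \<partial>lborel)
        = 2 * (\<integral>\<^sup>+\<theta>\<in>{0..2 * p}. (\<integral>\<^sup>+\<phi>\<in>{0..p}. K \<theta> \<phi> \<partial>lborel) \<partial>lborel)"
      by (subst nn_integral_cmult[symmetric]) (auto simp: inner mult.assoc intro!: nn_integral_cong)
    also have "(\<integral>\<^sup>+\<theta>\<in>{0..2 * p}. (\<integral>\<^sup>+\<phi>\<in>{0..p}. K \<theta> \<phi> \<partial>lborel) \<partial>lborel)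
        = 2 * (\<integral>\<^sup>+\<theta>\<in>{0..p}. (\<integral>\<^sup>+\<phi>\<in>{0..p}. K \<theta> \<phi> \<partial>lborel) \<partial>lborel)"
      using p by (intro nn_integral_even_period) (auto simp: K)
    finally show ?thesis .
  qed
  have "2 * (2 * (\<integral>\<^sup>+\<theta>\<in>{0..p}. (\<integral>\<^sup>+\<phi>\<in>{0..p}. H (\<theta> - \<phi>) (\<theta> + \<phi>) \<partial>lborel) \<partial>lborel))
      = (\<integral>\<^sup>+\<theta>\<in>{0..2 * p}. (\<integral>\<^sup>+\<phi>\<in>{0..2 * p}. H (\<theta> - \<phi>) (\<theta> + \<phi>) \<partial>lborel) \<partial>lborel)"
  proof (rule quarter[symmetric])
    fix a b
    show "H (a + 2 * p - b) (a + 2 * p + b) = H (a - b) (a + b)"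
      using per[of "a - b" "a + 2 * p + b"] per2[of "a - b" "a + b"] by (simp add: algebra_simps)
    show "H (- a - b) (- a + b) = H (a - b) (a + b)"
      using even[of "a + b" "- a + b"] even2[of "a + b" "a - b"] sym[of "a + b" "a - b"]
      by (simp add: algebra_simps)
    show "H (a - (b + 2 * p)) (a + (b + 2 * p)) = H (a - b) (a + b)"
      using per[of "a - (b + 2 * p)" "a + b + 2 * p"] per2[of "a - b" "a + b"] by (simp add: algebra_simps)
    show "H (a - - b) (a + - b) = H (a - b) (a + b)"
      using sym[of "a + b" "a - b"] by simp
  qed measurable
  also have "\<dots> = (\<integral>\<^sup>+\<phi>\<in>{0..2 * p}. (\<integral>\<^sup>+\<theta>\<in>{0..2 * p}. H (\<theta> - \<phi>) (\<theta> + \<phi>) \<partial>lborel) \<partial>lborel)"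
    by (subst (1 2) nn_integral_rectangle) auto
  also have "\<dots> = (\<integral>\<^sup>+\<phi>\<in>{0..2 * p}. (\<integral>\<^sup>+\<theta>\<in>{0..2 * p}. H \<theta> (\<theta> + 2 * \<phi>) \<partial>lborel) \<partial>lborel)"
  proof -
    have "(\<integral>\<^sup>+\<theta>\<in>{0..2 * p}. H (\<theta> - \<phi>) (\<theta> + \<phi>) \<partial>lborel) = (\<integral>\<^sup>+\<theta>\<in>{0..2 * p}. H \<theta> (\<theta> + 2 * \<phi>) \<partial>lborel)" for \<phi>
    proof -
      have "H (x + 2 * p - \<phi>) (x + 2 * p + \<phi>) = H (x - \<phi>) (x + \<phi>)" for x
        using per[of "x - \<phi>" "x + 2 * p + \<phi>"] per2[of "x - \<phi>" "x + \<phi>"] by (simp add: algebra_simps)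
      then have "(\<integral>\<^sup>+\<theta>\<in>{0..2 * p}. H (\<theta> - \<phi>) (\<theta> + \<phi>) \<partial>lborel)
          = (\<integral>\<^sup>+\<theta>\<in>{0..2 * p}. H (\<theta> + \<phi> - \<phi>) (\<theta> + \<phi> + \<phi>) \<partial>lborel)"
        using p by (intro nn_integral_period_shift[symmetric]) auto
      moreover have "\<theta> + \<phi> + \<phi> = \<theta> + 2 * \<phi>" for \<theta> by simp
      ultimately show ?thesis by simp
    qed
    then show ?thesis by simp
  qed
  also have "\<dots> = (\<integral>\<^sup>+\<theta>\<in>{0..2 * p}. (\<integral>\<^sup>+\<phi>\<in>{0..2 * p}. H \<theta> (\<theta> + 2 * \<phi>) \<partial>lborel) \<partial>lborel)"
    by (subst (1 2) nn_integral_rectangle) auto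
  also have "\<dots> = (\<integral>\<^sup>+\<theta>\<in>{0..2 * p}. (\<integral>\<^sup>+\<phi>\<in>{0..2 * p}. H \<theta> \<phi> \<partial>lborel) \<partial>lborel)"
  proof -
    have "(\<integral>\<^sup>+\<phi>\<in>{0..2 * p}. H \<theta> (\<theta> + 2 * \<phi>) \<partial>lborel) = (\<integral>\<^sup>+\<phi>\<in>{0..2 * p}. H \<theta> \<phi> \<partial>lborel)" for \<theta>
    proof -
      have "(\<integral>\<^sup>+\<phi>\<in>{0..2 * p}. H \<theta> (2 * \<phi> + \<theta>) \<partial>lborel) = (\<integral>\<^sup>+\<phi>\<in>{0..2 * p}. H \<theta> \<phi> \<partial>lborel)"
      proof (rule nn_integral_period_double[of "H \<theta>" "2 * p" \<theta>])
        show "H \<theta> \<in> borel_measurable borel"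
          using measurable_compose[OF measurable_Pair1' assms(1), of \<theta>] by simp
        show "H \<theta> (x + 2 * p) = H \<theta> x" for x by (rule per2)
      qed (use p in simp)
      then show ?thesis by (subst add.commute)
    qed
    then show ?thesis by simp
  qed
  also have "\<dots> = 2 * (2 * (\<integral>\<^sup>+\<theta>\<in>{0..p}. (\<integral>\<^sup>+\<phi>\<in>{0..p}. H \<theta> \<phi> \<partial>lborel) \<partial>lborel))"
    by (intro quarter) (auto simp: per per2 even even2)
  finally show ?thesis by (blast dest: ennreal_two_cancel)
qed

section \<open>The quadratic change of variables\<close>

lemma nn_integral_cos_substitution:
  fixes f :: "real \<Rightarrow> ennreal"
  assumes [measurable]: "f \<in> borel_measurable borel"
  shows "(\<integral>\<^sup>+x\<in>{-1..1}. f x \<partial>lborel) = (\<integral>\<^sup>+\<theta>\<in>{0..pi}. f (cos \<theta>) * ennreal \<bar>sin \<theta>\<bar> \<partial>lborel)"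
proof -
  \<comment> \<open>the substitution rule asks for an increasing function, here \<open>- cos\<close>\<close>
  have "(\<integral>\<^sup>+x\<in>{-1..1}. f x \<partial>lborel) = (\<integral>\<^sup>+x\<in>{-1..1}. f (- x) \<partial>lborel)"
    using nn_integral_interval_reflect[of f 0 1 "-1"] by simp
  also have "\<dots> = (\<integral>\<^sup>+x. f (- x) * indicator {- cos 0..- cos pi} x \<partial>lborel)"
    by simp
  also have "\<dots> = (\<integral>\<^sup>+\<theta>. f (- (- cos \<theta>)) * ennreal (sin \<theta>) * indicator {0..pi} \<theta> \<partial>lborel)"
    by (rule nn_integral_substitution_aux)
      (auto intro!: derivative_eq_intros continuous_intros simp: sin_ge_zero)
  also have "\<dots> = (\<integral>\<^sup>+\<theta>\<in>{0..pi}. f (cos \<theta>) * ennreal \<bar>sin \<theta>\<bar> \<partial>lborel)"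
    by (intro nn_integral_cong) (auto simp: indicator_def sin_ge_zero)
  finally show ?thesis .
qed

lemma nn_integral_square_cos_substitution:
  fixes F :: "real \<Rightarrow> real \<Rightarrow> ennreal"
  assumes m: "(\<lambda>(x, y). F x y) \<in> borel_measurable (borel \<Otimes>\<^sub>M borel)"
  shows "(\<integral>\<^sup>+z\<in>{-1..1} \<times> {-1..1}. (case z of (x, y) \<Rightarrow> F x y) \<partial>lborel)
    = (\<integral>\<^sup>+\<theta>\<in>{0..pi}. (\<integral>\<^sup>+\<phi>\<in>{0..pi}. F (cos \<theta>) (cos \<phi>) * ennreal (\<bar>sin \<theta>\<bar> * \<bar>sin \<phi>\<bar>) \<partial>lborel) \<partial>lborel)"
proof -
  have [measurable]: "F x \<in> borel_measurable borel" for x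
    using measurable_compose[OF measurable_Pair1' m, of x] by simp
  have [measurable]: "(\<lambda>(x, y). F x y) \<in> borel_measurable (borel \<Otimes>\<^sub>M lborel)"
    using m by (simp cong: measurable_cong_sets)
  have "(\<integral>\<^sup>+z\<in>{-1..1} \<times> {-1..1}. (case z of (x, y) \<Rightarrow> F x y) \<partial>lborel)
      = (\<integral>\<^sup>+x\<in>{-1..1}. (\<integral>\<^sup>+y\<in>{-1..1}. F x y \<partial>lborel) \<partial>lborel)"
    using m by (simp add: nn_integral_rectangle)
  also have "\<dots> = (\<integral>\<^sup>+\<theta>\<in>{0..pi}. (\<integral>\<^sup>+y\<in>{-1..1}. F (cos \<theta>) y \<partial>lborel) * ennreal \<bar>sin \<theta>\<bar> \<partial>lborel)"
    by (intro nn_integral_cos_substitution) measurable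
  moreover have "(\<integral>\<^sup>+y\<in>{-1..1}. F (cos \<theta>) y \<partial>lborel) * ennreal \<bar>sin \<theta>\<bar>
      = (\<integral>\<^sup>+\<phi>\<in>{0..pi}. F (cos \<theta>) (cos \<phi>) * ennreal (\<bar>sin \<theta>\<bar> * \<bar>sin \<phi>\<bar>) \<partial>lborel)" for \<theta>
  proof (subst nn_integral_cos_substitution)
    show "(\<integral>\<^sup>+\<phi>\<in>{0..pi}. F (cos \<theta>) (cos \<phi>) * ennreal \<bar>sin \<phi>\<bar> \<partial>lborel) * ennreal \<bar>sin \<theta>\<bar>
        = (\<integral>\<^sup>+\<phi>\<in>{0..pi}. F (cos \<theta>) (cos \<phi>) * ennreal (\<bar>sin \<theta>\<bar> * \<bar>sin \<phi>\<bar>) \<partial>lborel)"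
      by (subst nn_integral_multc[symmetric]) (auto simp: ennreal_mult mult_ac)
  qed measurable
  ultimately show ?thesis by simp
qed

text \<open>For \<open>(x, y)\<close> in the square, \<open>large_root x y\<close> and \<open>small_root x y\<close> are the roots of
  \<open>z\<^sup>2 - u * z + v\<close> with \<open>u = 2 * x * y\<close> and \<open>v = x\<^sup>2 + y\<^sup>2 - 1\<close>, that is, the numbers
  \<open>s\<close> and \<open>t\<close> with \<open>(s + t, s * t) = (u, v)\<close>.\<close>

definition large_root :: "real \<Rightarrow> real \<Rightarrow> real" where
  "large_root x y = x * y + sqrt ((1 - x\<^sup>2) * (1 - y\<^sup>2))"

definition small_root :: "real \<Rightarrow> real \<Rightarrow> real" where
  "small_root x y = x * y - sqrt ((1 - x\<^sup>2) * (1 - y\<^sup>2))"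

lemma measurable_roots [measurable]:
  "case_prod large_root \<in> borel_measurable borel" "case_prod small_root \<in> borel_measurable borel"
  unfolding large_root_def small_root_def case_prod_beta
  by (intro borel_measurable_continuous_onI continuous_intros)+

lemma roots_cos:
  assumes "\<theta> \<in> {0..pi}" "\<phi> \<in> {0..pi}"
  shows "large_root (cos \<theta>) (cos \<phi>) = cos (\<theta> - \<phi>)" "small_root (cos \<theta>) (cos \<phi>) = cos (\<theta> + \<phi>)"
proof -
  have "sqrt ((1 - (cos \<theta>)\<^sup>2) * (1 - (cos \<phi>)\<^sup>2)) = sin \<theta> * sin \<phi>"
    using assms by (simp add: sin_squared_eq[symmetric] real_sqrt_mult sin_ge_zero)
  then show "large_root (cos \<theta>) (cos \<phi>) = cos (\<theta> - \<phi>)" "small_root (cos \<theta>) (cos \<phi>) = cos (\<theta> + \<phi>)"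
    by (simp_all add: large_root_def small_root_def cos_diff cos_add)
qed

lemma measurable_abs_diff_squares [measurable]:
  "(\<lambda>z::real \<times> real. \<bar>(fst z)\<^sup>2 - (snd z)\<^sup>2\<bar>) \<in> borel_measurable borel"
  by (intro borel_measurable_continuous_onI continuous_intros)

text \<open>Substitute \<open>x = cos \<theta>\<close> and \<open>y = cos \<phi>\<close>.  The roots become \<open>cos (\<theta> - \<phi>)\<close> and
  \<open>cos (\<theta> + \<phi>)\<close>, and the factors that remain are functions of the rotated angles too:
  \<open>\<bar>x\<^sup>2 - y\<^sup>2\<bar> = \<bar>sin (\<theta> - \<phi>) * sin (\<theta> + \<phi>)\<bar>\<close> and, for the Jacobian,
  \<open>2 * sin \<theta> * sin \<phi> = cos (\<theta> - \<phi>) - cos (\<theta> + \<phi>)\<close>.  Rotate the angles and substitute back.\<close>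

lemma nn_integral_square_roots:
  fixes G :: "real \<Rightarrow> real \<Rightarrow> ennreal"
  assumes m: "(\<lambda>(x, y). G x y) \<in> borel_measurable borel" and sym: "\<And>x y. G x y = G y x"
  shows "2 * (\<integral>\<^sup>+z\<in>{-1..1} \<times> {-1..1}. (case z of (x, y) \<Rightarrow>
            G (large_root x y) (small_root x y) * ennreal \<bar>x\<^sup>2 - y\<^sup>2\<bar>) \<partial>lborel)
       = (\<integral>\<^sup>+z\<in>{-1..1} \<times> {-1..1}. (case z of (s, t) \<Rightarrow> G s t * ennreal \<bar>s - t\<bar>) \<partial>lborel)"
proof -
  have G_comp: "(\<lambda>x. G (f x) (g x)) \<in> borel_measurable M"
    if [measurable]: "f \<in> borel_measurable M" "g \<in> borel_measurable M" for f g and M :: "'z measure"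
    using measurable_compose[OF borel_measurable_Pair[OF that] m] by simp
  \<comment> \<open>\<open>H\<close> contains the Jacobian of the substitution back to \<open>s = cos a\<close> and \<open>t = cos b\<close>\<close>
  define H where "H = (\<lambda>a b. G (cos a) (cos b) * ennreal (\<bar>cos a - cos b\<bar> * \<bar>sin a\<bar> * \<bar>sin b\<bar>))"
  have H_rot: "H (\<theta> - \<phi>) (\<theta> + \<phi>)
      = 2 * (G (cos (\<theta> - \<phi>)) (cos (\<theta> + \<phi>)) * ennreal \<bar>(cos \<theta>)\<^sup>2 - (cos \<phi>)\<^sup>2\<bar> * ennreal (\<bar>sin \<theta>\<bar> * \<bar>sin \<phi>\<bar>))" for \<theta> \<phi>
  proof -
    have 1: "cos (\<theta> - \<phi>) - cos (\<theta> + \<phi>) = 2 * (sin \<theta> * sin \<phi>)"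
      by (simp add: cos_diff cos_add)
    have "sin (\<theta> - \<phi>) * sin (\<theta> + \<phi>) = (sin \<theta>)\<^sup>2 * (cos \<phi>)\<^sup>2 - (cos \<theta>)\<^sup>2 * (sin \<phi>)\<^sup>2"
      by (simp add: sin_diff sin_add algebra_simps power2_eq_square)
    also have "\<dots> = (cos \<phi>)\<^sup>2 - (cos \<theta>)\<^sup>2"
      by (simp add: sin_squared_eq algebra_simps)
    finally have "\<bar>sin (\<theta> - \<phi>)\<bar> * \<bar>sin (\<theta> + \<phi>)\<bar> = \<bar>(cos \<theta>)\<^sup>2 - (cos \<phi>)\<^sup>2\<bar>"
      by (simp add: abs_minus_commute flip: abs_mult)
    then have "\<bar>cos (\<theta> - \<phi>) - cos (\<theta> + \<phi>)\<bar> * \<bar>sin (\<theta> - \<phi>)\<bar> * \<bar>sin (\<theta> + \<phi>)\<bar>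
        = 2 * (\<bar>(cos \<theta>)\<^sup>2 - (cos \<phi>)\<^sup>2\<bar> * (\<bar>sin \<theta>\<bar> * \<bar>sin \<phi>\<bar>))"
      unfolding 1 by (simp add: abs_mult mult_ac)
    then have "H (\<theta> - \<phi>) (\<theta> + \<phi>) = G (cos (\<theta> - \<phi>)) (cos (\<theta> + \<phi>))
        * ennreal (2 * (\<bar>(cos \<theta>)\<^sup>2 - (cos \<phi>)\<^sup>2\<bar> * (\<bar>sin \<theta>\<bar> * \<bar>sin \<phi>\<bar>)))"
      by (simp only: H_def)
    then show ?thesis
      by (simp add: ennreal_mult mult_ac)
  qed
  have "2 * (\<integral>\<^sup>+z\<in>{-1..1} \<times> {-1..1}. (case z of (x, y) \<Rightarrow>
            G (large_root x y) (small_root x y) * ennreal \<bar>x\<^sup>2 - y\<^sup>2\<bar>) \<partial>lborel)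
      = 2 * (\<integral>\<^sup>+\<theta>\<in>{0..pi}. (\<integral>\<^sup>+\<phi>\<in>{0..pi}. G (large_root (cos \<theta>) (cos \<phi>)) (small_root (cos \<theta>) (cos \<phi>))
          * ennreal \<bar>(cos \<theta>)\<^sup>2 - (cos \<phi>)\<^sup>2\<bar> * ennreal (\<bar>sin \<theta>\<bar> * \<bar>sin \<phi>\<bar>) \<partial>lborel) \<partial>lborel)"
  proof (subst nn_integral_square_cos_substitution, goal_cases)
    case 1
    have [measurable]: "(\<lambda>z. G (case_prod large_root z) (case_prod small_root z)) \<in> borel_measurable borel"
      by (intro G_comp) measurable
    have "(\<lambda>z. G (case_prod large_root z) (case_prod small_root z) * ennreal \<bar>(fst z)\<^sup>2 - (snd z)\<^sup>2\<bar>) \<in> borel_measurable borel"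
      by measurable
    then show ?case by (simp add: case_prod_beta' borel_prod)
  qed simp
  also have "\<dots> = 2 * (\<integral>\<^sup>+\<theta>\<in>{0..pi}. (\<integral>\<^sup>+\<phi>\<in>{0..pi}. G (cos (\<theta> - \<phi>)) (cos (\<theta> + \<phi>))
          * ennreal \<bar>(cos \<theta>)\<^sup>2 - (cos \<phi>)\<^sup>2\<bar> * ennreal (\<bar>sin \<theta>\<bar> * \<bar>sin \<phi>\<bar>) \<partial>lborel) \<partial>lborel)"
    by (intro arg_cong[where f = "(*) 2"] nn_integral_cong) (auto simp: indicator_def roots_cos intro!: nn_integral_cong)
  also have "\<dots> = (\<integral>\<^sup>+\<theta>\<in>{0..pi}. (\<integral>\<^sup>+\<phi>\<in>{0..pi}. H (\<theta> - \<phi>) (\<theta> + \<phi>) \<partial>lborel) \<partial>lborel)"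
  proof -
    have *: "(\<lambda>(\<theta>, \<phi>). G (cos (\<theta> - \<phi>)) (cos (\<theta> + \<phi>))
          * ennreal \<bar>(cos \<theta>)\<^sup>2 - (cos \<phi>)\<^sup>2\<bar> * ennreal (\<bar>sin \<theta>\<bar> * \<bar>sin \<phi>\<bar>)) \<in> borel_measurable (borel \<Otimes>\<^sub>M borel)"
      unfolding case_prod_beta' by (intro borel_measurable_times_ennreal G_comp) measurable
    have **: "(\<lambda>(\<theta>, \<phi>). H (\<theta> - \<phi>) (\<theta> + \<phi>)) \<in> borel_measurable (borel \<Otimes>\<^sub>M borel)"
      unfolding H_def case_prod_beta' by (intro borel_measurable_times_ennreal G_comp) measurable
    show ?thesis
      unfolding nn_integral_rectangle(1)[OF * atLeastAtMost_borel atLeastAtMost_borel]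
        nn_integral_rectangle(1)[OF ** atLeastAtMost_borel atLeastAtMost_borel]
    proof (subst nn_integral_cmult[symmetric], goal_cases)
      case 1
      have "indicator ({0..pi} \<times> {0..pi}) \<in> borel_measurable (borel :: (real \<times> real) measure)"
        by (intro borel_measurable_indicator borel_closed closed_Times closed_atLeastAtMost)
      with * show ?case
        by (intro borel_measurable_times_ennreal) (simp_all add: borel_prod)
    qed (auto simp: H_rot mult_ac intro!: nn_integral_cong)
  qed
  also have "\<dots> = (\<integral>\<^sup>+\<theta>\<in>{0..pi}. (\<integral>\<^sup>+\<phi>\<in>{0..pi}. H \<theta> \<phi> \<partial>lborel) \<partial>lborel)"
  proof (rule nn_integral_torus_rotation)
    show "(\<lambda>(a, b). H a b) \<in> borel_measurable (borel \<Otimes>\<^sub>M borel)"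
      unfolding H_def case_prod_beta' by (intro borel_measurable_times_ennreal G_comp) measurable
    show "H a b = H b a" for a b
      by (simp add: H_def sym[of "cos a"] abs_minus_commute mult_ac)
  qed (simp_all add: H_def)
  also have "\<dots> = (\<integral>\<^sup>+z\<in>{-1..1} \<times> {-1..1}. (case z of (s, t) \<Rightarrow> G s t * ennreal \<bar>s - t\<bar>) \<partial>lborel)"
  proof (subst nn_integral_square_cos_substitution, goal_cases)
    case 1
    then show ?case
      unfolding case_prod_beta' by (intro borel_measurable_times_ennreal G_comp) measurable
  qed (simp add: H_def ennreal_mult mult_ac)
  finally show ?thesis .
qed

text \<open>The signed version, from the nonnegative one applied to positive and negative parts.\<close>

lemma integral_square_roots:
  fixes G :: "real \<Rightarrow> real \<Rightarrow> real"
  assumes [measurable]: "(\<lambda>(x, y). G x y) \<in> borel_measurable borel" and sym: "\<And>x y. G x y = G y x"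
    and int: "set_integrable lborel ({-1..1} \<times> {-1..1}) (\<lambda>(s, t). G s t * \<bar>s - t\<bar>)"
  shows "set_integrable lborel ({-1..1} \<times> {-1..1})
            (\<lambda>(x, y). G (large_root x y) (small_root x y) * \<bar>x\<^sup>2 - y\<^sup>2\<bar>)" (is ?int)
    and "2 * (LINT z:{-1..1} \<times> {-1..1}|lborel. (case z of (x, y) \<Rightarrow>
            G (large_root x y) (small_root x y) * \<bar>x\<^sup>2 - y\<^sup>2\<bar>))
       = (LINT z:{-1..1} \<times> {-1..1}|lborel. (case z of (s, t) \<Rightarrow> G s t * \<bar>s - t\<bar>))" (is ?eq)
proof -
  define Q :: "(real \<times> real) set" where "Q = {-1..1} \<times> {-1..1}"
  have [measurable]: "Q \<in> sets borel"
    unfolding Q_def by (intro borel_closed closed_Times closed_atLeastAtMost)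
  define F where "F = (\<lambda>z. indicator Q z *\<^sub>R (case z of (x, y) \<Rightarrow>
            G (large_root x y) (small_root x y) * \<bar>x\<^sup>2 - y\<^sup>2\<bar>))"
  define F' where "F' = (\<lambda>z. indicator Q z *\<^sub>R (case z of (s, t) \<Rightarrow> G s t * \<bar>s - t\<bar>))"
  have "(\<lambda>z. (\<lambda>(x, y). G x y) (case_prod large_root z, case_prod small_root z)) \<in> borel_measurable borel"
    by measurable
  then have [measurable]: "(\<lambda>z. G (case_prod large_root z) (case_prod small_root z)) \<in> borel_measurable borel"
    by simp
  have F_eq: "F = (\<lambda>z. indicator Q z * (G (case_prod large_root z) (case_prod small_root z) * \<bar>(fst z)\<^sup>2 - (snd z)\<^sup>2\<bar>))"
    by (auto simp: F_def)
  have mF [measurable]: "F \<in> borel_measurable lborel"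
    unfolding F_eq by measurable
  have intF': "integrable lborel F'"
    using int by (simp add: set_integrable_def F'_def Q_def)
  have key: "2 * (\<integral>\<^sup>+z. ennreal (e * F z) \<partial>lborel) = (\<integral>\<^sup>+z. ennreal (e * F' z) \<partial>lborel)" for e
  proof -
    have mE: "(\<lambda>(x, y). ennreal (e * G x y)) \<in> borel_measurable borel"
      using assms(1) by (simp add: case_prod_beta')
    have "2 * (\<integral>\<^sup>+z\<in>Q. (case z of (x, y) \<Rightarrow>
            ennreal (e * G (large_root x y) (small_root x y)) * ennreal \<bar>x\<^sup>2 - y\<^sup>2\<bar>) \<partial>lborel)
       = (\<integral>\<^sup>+z\<in>Q. (case z of (s, t) \<Rightarrow> ennreal (e * G s t) * ennreal \<bar>s - t\<bar>) \<partial>lborel)"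
      unfolding Q_def by (rule nn_integral_square_roots[OF mE]) (simp add: sym)
    moreover have "(case z of (x, y) \<Rightarrow>
            ennreal (e * G (large_root x y) (small_root x y)) * ennreal \<bar>x\<^sup>2 - y\<^sup>2\<bar>) * indicator Q z = ennreal (e * F z)" for z
      by (cases z) (auto simp: F_def indicator_def mult.assoc simp flip: ennreal_mult'')
    moreover have "(case z of (s, t) \<Rightarrow> ennreal (e * G s t) * ennreal \<bar>s - t\<bar>) * indicator Q z = ennreal (e * F' z)" for z
      by (cases z) (auto simp: F'_def indicator_def mult.assoc simp flip: ennreal_mult'')
    ultimately show ?thesis by simp
  qed
  have pos: "2 * (\<integral>\<^sup>+z. ennreal (F z) \<partial>lborel) = (\<integral>\<^sup>+z. ennreal (F' z) \<partial>lborel)"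
    and neg: "2 * (\<integral>\<^sup>+z. ennreal (- F z) \<partial>lborel) = (\<integral>\<^sup>+z. ennreal (- F' z) \<partial>lborel)"
    using key[of 1] key[of "-1"] by simp_all
  have intF: "integrable lborel F"
    using intF' mF unfolding real_integrable_def pos[symmetric] neg[symmetric]
    by (auto simp: ennreal_mult_eq_top_iff)
  have "integral\<^sup>L lborel F' = 2 * integral\<^sup>L lborel F"
    unfolding real_lebesgue_integral_def[OF intF] real_lebesgue_integral_def[OF intF']
      pos[symmetric] neg[symmetric]
    by (simp add: enn2real_mult)
  with intF show ?int ?eq
    by (simp_all add: set_integrable_def set_lebesgue_integral_def F_def F'_def Q_def)
qed

section \<open>The weight on the square\<close>

abbreviation square :: "(real \<times> real) set" where
  "square \<equiv> {-1..1} \<times> {-1..1}"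

lemma square_borel [measurable]: "square \<in> sets borel"
  by (intro borel_closed closed_Times closed_atLeastAtMost)

lemma integral_product_lborel:
  fixes F G :: "real \<Rightarrow> real"
  assumes F: "integrable lborel F" and G: "integrable lborel G"
  shows "integrable lborel (\<lambda>z. F (fst z) * G (snd z))"
    and "(LINT z|lborel. F (fst z) * G (snd z)) = integral\<^sup>L lborel F * integral\<^sup>L lborel G"
proof -
  have [measurable]: "F \<in> borel_measurable borel" "G \<in> borel_measurable borel"
    using F G by (auto dest: borel_measurable_integrable)
  have int: "integrable (lborel \<Otimes>\<^sub>M lborel) (\<lambda>z. F (fst z) * G (snd z))"
    by (rule lborel_pair.Fubini_integrable) (use F G in \<open>auto simp: abs_mult\<close>)
  then show "integrable lborel (\<lambda>z. F (fst z) * G (snd z))"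
    by (simp add: lborel_prod)
  show "(LINT z|lborel. F (fst z) * G (snd z)) = integral\<^sup>L lborel F * integral\<^sup>L lborel G"
    using lborel_pair.integral_fst'[OF int] by (simp add: lborel_prod)
qed

definition pair_integral :: "(real \<Rightarrow> real) \<Rightarrow> (real \<Rightarrow> real \<Rightarrow> real) \<Rightarrow> real" where
  "pair_integral w F = (LINT z:square|lborel. (case z of (s, t) \<Rightarrow> F s t * (w s * w t)))"

text \<open>Up to the factor \<open>a_const \<gamma> w\<close>, this is integration against \<open>W_weight \<gamma> w\<close> pulled back to
  the coordinates \<open>(s, t)\<close> and averaged over both orders of \<open>s\<close> and \<open>t\<close>.\<close>

definition kernel_integral :: "real \<Rightarrow> (real \<Rightarrow> real) \<Rightarrow> (real \<Rightarrow> real \<Rightarrow> real) \<Rightarrow> real" where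
  "kernel_integral \<gamma> w F =
     (LINT z:square|lborel. (case z of (s, t) \<Rightarrow> F s t * (w s * w t) * \<bar>s - t\<bar> powr (2 * \<gamma> + 1)))"

lemma AE_off_diagonal: "AE z in lborel. fst z \<noteq> (snd z :: real)"
proof -
  have "negligible {z :: real \<times> real. (1, -1) \<bullet> z = 0}"
    by (rule negligible_hyperplane) (auto simp: zero_prod_def)
  moreover have "{z :: real \<times> real. (1, -1) \<bullet> z = 0} = {z. fst z = snd z}"
    by (auto simp: inner_prod_def)
  ultimately have "{z :: real \<times> real. fst z = snd z} \<in> null_sets lebesgue"
    by (simp add: negligible_iff_null_sets)
  then have "AE z in lebesgue. fst z \<noteq> (snd z :: real)"
    by (rule AE_I') auto
  then show ?thesis by (simp add: AE_completion_iff)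
qed

lemma square_powr_times_abs: "((d::real)\<^sup>2) powr g * \<bar>d\<bar> = \<bar>d\<bar> powr (2 * g + 1)"
proof (cases "d = 0")
  case False
  have "(d\<^sup>2) powr g = (\<bar>d\<bar> powr 2) powr g"
    using False by simp
  also have "\<dots> = \<bar>d\<bar> powr (2 * g)" by (rule powr_powr)
  finally show ?thesis using False by (simp add: powr_add)
qed simp

lemma roots_sum_prod:
  assumes "(x, y) \<in> square"
  shows "large_root x y + small_root x y = 2 * x * y" "large_root x y * small_root x y = x\<^sup>2 + y\<^sup>2 - 1"
    and "(large_root x y - small_root x y)\<^sup>2 = 4 * ((1 - x\<^sup>2) * (1 - y\<^sup>2))"
    and "small_root x y \<le> large_root x y"
proof -
  have nn: "0 \<le> (1 - x\<^sup>2) * (1 - y\<^sup>2)"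
    using assms by (auto simp: abs_square_le_1 abs_le_iff)
  show "large_root x y + small_root x y = 2 * x * y"
    by (simp add: large_root_def small_root_def)
  have "large_root x y * small_root x y = x\<^sup>2 * y\<^sup>2 - (sqrt ((1 - x\<^sup>2) * (1 - y\<^sup>2)))\<^sup>2"
    by (simp add: large_root_def small_root_def power2_eq_square algebra_simps)
  then show "large_root x y * small_root x y = x\<^sup>2 + y\<^sup>2 - 1"
    using nn by (simp add: algebra_simps)
  have "(large_root x y - small_root x y)\<^sup>2 = 4 * (sqrt ((1 - x\<^sup>2) * (1 - y\<^sup>2)))\<^sup>2"
    by (simp add: large_root_def small_root_def power2_eq_square algebra_simps)
  then show "(large_root x y - small_root x y)\<^sup>2 = 4 * ((1 - x\<^sup>2) * (1 - y\<^sup>2))"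
    using nn by simp
  show "small_root x y \<le> large_root x y"
    using nn by (simp add: large_root_def small_root_def)
qed

lemma inj_on_sum_prod: "inj_on sum_prod triangle"
proof (rule inj_onI, clarify)
  fix s t s' t' assume "(s, t) \<in> triangle" "(s', t') \<in> triangle" and eq: "sum_prod (s, t) = sum_prod (s', t')"
  then have lt: "s < t" "s' < t'" by (auto simp: triangle_def)
  have e: "s + t = s' + t'" "s * t = s' * t'" using eq by (auto simp: sum_prod_def)
  have "(t - s)\<^sup>2 = (s + t)\<^sup>2 - 4 * (s * t)" "(t' - s')\<^sup>2 = (s' + t')\<^sup>2 - 4 * (s' * t')"
    by (simp_all add: power2_eq_square algebra_simps)
  then have "(t - s)\<^sup>2 = (t' - s')\<^sup>2" by (simp add: e)
  then have "t - s = t' - s'" using lt by (simp add: power2_eq_iff)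
  with e show "s = s' \<and> t = t'" by linarith
qed

text \<open>Inside the square, off the diagonals, the point \<open>(2 * x * y, x\<^sup>2 + y\<^sup>2 - 1)\<close> lies in
  \<open>Omega\<close>: the products \<open>(1 + s) * (1 + t) = (x + y)\<^sup>2\<close> and \<open>(1 - s) * (1 - t) = (x - y)\<^sup>2\<close> are
  positive, and \<open>\<bar>s + t\<bar> < 2\<close> excludes the solutions outside of \<open>[-1, 1]\<close>.  On the diagonals both
  sides vanish because of the factor \<open>\<bar>x\<^sup>2 - y\<^sup>2\<bar>\<close>, and on the boundary because \<open>s = t\<close> and
  \<open>0 powr \<gamma> = 0\<close>, which agrees with the extension of the weight by zero.\<close>

lemma square_weight_eq:
  assumes xy: "(x, y) \<in> square"
  defines "s \<equiv> large_root x y" and "t \<equiv> small_root x y"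
  shows "square_weight \<gamma> w x y
    = 2 * a_const \<gamma> w * (w s * w t) * ((s - t)\<^sup>2) powr \<gamma> * \<bar>x\<^sup>2 - y\<^sup>2\<bar>"
proof -
  note r = roots_sum_prod[OF xy, folded s_def t_def]
  have uv: "(2 * x * y)\<^sup>2 - 4 * (x\<^sup>2 + y\<^sup>2 - 1) = (s - t)\<^sup>2"
    unfolding r(3) by (simp add: power2_eq_square algebra_simps)
  have le: "x\<^sup>2 \<le> 1" "y\<^sup>2 \<le> 1" using xy by (auto simp: abs_square_le_1 abs_le_iff)
  consider "x\<^sup>2 = y\<^sup>2" | "x\<^sup>2 = 1 \<or> y\<^sup>2 = 1" | "x\<^sup>2 \<noteq> y\<^sup>2" "x\<^sup>2 < 1" "y\<^sup>2 < 1"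
    using le by argo
  then show ?thesis
  proof cases
    case 1
    then show ?thesis by (simp add: square_weight_def)
  next
    case 2
    then have 0: "(s - t)\<^sup>2 = 0" unfolding r(3) by auto
    have "(2 * x * y, x\<^sup>2 + y\<^sup>2 - 1) \<notin> Omega"
    proof
      assume "(2 * x * y, x\<^sup>2 + y\<^sup>2 - 1) \<in> Omega"
      then obtain a b where ab: "a < b" "2 * x * y = a + b" "x\<^sup>2 + y\<^sup>2 - 1 = a * b"
        by (auto simp: Omega_def sum_prod_def triangle_def)
      have "(s - t)\<^sup>2 = (b - a)\<^sup>2"
        unfolding uv[symmetric] ab by (simp add: power2_eq_square algebra_simps)
      with 0 ab(1) show False by simp
    qed
    then show ?thesis using 0 by (simp add: square_weight_def W_weight_def)
  next
    case 3
    have "(s - t)\<^sup>2 > 0" using 3 unfolding r(3) by simp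
    then have "t < s" using r(4) by (cases "s = t") auto
    have ne: "x + y \<noteq> 0" "x - y \<noteq> 0"
      using 3(1) by (auto simp: power2_eq_iff add_eq_0_iff)
    have "(1 + s) * (1 + t) = (x + y)\<^sup>2"
      using r(1,2) by (simp add: power2_eq_square algebra_simps)
    then have p: "(1 + s) * (1 + t) > 0" using ne by simp
    have "(1 - s) * (1 - t) = (x - y)\<^sup>2"
      using r(1,2) by (simp add: power2_eq_square algebra_simps)
    then have m: "(1 - s) * (1 - t) > 0" using ne by simp
    have "\<bar>x * y\<bar> < 1"
      using 3 mult_strict_mono[of "x\<^sup>2" 1 "y\<^sup>2" 1] by (simp add: abs_square_less_1[symmetric] power_mult_distrib)
    then have b: "\<bar>s + t\<bar> < 2" using r(1) by simp
    have "-1 < t" using p b \<open>t < s\<close> by (auto simp: zero_less_mult_iff)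
    moreover have "s < 1" using m b \<open>t < s\<close> by (auto simp: zero_less_mult_iff)
    ultimately have tri: "(t, s) \<in> triangle" using \<open>t < s\<close> by (simp add: triangle_def)
    have sp: "sum_prod (t, s) = (2 * x * y, x\<^sup>2 + y\<^sup>2 - 1)"
      using r(1,2) by (simp add: sum_prod_def algebra_simps)
    then have "the_inv_into triangle sum_prod (2 * x * y, x\<^sup>2 + y\<^sup>2 - 1) = (t, s)"
      using the_inv_into_f_f[OF inj_on_sum_prod tri] by simp
    moreover have "(2 * x * y, x\<^sup>2 + y\<^sup>2 - 1) \<in> Omega"
      unfolding Omega_def sp[symmetric] using tri by blast
    ultimately show ?thesis
      by (simp add: square_weight_def W_weight_def flip: uv)
  qed
qed

section \<open>Integrals against Borel weights\<close>

text \<open>Borel measurability gives access to Fubini on the product of two copies of \<open>lborel\<close>.\<close>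

locale borel_weight =
  fixes w :: "real \<Rightarrow> real"
  assumes w_borel [measurable]: "w \<in> borel_measurable borel" and weight: "weight_function w"
begin

lemma weight_integral_lborel:
  "integrable lborel (\<lambda>x. indicator {-1..1} x * (poly p x * w x))"
  "weight_integral w p = (LINT x|lborel. indicator {-1..1} x * (poly p x * w x))"
proof -
  have m: "(\<lambda>x. indicator {-1..1} x * (poly p x * w x)) \<in> borel_measurable lborel"
  proof -
    have [measurable]: "poly p \<in> borel_measurable borel"
      by (intro borel_measurable_continuous_onI continuous_intros)
    show ?thesis by measurable
  qed
  show "integrable lborel (\<lambda>x. indicator {-1..1} x * (poly p x * w x))"
    using weight_integrable_poly[OF weight, of p] integrable_completion[OF m]
    by (simp add: set_integrable_def)
  show "weight_integral w p = (LINT x|lborel. indicator {-1..1} x * (poly p x * w x))"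
    using integral_completion[OF m] by (simp add: weight_integral_def set_lebesgue_integral_def)
qed

lemma pair_integral_product:
  "set_integrable lborel square (\<lambda>(s, t). poly f s * poly g t * (w s * w t))"
  "pair_integral w (\<lambda>s t. poly f s * poly g t) = weight_integral w f * weight_integral w g"
proof -
  have eq: "indicator square z *\<^sub>R (case z of (s, t) \<Rightarrow> poly f s * poly g t * (w s * w t))
      = (indicator {-1..1} (fst z) * (poly f (fst z) * w (fst z))) * (indicator {-1..1} (snd z) * (poly g (snd z) * w (snd z)))" for z
    by (cases z) (auto simp: indicator_def)
  show "set_integrable lborel square (\<lambda>(s, t). poly f s * poly g t * (w s * w t))"
    unfolding set_integrable_def eq
    by (intro integral_product_lborel(1) weight_integral_lborel)
  show "pair_integral w (\<lambda>s t. poly f s * poly g t) = weight_integral w f * weight_integral w g"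
    unfolding pair_integral_def set_lebesgue_integral_def eq weight_integral_lborel(2)
    by (intro integral_product_lborel(2) weight_integral_lborel)
qed

lemma pair_integrable_polys2:
  assumes "f \<in> polys2 m"
  shows "set_integrable lborel square (\<lambda>(s, t). f s t * (w s * w t))"
proof -
  obtain c where c: "f = (\<lambda>x y. \<Sum>i\<le>m. \<Sum>j\<le>m - i. c i j * (x ^ i * y ^ j))" using assms by (elim polys2_E)
  have "integrable lborel (\<lambda>z. indicator square z *\<^sub>R (case z of (s, t) \<Rightarrow> poly (monom 1 i) s * poly (monom 1 j) t * (w s * w t)))" for i j
    using pair_integral_product(1) by (simp add: set_integrable_def)
  then have "integrable lborel (\<lambda>z. \<Sum>i\<le>m. \<Sum>j\<le>m - i. c i j *
      (indicator square z *\<^sub>R (case z of (s, t) \<Rightarrow> poly (monom 1 i) s * poly (monom 1 j) t * (w s * w t))))"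
    by (intro Bochner_Integration.integrable_sum integrable_mult_right) simp
  also have "(\<lambda>z. \<Sum>i\<le>m. \<Sum>j\<le>m - i. c i j *
      (indicator square z *\<^sub>R (case z of (s, t) \<Rightarrow> poly (monom 1 i) s * poly (monom 1 j) t * (w s * w t))))
      = (\<lambda>z. indicator square z *\<^sub>R (case z of (s, t) \<Rightarrow> f s t * (w s * w t)))"
    by (auto simp: c fun_eq_iff poly_monom sum_distrib_left sum_distrib_right mult_ac)
  finally show ?thesis unfolding set_integrable_def .
qed

text \<open>Off the diagonal, which is negligible, \<open>\<bar>s - t\<bar> powr (2 * \<gamma> + 1)\<close> is \<open>1\<close> for \<open>\<gamma> = -1/2\<close> and
  \<open>(s - t)\<^sup>2\<close> for \<open>\<gamma> = 1/2\<close>.  In both cases the integral becomes one of a polynomial, hence a sum of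
  products of integrals in one variable.\<close>

lemma kernel_integral:
  assumes g: "\<gamma> = -1/2 \<or> \<gamma> = 1/2" and F: "F \<in> polys2 m"
  defines "F' \<equiv> (\<lambda>s t. if \<gamma> = -1/2 then F s t else F s t * (s - t)\<^sup>2)"
  shows "set_integrable lborel square (\<lambda>(s, t). F s t * (w s * w t) * \<bar>s - t\<bar> powr (2 * \<gamma> + 1))"
    and "kernel_integral \<gamma> w F = pair_integral w F'"
proof -
  have sq: "(\<lambda>s t::real. (s - t)\<^sup>2) \<in> polys2 2"
    using polys2_power[OF polys2_diff[OF polys2_monom[of 1 0 1] polys2_monom[of 0 1 1]], of 2] by simp
  have "F' \<in> polys2 (m + 2)"
    unfolding F'_def using g polys2_mono[OF F, of "m + 2"] polys2_mult[OF F sq] by auto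
  then have int: "set_integrable lborel square (\<lambda>(s, t). F' s t * (w s * w t))"
    by (rule pair_integrable_polys2)
  let ?L = "\<lambda>z. indicator square z *\<^sub>R (case z of (s, t) \<Rightarrow> F' s t * (w s * w t))"
  let ?R = "\<lambda>z. indicator square z *\<^sub>R (case z of (s, t) \<Rightarrow> F s t * (w s * w t) * \<bar>s - t\<bar> powr (2 * \<gamma> + 1))"
  have [measurable]: "(\<lambda>z. F (fst z) (snd z)) \<in> borel_measurable borel"
    by (intro borel_measurable_continuous_onI polys2_continuous[OF F])
  have [measurable]: "(\<lambda>z. \<bar>fst z - snd z :: real\<bar>) \<in> borel_measurable borel"
    by (intro borel_measurable_continuous_onI continuous_intros)
  have [measurable]: "(\<lambda>z :: real \<times> real. w (fst z)) \<in> borel_measurable borel" "(\<lambda>z :: real \<times> real. w (snd z)) \<in> borel_measurable borel"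
    by (intro measurable_compose[OF _ w_borel] borel_measurable_continuous_onI continuous_intros)+
  have mR: "?R \<in> borel_measurable lborel"
    unfolding case_prod_beta' by measurable
  have mL: "?L \<in> borel_measurable lborel"
    using int unfolding set_integrable_def by (rule borel_measurable_integrable)
  have ae: "AE z in lborel. ?L z = ?R z"
    using AE_off_diagonal
  proof eventually_elim
    case (elim z)
    then show ?case using g by (auto simp: F'_def case_prod_beta' mult_ac)
  qed
  show "set_integrable lborel square (\<lambda>(s, t). F s t * (w s * w t) * \<bar>s - t\<bar> powr (2 * \<gamma> + 1))"
    using int unfolding set_integrable_def by (rule integrable_cong_AE_imp[OF _ mR]) (use ae in auto)
  show "kernel_integral \<gamma> w F = pair_integral w F'"
    unfolding kernel_integral_def pair_integral_def set_lebesgue_integral_def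
    by (rule integral_cong_AE[OF mR mL]) (use ae in auto)
qed

lemma a_const_kernel: "a_const \<gamma> w = inverse (kernel_integral \<gamma> w (\<lambda>_ _. 1))"
proof -
  have [measurable]: "(\<lambda>z. \<bar>fst z - snd z :: real\<bar>) \<in> borel_measurable borel"
    by (intro borel_measurable_continuous_onI continuous_intros)
  have [measurable]: "(\<lambda>z :: real \<times> real. w (fst z)) \<in> borel_measurable borel" "(\<lambda>z :: real \<times> real. w (snd z)) \<in> borel_measurable borel"
    by (intro measurable_compose[OF _ w_borel] borel_measurable_continuous_onI continuous_intros)+
  have "(\<lambda>z. indicator square z *\<^sub>R (case z of (x, y) \<Rightarrow> w x * w y * \<bar>x - y\<bar> powr (2 * \<gamma> + 1))) \<in> borel_measurable lborel"
    unfolding case_prod_beta' by measurable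
  from integral_completion[OF this] show ?thesis
    by (simp add: a_const_def kernel_integral_def set_lebesgue_integral_def)
qed

end

section \<open>Orthonormality of the symmetrized products\<close>

lemma polys2_sum_prod_compose:
  assumes "P \<in> polys2 n"
  shows "(\<lambda>s t. P (s + t) (s * t)) \<in> polys2 (2 * n)"
proof -
  have "(\<lambda>s t :: real. s ^ 1 * t ^ 0 + s ^ 0 * t ^ 1) \<in> polys2 2"
    by (intro polys2_add polys2_monom) auto
  moreover have "(\<lambda>s t :: real. s ^ 1 * t ^ 1) \<in> polys2 2"
    by (intro polys2_monom) auto
  ultimately show ?thesis
    using polys2_compose[OF assms, of "\<lambda>s t. s + t" 2 "\<lambda>s t. s * t"] by simp
qed

context borel_weight
begin

lemma pair_integral_add:
  assumes "f \<in> polys2 m" "g \<in> polys2 n"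
  shows "pair_integral w (\<lambda>s t. f s t + g s t) = pair_integral w f + pair_integral w g"
  using set_integral_add(2)[OF pair_integrable_polys2[OF assms(1)] pair_integrable_polys2[OF assms(2)]]
  unfolding pair_integral_def case_prod_beta' distrib_right .

lemma pair_integral_scale: "pair_integral w (\<lambda>s t. c * f s t) = c * pair_integral w f"
proof -
  have "pair_integral w (\<lambda>s t. c * f s t) = (LINT z:square|lborel. c * (case z of (s, t) \<Rightarrow> f s t * (w s * w t)))"
    unfolding pair_integral_def case_prod_beta' mult.assoc ..
  then show ?thesis
    unfolding pair_integral_def by (simp only: set_integral_mult_right)
qed

text \<open>The four terms of the expanded product separate in \<open>s\<close> and \<open>t\<close>, and they agree in pairs.
  The cases \<open>e = 1\<close> and \<open>e = -1\<close> serve \<open>\<gamma> = -1/2\<close> and \<open>\<gamma> = 1/2\<close>, respectively.\<close>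

lemma pair_integral_symmetrized_products:
  assumes e: "e = 1 \<or> e = -1"
  shows "pair_integral w (\<lambda>s t. (poly f s * poly g t + e * (poly f t * poly g s)) *
            (poly f' s * poly g' t + e * (poly f' t * poly g' s)))
    = 2 * (weight_integral w (f * f') * weight_integral w (g * g')
         + e * (weight_integral w (f * g') * weight_integral w (g * f')))"
proof -
  have prod: "(\<lambda>s t. poly a s * poly b t) \<in> polys2 (degree a + degree b)" for a b
  proof -
    have a: "(\<lambda>s t. \<Sum>i\<le>degree a. coeff a i * (s ^ i * t ^ 0)) \<in> polys2 (degree a)"
      by (intro polys2_sum polys2_scale polys2_monom) auto
    have b: "(\<lambda>s t. \<Sum>i\<le>degree b. coeff b i * (s ^ 0 * t ^ i)) \<in> polys2 (degree b)"
      by (intro polys2_sum polys2_scale polys2_monom) auto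
    show ?thesis using polys2_mult[OF a b] by (simp add: poly_altdef)
  qed
  define N where "N = degree f + degree f' + degree g + degree g'"
  define T where "T = (\<lambda>a b (s::real) t. poly a s * poly b t)"
  have T: "T (a * a') (b * b') \<in> polys2 N"
    if "degree a + degree a' + degree b + degree b' \<le> N" for a a' b b'
  proof (rule polys2_mono)
    show "T (a * a') (b * b') \<in> polys2 (degree (a * a') + degree (b * b'))" unfolding T_def by (rule prod)
    show "degree (a * a') + degree (b * b') \<le> N"
      using degree_mult_le[of a a'] degree_mult_le[of b b'] that by linarith
  qed
  have in1: "T (f * f') (g * g') \<in> polys2 N" "T (f * g') (g * f') \<in> polys2 N"
    "T (g * f') (f * g') \<in> polys2 N" "T (g * g') (f * f') \<in> polys2 N"
    by (intro T; simp add: N_def)+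
  have val: "pair_integral w (T a b) = weight_integral w a * weight_integral w b" for a b
    unfolding T_def by (rule pair_integral_product)
  have "(\<lambda>s t. (poly f s * poly g t + e * (poly f t * poly g s)) *
            (poly f' s * poly g' t + e * (poly f' t * poly g' s)))
      = (\<lambda>s t. (T (f * f') (g * g') s t + T (g * g') (f * f') s t)
          + e * (T (f * g') (g * f') s t + T (g * f') (f * g') s t))"
    using e by (auto simp: T_def fun_eq_iff algebra_simps)
  then have "pair_integral w (\<lambda>s t. (poly f s * poly g t + e * (poly f t * poly g s)) *
            (poly f' s * poly g' t + e * (poly f' t * poly g' s)))
      = (pair_integral w (T (f * f') (g * g')) + pair_integral w (T (g * g') (f * f')))
          + e * (pair_integral w (T (f * g') (g * f')) + pair_integral w (T (g * f') (f * g')))"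
    using in1 by (simp add: pair_integral_add pair_integral_scale polys2_add polys2_scale
        pair_integral_add[OF polys2_add polys2_scale[OF polys2_add]])
  then show ?thesis by (simp add: val algebra_simps)
qed

lemma a_const_minus: "a_const (-1/2) w = 1 / (weight_integral w 1)\<^sup>2"
proof -
  have "kernel_integral (-1/2) w (\<lambda>_ _. 1) = pair_integral w (\<lambda>_ _. 1)"
    using kernel_integral(2)[OF disjI1[OF refl] polys2_const[of 1 0]] by (simp only: simp_thms if_True)
  also have "\<dots> = weight_integral w 1 * weight_integral w 1"
    using pair_integral_product(2)[of 1 1] by (simp only: poly_1 mult_1)
  finally show ?thesis
    by (simp only: a_const_kernel power2_eq_square inverse_eq_divide)
qed

text \<open>The integral of \<open>(s - t)\<^sup>2\<close> is twice the product of the mass and the integral of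
  \<open>(x - m)\<^sup>2 * w x\<close>, where \<open>m\<close> is the mean of the normalized weight.  This variance is positive
  because a weight with a density cannot be concentrated at a point.\<close>

lemma a_const_plus_pos: "a_const (1/2) w > 0"
proof -
  let ?L = "weight_integral w"
  define X :: "real poly" where "X = [:0, 1:]"
  have "pair_integral w (\<lambda>s t. (s - t)\<^sup>2) = 2 * (?L (X * X) * ?L 1 - (?L X)\<^sup>2)"
    using pair_integral_symmetrized_products[of "-1" X 1 X 1] by (simp add: X_def power2_eq_square)
  moreover have "?L (X * X) * ?L 1 - (?L X)\<^sup>2 > 0"
  proof -
    define m where "m = ?L X / ?L 1"
    have L1: "?L 1 > 0" by (rule weight_integral_1_pos[OF weight])
    have "0 < ?L ((X + Polynomial.smult (- m) 1) * (X + Polynomial.smult (- m) 1))"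
    proof (rule weight_integral_nonneg_pos[OF weight])
      show "0 \<le> poly ((X + Polynomial.smult (- m) 1) * (X + Polynomial.smult (- m) 1)) x" for x
        unfolding poly_mult by (rule zero_le_square)
    qed (simp add: X_def)
    also have "(X + Polynomial.smult (- m) 1) * (X + Polynomial.smult (- m) 1)
        = X * X + (Polynomial.smult (- 2 * m) X + Polynomial.smult (m\<^sup>2) 1)"
      by (simp add: X_def power2_eq_square)
    also have "?L \<dots> = ?L (X * X) + (- 2 * m * ?L X + m\<^sup>2 * ?L 1)"
      by (simp only: weight_integral_add[OF weight] weight_integral_smult)
    also have "\<dots> = (?L (X * X) * ?L 1 - (?L X)\<^sup>2) / ?L 1"
      using L1 by (simp add: m_def power2_eq_square field_simps)
    finally show ?thesis using L1 by (simp add: zero_less_divide_iff)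
  qed
  moreover have "kernel_integral (1/2) w (\<lambda>_ _. 1) = pair_integral w (\<lambda>s t. (s - t)\<^sup>2)"
    using kernel_integral(2)[OF disjI2[OF refl] polys2_const[of 1 0]] by simp
  ultimately show ?thesis by (simp add: a_const_kernel)
qed

lemma a_const_pos: "\<gamma> = -1/2 \<or> \<gamma> = 1/2 \<Longrightarrow> a_const \<gamma> w > 0"
proof (elim disjE)
  show "a_const \<gamma> w > 0" if "\<gamma> = -1/2"
    unfolding that a_const_minus using weight_integral_1_pos[OF weight] by simp
qed (use a_const_plus_pos in \<open>simp only:\<close>)

text \<open>The symmetrized products leave Kronecker deltas for \<open>(k, n) = (k', n')\<close> and for the crossed
  pairing.  For \<open>\<gamma> = -1/2\<close> the crossed pairing contributes exactly when all four indices agree,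
  which the normalization for \<open>k = n\<close> compensates.  For \<open>\<gamma> = 1/2\<close> it would
  need \<open>n + 1 = k' \<le> n'\<close> and \<open>n' + 1 = k \<le> n\<close>, and it never contributes.\<close>

lemma P_gamma_orthonormal:
  assumes g: "\<gamma> = -1/2 \<or> \<gamma> = 1/2" and k: "k \<le> n" "k' \<le> n'"
  shows "a_const \<gamma> w * kernel_integral \<gamma> w
      (\<lambda>s t. P_gamma \<gamma> w k n (s + t) (s * t) * P_gamma \<gamma> w k' n' (s + t) (s * t))
    = (if k = k' \<and> n = n' then 1 else 0)"
proof -
  let ?p = "orthonormal_poly w" and ?L = "weight_integral w"
  have L1: "?L 1 > 0" by (rule weight_integral_1_pos[OF weight])
  have pin: "(\<lambda>s t. P_gamma \<gamma> w k n (s + t) (s * t) * P_gamma \<gamma> w k' n' (s + t) (s * t)) \<in> polys2 (2 * n + 2 * n')"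
    by (intro polys2_mult polys2_sum_prod_compose P_gamma_in_polys2 weight k)
  show ?thesis
  proof (cases "\<gamma> = -1/2")
    case True
    define c where "c = (\<lambda>k n :: nat. if k = n then 1 / 2 else 1 / sqrt 2)"
    have P: "P_gamma \<gamma> w k n (s + t) (s * t)
        = c k n * (poly (?p n) s * poly (?p k) t + 1 * (poly (?p n) t * poly (?p k) s))" if "k \<le> n" for k n s t
      using P_minus(2)[OF weight that, of s t] True by (simp add: P_gamma_def c_def)
    have "kernel_integral \<gamma> w (\<lambda>s t. P_gamma \<gamma> w k n (s + t) (s * t) * P_gamma \<gamma> w k' n' (s + t) (s * t))
        = pair_integral w (\<lambda>s t. P_gamma \<gamma> w k n (s + t) (s * t) * P_gamma \<gamma> w k' n' (s + t) (s * t))"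
      using kernel_integral(2)[OF g pin] True by simp
    also have "\<dots> = pair_integral w (\<lambda>s t. (c k n * c k' n') *
            ((poly (?p n) s * poly (?p k) t + 1 * (poly (?p n) t * poly (?p k) s)) *
             (poly (?p n') s * poly (?p k') t + 1 * (poly (?p n') t * poly (?p k') s))))"
      unfolding P[OF k(1)] P[OF k(2)] by (simp add: mult_ac)
    also have "\<dots> = c k n * c k' n' * (2 * (?L (?p n * ?p n') * ?L (?p k * ?p k') + ?L (?p n * ?p k') * ?L (?p k * ?p n')))"
      unfolding pair_integral_scale by (subst pair_integral_symmetrized_products) auto
    also have "\<dots> = (if k = k' \<and> n = n' then (?L 1)\<^sup>2 else 0)"
      using k by (auto simp: orthonormal_poly(2)[OF weight] c_def power2_eq_square)
    finally show ?thesis using L1 True a_const_minus by simp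
  next
    case False
    with g have g2: "\<gamma> = 1/2" by blast
    define c where "c = sqrt (a_const (-1/2) w / (2 * a_const (1/2) w))"
    have a: "a_const (1/2) w > 0" "a_const (-1/2) w > 0" using a_const_pos by auto
    have cc: "c * c = a_const (-1/2) w / (2 * a_const (1/2) w)"
      using a by (simp add: c_def)
    have P: "P_gamma \<gamma> w k n (s + t) (s * t) * (s - t)
        = c * (poly (?p (n + 1)) s * poly (?p k) t + (-1) * (poly (?p (n + 1)) t * poly (?p k) s))" if "k \<le> n" for k n s t
      using P_plus(2)[OF weight that, of s t] g2 by (simp add: P_gamma_def c_def)
    have "kernel_integral \<gamma> w (\<lambda>s t. P_gamma \<gamma> w k n (s + t) (s * t) * P_gamma \<gamma> w k' n' (s + t) (s * t))
        = pair_integral w (\<lambda>s t. (P_gamma \<gamma> w k n (s + t) (s * t) * (s - t)) * (P_gamma \<gamma> w k' n' (s + t) (s * t) * (s - t)))"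
      unfolding g2 using kernel_integral(2)[OF g pin, unfolded g2] by (simp add: mult_ac power2_eq_square)
    also have "\<dots> = pair_integral w (\<lambda>s t. (c * c) *
            ((poly (?p (n + 1)) s * poly (?p k) t + (-1) * (poly (?p (n + 1)) t * poly (?p k) s)) *
             (poly (?p (n' + 1)) s * poly (?p k') t + (-1) * (poly (?p (n' + 1)) t * poly (?p k') s))))"
      unfolding P[OF k(1)] P[OF k(2)] by (simp add: mult_ac)
    also have "\<dots> = c * c * (2 * (?L (?p (n + 1) * ?p (n' + 1)) * ?L (?p k * ?p k') + (-1) * (?L (?p (n + 1) * ?p k') * ?L (?p k * ?p (n' + 1)))))"
      unfolding pair_integral_scale by (subst pair_integral_symmetrized_products) auto
    also have "\<dots> = c * c * (if k = k' \<and> n = n' then 2 * (?L 1)\<^sup>2 else 0)"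
      using k by (auto simp: orthonormal_poly(2)[OF weight] power2_eq_square)
    finally show ?thesis
      unfolding cc g2 using L1 a a_const_minus by simp
  qed
qed

section \<open>The inner product on the square\<close>

text \<open>The quadratic map \<open>(x, y) \<mapsto> (2 * x * y, x\<^sup>2 + y\<^sup>2 - 1)\<close> carries the weight on the square to the
  weight on \<open>Omega\<close>; this is \<open>integral_square_roots\<close> combined with the formula for
  \<open>square_weight\<close> in terms of the roots.\<close>

lemma square_weight_integral:
  assumes g: "\<gamma> = -1/2 \<or> \<gamma> = 1/2" and P: "P \<in> polys2 m"
  shows "set_integrable lborel square (\<lambda>(x, y). P (2 * x * y) (x\<^sup>2 + y\<^sup>2 - 1) * square_weight \<gamma> w x y)"
    and "(LINT z:square|lborel. (case z of (x, y) \<Rightarrow> P (2 * x * y) (x\<^sup>2 + y\<^sup>2 - 1) * square_weight \<gamma> w x y))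
      = a_const \<gamma> w * kernel_integral \<gamma> w (\<lambda>s t. P (s + t) (s * t))"
proof -
  define G where "G = (\<lambda>s t. 2 * a_const \<gamma> w * (P (s + t) (s * t) * (w s * w t) * ((s - t)\<^sup>2) powr \<gamma>))"
  have sym: "G x y = G y x" for x y by (simp add: G_def mult_ac add_ac power2_commute)
  have P2: "(\<lambda>s t. P (s + t) (s * t)) \<in> polys2 (2 * m)" by (rule polys2_sum_prod_compose[OF P])
  have Gk: "G s t * \<bar>s - t\<bar> = 2 * a_const \<gamma> w * (P (s + t) (s * t) * (w s * w t) * \<bar>s - t\<bar> powr (2 * \<gamma> + 1))" for s t
    unfolding G_def square_powr_times_abs[symmetric] by (simp add: mult_ac)
  have [measurable]: "(\<lambda>z. P (fst z + snd z) (fst z * snd z)) \<in> borel_measurable borel"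
    using polys2_continuous[OF P2, of UNIV] by (intro borel_measurable_continuous_onI)
  have [measurable]: "(\<lambda>z. (fst z - snd z :: real)\<^sup>2) \<in> borel_measurable borel"
    by (intro borel_measurable_continuous_onI continuous_intros)
  have [measurable]: "(\<lambda>z :: real \<times> real. w (fst z)) \<in> borel_measurable borel" "(\<lambda>z :: real \<times> real. w (snd z)) \<in> borel_measurable borel"
    by (intro measurable_compose[OF _ w_borel] borel_measurable_continuous_onI continuous_intros)+
  have mG: "(\<lambda>(x, y). G x y) \<in> borel_measurable borel"
    unfolding G_def case_prod_beta' by measurable
  note kint = kernel_integral(1)[OF g P2]
  have int: "set_integrable lborel square (\<lambda>(s, t). G s t * \<bar>s - t\<bar>)"
    using set_integrable_mult_right[of "2 * a_const \<gamma> w", OF kint] unfolding Gk case_prod_beta' .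
  have lint: "(LINT z:square|lborel. (case z of (s, t) \<Rightarrow> G s t * \<bar>s - t\<bar>))
      = 2 * a_const \<gamma> w * kernel_integral \<gamma> w (\<lambda>s t. P (s + t) (s * t))"
    unfolding Gk kernel_integral_def case_prod_beta' by (rule set_integral_mult_right)
  have eq: "indicator square z *\<^sub>R (case z of (x, y) \<Rightarrow> P (2 * x * y) (x\<^sup>2 + y\<^sup>2 - 1) * square_weight \<gamma> w x y)
      = indicator square z *\<^sub>R (case z of (x, y) \<Rightarrow> G (large_root x y) (small_root x y) * \<bar>x\<^sup>2 - y\<^sup>2\<bar>)" for z
  proof (cases "z \<in> square")
    case True
    then obtain x y where z: "z = (x, y)" and xy: "(x, y) \<in> square" by auto
    show ?thesis
      unfolding z prod.case square_weight_eq[OF xy] G_def roots_sum_prod(1,2)[OF xy] by simp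
  qed simp
  show "set_integrable lborel square (\<lambda>(x, y). P (2 * x * y) (x\<^sup>2 + y\<^sup>2 - 1) * square_weight \<gamma> w x y)"
    using integral_square_roots(1)[OF mG sym int] unfolding set_integrable_def eq .
  show "(LINT z:square|lborel. (case z of (x, y) \<Rightarrow> P (2 * x * y) (x\<^sup>2 + y\<^sup>2 - 1) * square_weight \<gamma> w x y))
      = a_const \<gamma> w * kernel_integral \<gamma> w (\<lambda>s t. P (s + t) (s * t))"
  proof -
    have "(LINT z:square|lborel. (case z of (x, y) \<Rightarrow> P (2 * x * y) (x\<^sup>2 + y\<^sup>2 - 1) * square_weight \<gamma> w x y))
        = (LINT z:square|lborel. (case z of (x, y) \<Rightarrow> G (large_root x y) (small_root x y) * \<bar>x\<^sup>2 - y\<^sup>2\<bar>))"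
      unfolding set_lebesgue_integral_def eq ..
    then show ?thesis
      using integral_square_roots(2)[OF mG sym int, unfolded lint] by linarith
  qed
qed

lemma square_weight_integrable:
  assumes g: "\<gamma> = -1/2 \<or> \<gamma> = 1/2" and f: "f \<in> polys2 m"
  shows "set_integrable lborel square (\<lambda>(x, y). f x y * square_weight \<gamma> w x y)"
proof -
  have int: "integrable lborel (\<lambda>z. indicator square z *\<^sub>R (case z of (x, y) \<Rightarrow> square_weight \<gamma> w x y))"
    using square_weight_integral(1)[OF g polys2_const[of 1 0]] by (simp add: set_integrable_def)
  have "compact square" by (intro compact_Times compact_Icc)
  then have "bounded ((\<lambda>z. f (fst z) (snd z)) ` square)"
    by (intro compact_imp_bounded compact_continuous_image polys2_continuous[OF f])
  then obtain B where "\<forall>v\<in>(\<lambda>z. f (fst z) (snd z)) ` square. norm v \<le> B"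
    unfolding bounded_iff by blast
  then have B: "\<bar>f (fst z) (snd z)\<bar> \<le> B" if "z \<in> square" for z
    using bspec[OF \<open>\<forall>v\<in>_. _\<close> imageI[OF that]] by (simp only: real_norm_def)
  have "integrable lborel (\<lambda>z. f (fst z) (snd z) * (indicator square z *\<^sub>R (case z of (x, y) \<Rightarrow> square_weight \<gamma> w x y)))"
  proof (rule Bochner_Integration.integrable_bound)
    show "integrable lborel (\<lambda>z. B * (indicator square z *\<^sub>R (case z of (x, y) \<Rightarrow> square_weight \<gamma> w x y)))"
      using int by (rule integrable_mult_right)
    show "(\<lambda>z. f (fst z) (snd z) * (indicator square z *\<^sub>R (case z of (x, y) \<Rightarrow> square_weight \<gamma> w x y))) \<in> borel_measurable lborel"
      using polys2_continuous[OF f, of UNIV] borel_measurable_integrable[OF int]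
      by (intro borel_measurable_times) (auto intro: borel_measurable_continuous_onI)
    show "AE z in lborel. norm (f (fst z) (snd z) * (indicator square z *\<^sub>R (case z of (x, y) \<Rightarrow> square_weight \<gamma> w x y)))
        \<le> norm (B * (indicator square z *\<^sub>R (case z of (x, y) \<Rightarrow> square_weight \<gamma> w x y)))"
    proof (rule AE_I2)
      fix z
      show "norm (f (fst z) (snd z) * (indicator square z *\<^sub>R (case z of (x, y) \<Rightarrow> square_weight \<gamma> w x y)))
        \<le> norm (B * (indicator square z *\<^sub>R (case z of (x, y) \<Rightarrow> square_weight \<gamma> w x y)))"
      proof (cases "z \<in> square")
        case True
        then have "\<bar>f (fst z) (snd z)\<bar> \<le> \<bar>B\<bar>" using B[OF True] by linarith
        then show ?thesis by (simp add: abs_mult mult_right_mono)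
      qed simp
    qed
  qed
  moreover have "f (fst z) (snd z) * (indicator square z *\<^sub>R (case z of (x, y) \<Rightarrow> square_weight \<gamma> w x y))
      = indicator square z *\<^sub>R (case z of (x, y) \<Rightarrow> f x y * square_weight \<gamma> w x y)" for z
    by (cases z) simp
  ultimately show ?thesis
    by (simp only: set_integrable_def)
qed

lemma square_inner_lborel:
  assumes g: "\<gamma> = -1/2 \<or> \<gamma> = 1/2" and "f \<in> polys2 m" "h \<in> polys2 n"
  shows "set_integrable lborel square (\<lambda>(x, y). f x y * h x y * square_weight \<gamma> w x y)"
    and "square_inner \<gamma> w f h = (LINT z:square|lborel. (case z of (x, y) \<Rightarrow> f x y * h x y * square_weight \<gamma> w x y))"
proof -
  show int: "set_integrable lborel square (\<lambda>(x, y). f x y * h x y * square_weight \<gamma> w x y)"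
    by (rule square_weight_integrable[OF g polys2_mult[OF assms(2,3)]])
  show "square_inner \<gamma> w f h = (LINT z:square|lborel. (case z of (x, y) \<Rightarrow> f x y * h x y * square_weight \<gamma> w x y))"
    using integral_completion[OF borel_measurable_integrable[OF int[unfolded set_integrable_def]]]
    by (simp add: square_inner_def set_lebesgue_integral_def)
qed

lemma square_inner_add:
  assumes g: "\<gamma> = -1/2 \<or> \<gamma> = 1/2" and f: "f \<in> polys2 m" and f': "f' \<in> polys2 m" and h: "h \<in> polys2 n"
  shows "square_inner \<gamma> w (\<lambda>x y. f x y + f' x y) h = square_inner \<gamma> w f h + square_inner \<gamma> w f' h"
  using set_integral_add(2)[OF square_inner_lborel(1)[OF g f h] square_inner_lborel(1)[OF g f' h]]
  unfolding square_inner_lborel(2)[OF g f h] square_inner_lborel(2)[OF g f' h]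
    square_inner_lborel(2)[OF g polys2_add[OF f f'] h] case_prod_beta' distrib_right .

lemma square_inner_scale: "square_inner \<gamma> w (\<lambda>x y. c * f x y) h = c * square_inner \<gamma> w f h"
proof -
  have "square_inner \<gamma> w (\<lambda>x y. c * f x y) h
      = (LINT z:square|lebesgue. c * (case z of (x, y) \<Rightarrow> f x y * h x y * square_weight \<gamma> w x y))"
    unfolding square_inner_def case_prod_beta' mult.assoc ..
  then show ?thesis
    unfolding square_inner_def by (simp only: set_integral_mult_right)
qed

lemma square_inner_sum:
  assumes g: "\<gamma> = -1/2 \<or> \<gamma> = 1/2" and f: "\<And>i. i \<in> I \<Longrightarrow> f i \<in> polys2 m" and h: "h \<in> polys2 n"
  shows "square_inner \<gamma> w (\<lambda>x y. \<Sum>i\<in>I. c i * f i x y) h = (\<Sum>i\<in>I. c i * square_inner \<gamma> w (f i) h)"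
  using f
proof (induction I rule: infinite_finite_induct)
  case (infinite I)
  then show ?case using square_inner_scale[of \<gamma> 0 "\<lambda>_ _. 0" h] by simp
next
  case empty
  then show ?case using square_inner_scale[of \<gamma> 0 "\<lambda>_ _. 0" h] by simp
next
  case (insert i I)
  then show ?case
    using square_inner_add[OF g polys2_scale[of "f i" m "c i"] polys2_sum[of I "\<lambda>i x y. c i * f i x y" m] h]
    by (simp add: polys2_scale square_inner_scale)
qed

lemma square_inner_commute: "square_inner \<gamma> w f h = square_inner \<gamma> w h f"
  unfolding square_inner_def mult.commute[of "f _ _" "h _ _"] ..

end

lemma integral_lborel_swap:
  fixes f :: "real \<times> real \<Rightarrow> real"
  assumes "integrable lborel f"
  shows "(LINT z|lborel. f (snd z, fst z)) = integral\<^sup>L lborel f"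
proof -
  have "f \<in> borel_measurable (lborel \<Otimes>\<^sub>M lborel)"
    using assms by (simp add: lborel_prod)
  from lborel_pair.integral_product_swap[OF this] show ?thesis
    by (simp only: lborel_prod case_prod_beta')
qed

lemma integral_lborel_uminus:
  fixes f :: "real \<times> real \<Rightarrow> real"
  assumes "integrable lborel f"
  shows "(LINT z|lborel. f (- z)) = integral\<^sup>L lborel f"
proof -
  have [measurable]: "f \<in> borel_measurable borel" using assms by auto
  have "integral\<^sup>L lborel f = integral\<^sup>L (distr lborel borel (\<lambda>z. 0 + (-1) *\<^sub>R z)) f"
    using lborel_affine[of "-1" "0 :: real \<times> real"] by (simp add: density_1)
  then show ?thesis by (simp add: integral_distr)
qed

context borel_weight
begin

text \<open>The weight on the square is invariant under \<open>(x, y) \<mapsto> (y, x)\<close> and \<open>(x, y) \<mapsto> (-x, -y)\<close>.\<close>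

lemma square_inner_antisymmetric:
  assumes g: "\<gamma> = -1/2 \<or> \<gamma> = 1/2" and f: "f \<in> polys2 m" and h: "h \<in> polys2 n"
    and anti: "(\<forall>x y. f y x * h y x = - (f x y * h x y)) \<or> (\<forall>x y. f (- x) (- y) * h (- x) (- y) = - (f x y * h x y))"
  shows "square_inner \<gamma> w f h = 0"
proof -
  define F where "F = (\<lambda>z. indicator square z *\<^sub>R (case z of (x, y) \<Rightarrow> f x y * h x y * square_weight \<gamma> w x y))"
  have int: "integrable lborel F"
    using square_inner_lborel(1)[OF g f h] by (simp add: F_def set_integrable_def)
  have inner: "square_inner \<gamma> w f h = integral\<^sup>L lborel F"
    using square_inner_lborel(2)[OF g f h] by (simp add: F_def set_lebesgue_integral_def)
  from anti have "integral\<^sup>L lborel F = - integral\<^sup>L lborel F"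
  proof
    assume a: "\<forall>x y. f y x * h y x = - (f x y * h x y)"
    have "square_weight \<gamma> w y x = square_weight \<gamma> w x y" for x y
      by (simp add: square_weight_def mult_ac add_ac abs_minus_commute)
    then have "F (snd z, fst z) = - F z" for z
      using a[rule_format, of "snd z" "fst z"] by (cases z) (auto simp: F_def indicator_def)
    then show ?thesis using integral_lborel_swap[OF int] by simp
  next
    assume a: "\<forall>x y. f (- x) (- y) * h (- x) (- y) = - (f x y * h x y)"
    have "square_weight \<gamma> w (- x) (- y) = square_weight \<gamma> w x y" for x y
      by (simp add: square_weight_def)
    then have "F (- z) = - F z" for z
      using a[rule_format, of "fst z" "snd z"] by (cases z) (auto simp: F_def indicator_def)
    then show ?thesis using integral_lborel_uminus[OF int] by simp
  qed
  with inner show ?thesis by simp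
qed

end

section \<open>Orthonormal bases by counting dimensions\<close>

text \<open>Real functions of two variables as a vector space, for the comparison of the number of
  independent elements with the size of a spanning set.\<close>

interpretation fun2: vector_space "\<lambda>(c::real) (f::real \<Rightarrow> real \<Rightarrow> real). (\<lambda>x y. c * f x y)"
  by unfold_locales (simp_all add: fun_eq_iff distrib_left distrib_right)

lemma sum_fun2_apply: "(\<Sum>i\<in>A. f i) x y = (\<Sum>i\<in>A. f i x y :: real)"
  by (induction A rule: infinite_finite_induct) simp_all

definition monomials2 :: "nat \<Rightarrow> (real \<Rightarrow> real \<Rightarrow> real) set" where
  "monomials2 m = (\<lambda>(i, j) x y. x ^ i * y ^ j) ` Sigma {..m} (\<lambda>i. {..m - i})"

lemma card_monomials2: "finite (monomials2 m)" "card (monomials2 m) \<le> (\<Sum>l\<le>m. l + 1)"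
proof -
  have "card (monomials2 m) \<le> card (Sigma {..m} (\<lambda>i. {..m - i}))"
    unfolding monomials2_def by (rule card_image_le) auto
  also have "\<dots> = (\<Sum>i<Suc m. (m - i) + 1)"
    by (simp add: card_SigmaI lessThan_Suc_atMost)
  also have "\<dots> = (\<Sum>l\<le>m. l + 1)"
    using sum.nat_diff_reindex[of "\<lambda>l. l + 1" "Suc m"] by (simp only: diff_Suc_Suc lessThan_Suc_atMost)
  finally show "card (monomials2 m) \<le> (\<Sum>l\<le>m. l + 1)" .
  show "finite (monomials2 m)" by (simp add: monomials2_def)
qed

lemma polys2_span: "f \<in> polys2 m \<Longrightarrow> f \<in> fun2.span (monomials2 m)"
proof (elim polys2_E)
  fix c assume c: "f = (\<lambda>x y. \<Sum>i\<le>m. \<Sum>j\<le>m - i. c i j * (x ^ i * y ^ j))"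
  have "f = (\<Sum>i\<le>m. \<Sum>j\<le>m - i. (\<lambda>x y. c i j * (x ^ i * y ^ j)))"
    by (simp add: c fun_eq_iff sum_fun2_apply)
  also have "\<dots> \<in> fun2.span (monomials2 m)"
    by (intro fun2.span_sum fun2.span_scale fun2.span_base) (auto simp: monomials2_def intro!: image_eqI)
  finally show ?thesis .
qed

context borel_weight
begin

text \<open>An orthonormal family is independent.  If it has as many members as there are monomials of
  degree at most \<open>m\<close>, a polynomial outside of its span would give one independent element too many.\<close>

lemma orthonormal_spans_polys2:
  assumes g: "\<gamma> = -1/2 \<or> \<gamma> = 1/2"
    and fin: "finite I" and card: "card I = (\<Sum>l\<le>m. l + 1)"
    and in_polys: "\<And>i. i \<in> I \<Longrightarrow> e i \<in> polys2 m"
    and orth: "\<And>i j. i \<in> I \<Longrightarrow> j \<in> I \<Longrightarrow> square_inner \<gamma> w (e i) (e j) = (if i = j then 1 else 0)"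
    and f: "f \<in> polys2 m"
  obtains c where "f = (\<lambda>x y. \<Sum>i\<in>I. c i * e i x y)"
proof -
  have inj: "inj_on e I"
    using orth by (intro inj_onI) (metis zero_neq_one)
  have sum_B: "(\<Sum>v\<in>e ` I. (\<lambda>x y. u v * v x y)) = (\<lambda>x y. \<Sum>i\<in>I. u (e i) * e i x y)" for u
    by (simp add: fun_eq_iff sum_fun2_apply sum.reindex[OF inj])
  have ind: "fun2.independent (e ` I)"
  proof
    assume "fun2.dependent (e ` I)"
    then obtain u i where i: "i \<in> I" "u (e i) \<noteq> 0" and 0: "(\<Sum>v\<in>e ` I. (\<lambda>x y. u v * v x y)) = 0"
      using fin by (subst (asm) fun2.dependent_finite) auto
    have "(\<Sum>j\<in>I. u (e j) * square_inner \<gamma> w (e j) (e i)) = square_inner \<gamma> w (\<lambda>x y. \<Sum>j\<in>I. u (e j) * e j x y) (e i)"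
      by (rule square_inner_sum[OF g, where m = m and n = m, symmetric]) (use in_polys i in auto)
    also have "(\<lambda>x y. \<Sum>j\<in>I. u (e j) * e j x y) = (\<lambda>x y. 0 * e i x y)"
      using 0 unfolding sum_B by (simp add: fun_eq_iff)
    also have "square_inner \<gamma> w \<dots> (e i) = 0"
      unfolding square_inner_scale by simp
    also have "(\<Sum>j\<in>I. u (e j) * square_inner \<gamma> w (e j) (e i)) = (\<Sum>j\<in>I. if j = i then u (e i) else 0)"
      using orth i by (intro sum.cong) auto
    finally show False using i fin by simp
  qed
  have "f \<in> fun2.span (e ` I)"
  proof (rule ccontr)
    assume nf: "f \<notin> fun2.span (e ` I)"
    then have "fun2.independent (insert f (e ` I))"
      using ind by (rule fun2.independent_insertI)
    moreover have "insert f (e ` I) \<subseteq> fun2.span (monomials2 m)"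
      using f in_polys polys2_span by blast
    ultimately have "card (insert f (e ` I)) \<le> card (monomials2 m)"
      using fun2.independent_span_bound[OF card_monomials2(1)] by blast
    moreover have "f \<notin> e ` I" using nf fun2.span_base by blast
    then have "card (insert f (e ` I)) = Suc (card I)"
      using fin inj by (simp add: card_image)
    ultimately show False using card_monomials2(2)[of m] card by linarith
  qed
  then obtain u where "f = (\<Sum>v\<in>e ` I. (\<lambda>x y. u v * v x y))"
    using fin by (subst (asm) fun2.span_finite) auto
  then show thesis using that[of "\<lambda>i. u (e i)"] by (simp only: sum_B)
qed

text \<open>A family that is orthonormal across all degrees, with \<open>l + 1\<close> members of degree at most \<open>l\<close>
  for every \<open>l\<close>, spans all polynomials degree by degree.  The members of degree \<open>m\<close> are then
  orthogonal to everything of smaller degree, and an element of \<open>orth_space \<gamma> w m\<close> has zero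
  coefficients at all members of smaller degree.\<close>

lemma graded_orthonormal_basis:
  assumes g: "\<gamma> = -1/2 \<or> \<gamma> = 1/2"
    and fin: "\<And>l. finite (I l)" and card: "\<And>l. card (I l) = l + 1"
    and in_polys: "\<And>l i. i \<in> I l \<Longrightarrow> e l i \<in> polys2 l"
    and orth: "\<And>l i l' i'. i \<in> I l \<Longrightarrow> i' \<in> I l' \<Longrightarrow>
      square_inner \<gamma> w (e l i) (e l' i') = (if l = l' \<and> i = i' then 1 else 0)"
  shows "orthonormal_basis_on (square_inner \<gamma> w) (orth_space \<gamma> w m) (I m) (e m)"
proof -
  define J where "J = (\<lambda>m. Sigma {..m} I)"
  define E where "E = (\<lambda>(l, i). e l i)"
  have expand: "\<exists>c. f = (\<lambda>x y. \<Sum>p\<in>J m. c p * E p x y)" if f: "f \<in> polys2 m" for f m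
  proof (rule orthonormal_spans_polys2[OF g, of "J m" m E f])
    show "finite (J m)" unfolding J_def using fin by auto
    show "card (J m) = (\<Sum>l\<le>m. l + 1)" unfolding J_def using fin card by (simp add: card_SigmaI)
    show "E p \<in> polys2 m" if "p \<in> J m" for p
      using that in_polys by (auto simp: J_def E_def intro: polys2_mono)
    show "square_inner \<gamma> w (E p) (E q) = (if p = q then 1 else 0)" if "p \<in> J m" "q \<in> J m" for p q
    proof -
      obtain l i l' i' where "p = (l, i)" "i \<in> I l" "q = (l', i')" "i' \<in> I l'"
        using \<open>p \<in> J m\<close> \<open>q \<in> J m\<close> by (auto simp: J_def)
      then show ?thesis using orth[of i l i' l'] by (simp add: E_def)
    qed
  qed (use f in auto)
  \<comment> \<open>expansions of degree \<open>k\<close> have no component along members of larger degree\<close>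
  have coeff: "square_inner \<gamma> w (\<lambda>x y. \<Sum>p\<in>J k. c p * E p x y) (e l i) = (if l \<le> k then c (l, i) else 0)"
    if i: "i \<in> I l" for c k l i
  proof -
    have "square_inner \<gamma> w (\<lambda>x y. \<Sum>p\<in>J k. c p * E p x y) (e l i) = (\<Sum>p\<in>J k. c p * square_inner \<gamma> w (E p) (e l i))"
    proof (rule square_inner_sum[OF g])
      show "E p \<in> polys2 k" if "p \<in> J k" for p
        using that in_polys by (auto simp: J_def E_def intro: polys2_mono)
    qed (rule in_polys[OF i])
    also have "\<dots> = (\<Sum>p\<in>J k. if p = (l, i) then c (l, i) else 0)"
    proof (rule sum.cong[OF refl])
      fix p assume "p \<in> J k"
      then obtain l' i' where "p = (l', i')" "i' \<in> I l'" by (auto simp: J_def)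
      then show "c p * square_inner \<gamma> w (E p) (e l i) = (if p = (l, i) then c (l, i) else 0)"
        using orth[of i' l' i l] i by (auto simp: E_def)
    qed
    also have "\<dots> = (if l \<le> k then c (l, i) else 0)"
      using fin i by (simp add: J_def)
    finally show ?thesis .
  qed
  show ?thesis
    unfolding orthonormal_basis_on_def
  proof (intro conjI ballI)
    show "finite (I m)" by (rule fin)
    show "square_inner \<gamma> w (e m i) (e m j) = (if i = j then 1 else 0)" if "i \<in> I m" "j \<in> I m" for i j
      using orth[OF that] by simp
    show "e m i \<in> orth_space \<gamma> w m" if i: "i \<in> I m" for i
      unfolding orth_space_def
    proof (intro CollectI conjI allI impI ballI)
      show "e m i \<in> polys2 m" by (rule in_polys[OF i])
      fix l h assume "l < m" "h \<in> polys2 l"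
      then obtain c where "h = (\<lambda>x y. \<Sum>p\<in>J l. c p * E p x y)" using expand by blast
      then have "square_inner \<gamma> w h (e m i) = 0"
        using coeff[OF i, of c l] \<open>l < m\<close> by simp
      then show "square_inner \<gamma> w (e m i) h = 0" by (simp only: square_inner_commute)
    qed
    fix f assume f: "f \<in> orth_space \<gamma> w m"
    then have "f \<in> polys2 m" by (simp add: orth_space_def)
    then obtain c where c: "f = (\<lambda>x y. \<Sum>p\<in>J m. c p * E p x y)"
      using expand by blast
    have 0: "c (l, i) = 0" if "l < m" "i \<in> I l" for l i
      using f in_polys[OF that(2)] that coeff[OF that(2), of c m] unfolding orth_space_def c by auto
    have "f x y = (\<Sum>i\<in>I m. c (m, i) * e m i x y)" for x y
    proof -
      have "f x y = (\<Sum>l\<le>m. \<Sum>i\<in>I l. c (l, i) * e l i x y)"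
        unfolding c J_def E_def using fin by (subst sum.Sigma) (auto intro!: sum.cong)
      also have "\<dots> = (\<Sum>l\<in>{m}. \<Sum>i\<in>I l. c (l, i) * e l i x y)"
        by (rule sum.mono_neutral_right) (auto simp: 0)
      finally show ?thesis by simp
    qed
    then show "\<exists>c. \<forall>x y. f x y = (\<Sum>i\<in>I m. c i * e m i x y)" by (intro exI[of _ "\<lambda>i. c (m, i)"]) simp
  qed
qed

end

section \<open>The orthonormal families on the square\<close>

text \<open>All four families at once: the pairs \<open>(i, j)\<close> equal to \<open>(0, 0)\<close> and \<open>(1, 1)\<close> give even degrees,
  \<open>(0, 1)\<close> and \<open>(1, 0)\<close> give odd ones, and the degree is \<open>2 * n + i + j\<close>.\<close>

definition Q_general :: "real \<Rightarrow> (real \<Rightarrow> real) \<Rightarrow> nat \<Rightarrow> nat \<Rightarrow> nat \<Rightarrow> nat \<Rightarrow> real \<Rightarrow> real \<Rightarrow> real" where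
  "Q_general \<gamma> w i j n k x y = b_const \<gamma> w i j * ((x - y) ^ i * (x + y) ^ j) *
     P_gamma \<gamma> (shifted_weight i j w) k n (2 * x * y) (x\<^sup>2 + y\<^sup>2 - 1)"

lemma Q_general_swap: "Q_general \<gamma> w i j n k y x = (-1) ^ i * Q_general \<gamma> w i j n k x y"
proof -
  have "y - x = (-1) * (x - y)" by simp
  then have 1: "(y - x) ^ i = (-1) ^ i * (x - y) ^ i" by (simp only: power_mult_distrib)
  have 2: "2 * y * x = 2 * x * y" "y\<^sup>2 + x\<^sup>2 - 1 = x\<^sup>2 + y\<^sup>2 - 1" "y + x = x + y" by simp_all
  show ?thesis unfolding Q_general_def 1 2 by (simp only: mult_ac)
qed

lemma Q_general_uminus: "Q_general \<gamma> w i j n k (- x) (- y) = (-1) ^ (i + j) * Q_general \<gamma> w i j n k x y"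
proof -
  have "- x - - y = (-1) * (x - y)" "- x + - y = (-1) * (x + y)" by simp_all
  then have 1: "(- x - - y) ^ i = (-1) ^ i * (x - y) ^ i" "(- x + - y) ^ j = (-1) ^ j * (x + y) ^ j"
    by (simp_all only: power_mult_distrib)
  have 2: "2 * - x * - y = 2 * x * y" "(- x)\<^sup>2 + (- y)\<^sup>2 - 1 = x\<^sup>2 + y\<^sup>2 - 1" by simp_all
  show ?thesis unfolding Q_general_def 1 2 power_add by (simp only: mult_ac)
qed

lemma Q_general_in_polys2:
  assumes w: "weight_function w" and "k \<le> n"
  shows "Q_general \<gamma> w i j n k \<in> polys2 (2 * n + i + j)"
proof -
  have u: "(\<lambda>x y::real. 2 * x * y) \<in> polys2 2"
    using polys2_scale[OF polys2_monom[of 1 1 2], of 2] by (simp add: mult.assoc)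
  have v: "(\<lambda>x y::real. x\<^sup>2 + y\<^sup>2 - 1) \<in> polys2 2"
    using polys2_diff[OF polys2_add[OF polys2_monom[of 2 0 2] polys2_monom[of 0 2 2]] polys2_const[of 1]] by simp
  have m: "(\<lambda>x y::real. x - y) \<in> polys2 1" and p: "(\<lambda>x y::real. x + y) \<in> polys2 1"
    using polys2_diff[OF polys2_monom[of 1 0 1] polys2_monom[of 0 1 1]]
      polys2_add[OF polys2_monom[of 1 0 1] polys2_monom[of 0 1 1]] by simp_all
  have "(\<lambda>x y. (b_const \<gamma> w i j * ((x - y) ^ i * (x + y) ^ j)) *
     P_gamma \<gamma> (shifted_weight i j w) k n (2 * x * y) (x\<^sup>2 + y\<^sup>2 - 1)) \<in> polys2 ((1 * i + 1 * j) + 2 * n)"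
    by (intro polys2_mult polys2_scale polys2_power m p polys2_compose[OF _ u v]
        P_gamma_in_polys2 weight_function_shifted w \<open>k \<le> n\<close>)
  moreover have "(1 * i + 1 * j) + 2 * n = 2 * n + i + j" by simp
  ultimately show ?thesis unfolding Q_general_def[abs_def] by (simp only:)
qed

lemma Q_general_special:
  assumes a: "a_const \<gamma> w > 0"
  shows "Q1_even \<gamma> w n = Q_general \<gamma> w 0 0 n" "Q2_even \<gamma> w n = Q_general \<gamma> w 1 1 (n - 1)"
    "Q1_odd \<gamma> w n = Q_general \<gamma> w 0 1 n" "Q2_odd \<gamma> w n = Q_general \<gamma> w 1 0 n"
proof -
  have w0: "shifted_weight 0 0 w = w" by (simp add: shifted_weight_def)
  show "Q1_even \<gamma> w n = Q_general \<gamma> w 0 0 n"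
    using a by (simp add: fun_eq_iff Q1_even_def Q_general_def b_const_def w0)
  have "x\<^sup>2 - y\<^sup>2 = (x - y) * (x + y)" for x y :: real
    by (simp add: power2_eq_square algebra_simps)
  then show "Q2_even \<gamma> w n = Q_general \<gamma> w 1 1 (n - 1)"
    by (intro ext) (simp only: Q2_even_def Q_general_def power_one_right)
  show "Q1_odd \<gamma> w n = Q_general \<gamma> w 0 1 n" "Q2_odd \<gamma> w n = Q_general \<gamma> w 1 0 n"
    by (simp_all add: fun_eq_iff Q1_odd_def Q2_odd_def Q_general_def)
qed

context borel_weight
begin

lemma borel_weight_shifted: "borel_weight (shifted_weight i j w)"
proof
  have "(\<lambda>x. (1 - x) ^ i * (1 + x) ^ j * w x) \<in> borel_measurable borel" by measurable
  then show "shifted_weight i j w \<in> borel_measurable borel" by (simp only: shifted_weight_def)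
  show "weight_function (shifted_weight i j w)" by (rule weight_function_shifted[OF weight])
qed

text \<open>Squaring the prefactor produces the modified weight, since
  \<open>(x - y)\<^sup>2 = (1 - s) * (1 - t)\<close> and \<open>(x + y)\<^sup>2 = (1 + s) * (1 + t)\<close> at the roots \<open>s\<close> and \<open>t\<close>.\<close>

lemma square_weight_shifted:
  assumes g: "\<gamma> = -1/2 \<or> \<gamma> = 1/2" and xy: "(x, y) \<in> square"
  shows "(b_const \<gamma> w i j * ((x - y) ^ i * (x + y) ^ j))\<^sup>2 * square_weight \<gamma> w x y
    = square_weight \<gamma> (shifted_weight i j w) x y"
proof -
  interpret S: borel_weight "shifted_weight i j w" by (rule borel_weight_shifted)
  let ?s = "large_root x y" and ?t = "small_root x y"
  note r = roots_sum_prod(1,2)[OF xy]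
  have b: "(b_const \<gamma> w i j)\<^sup>2 = a_const \<gamma> (shifted_weight i j w) / a_const \<gamma> w"
    using a_const_pos[OF g] S.a_const_pos[OF g] by (simp add: b_const_def)
  have "(1 - ?s) * (1 - ?t) = 1 - (?s + ?t) + ?s * ?t" "(1 + ?s) * (1 + ?t) = 1 + (?s + ?t) + ?s * ?t"
    by (simp_all add: algebra_simps)
  then have m: "(1 - ?s) * (1 - ?t) = (x - y)\<^sup>2" and p: "(1 + ?s) * (1 + ?t) = (x + y)\<^sup>2"
    unfolding r by (simp_all add: power2_eq_square algebra_simps)
  have "shifted_weight i j w ?s * shifted_weight i j w ?t
      = ((1 - ?s) * (1 - ?t)) ^ i * ((1 + ?s) * (1 + ?t)) ^ j * (w ?s * w ?t)"
    by (simp add: shifted_weight_def power_mult_distrib mult_ac)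
  also have "\<dots> = ((x - y) ^ i * (x + y) ^ j)\<^sup>2 * (w ?s * w ?t)"
    unfolding m p by (simp add: power_mult_distrib power2_eq_square)
  finally show ?thesis
    unfolding square_weight_eq[OF xy] power_mult_distrib[of "b_const \<gamma> w i j"] b
    using a_const_pos[OF g] by (simp add: field_simps)
qed

lemma Q_general_orthonormal_same:
  assumes g: "\<gamma> = -1/2 \<or> \<gamma> = 1/2" and k: "k \<le> n" "k' \<le> n'"
  shows "square_inner \<gamma> w (Q_general \<gamma> w i j n k) (Q_general \<gamma> w i j n' k') = (if k = k' \<and> n = n' then 1 else 0)"
proof -
  interpret S: borel_weight "shifted_weight i j w" by (rule borel_weight_shifted)
  let ?w = "shifted_weight i j w"
  let ?PP = "\<lambda>u v. P_gamma \<gamma> ?w k n u v * P_gamma \<gamma> ?w k' n' u v"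
  have PP: "?PP \<in> polys2 (n + n')"
    by (intro polys2_mult P_gamma_in_polys2 S.weight k)
  have "square_inner \<gamma> w (Q_general \<gamma> w i j n k) (Q_general \<gamma> w i j n' k')
    = (LINT z:square|lborel. (case z of (x, y) \<Rightarrow>
        Q_general \<gamma> w i j n k x y * Q_general \<gamma> w i j n' k' x y * square_weight \<gamma> w x y))"
    by (rule square_inner_lborel(2)[OF g Q_general_in_polys2[OF weight k(1)] Q_general_in_polys2[OF weight k(2)]])
  also have "\<dots> = (LINT z:square|lborel. (case z of (x, y) \<Rightarrow>
        ?PP (2 * x * y) (x\<^sup>2 + y\<^sup>2 - 1) * square_weight \<gamma> ?w x y))"
    unfolding set_lebesgue_integral_def
  proof (rule Bochner_Integration.integral_cong[OF refl])
    fix z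
    show "indicat_real square z *\<^sub>R (case z of (x, y) \<Rightarrow>
        Q_general \<gamma> w i j n k x y * Q_general \<gamma> w i j n' k' x y * square_weight \<gamma> w x y)
      = indicat_real square z *\<^sub>R (case z of (x, y) \<Rightarrow>
        ?PP (2 * x * y) (x\<^sup>2 + y\<^sup>2 - 1) * square_weight \<gamma> ?w x y)"
    proof (cases "z \<in> square")
      case True
      then obtain x y where z: "z = (x, y)" and xy: "(x, y) \<in> square" by auto
      show ?thesis
        unfolding z prod.case square_weight_shifted[OF g xy, symmetric] Q_general_def
        by (simp add: power2_eq_square mult_ac)
    qed simp
  qed
  also have "\<dots> = (if k = k' \<and> n = n' then 1 else 0)"
    unfolding S.square_weight_integral(2)[OF g PP] by (rule S.P_gamma_orthonormal[OF g k])
  finally show ?thesis .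
qed

text \<open>Different pairs \<open>(i, j)\<close> have different parity under the swap \<open>(x, y) \<mapsto> (y, x)\<close>, governed by
  \<open>i\<close>, or under \<open>(x, y) \<mapsto> (-x, -y)\<close>, governed by \<open>i + j\<close>.\<close>

lemma Q_general_orthonormal:
  assumes g: "\<gamma> = -1/2 \<or> \<gamma> = 1/2" and k: "k \<le> n" "k' \<le> n'"
    and ij: "i \<le> 1" "j \<le> 1" "i' \<le> 1" "j' \<le> 1"
  shows "square_inner \<gamma> w (Q_general \<gamma> w i j n k) (Q_general \<gamma> w i' j' n' k')
    = (if i = i' \<and> j = j' \<and> k = k' \<and> n = n' then 1 else 0)"
proof (cases "i = i' \<and> j = j'")
  case True
  then show ?thesis using Q_general_orthonormal_same[OF g k, of i j] by simp
next
  case False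
  have 01: "a = 0 \<or> a = 1" if "a \<le> 1" for a :: nat using that by linarith
  have "(\<forall>x y. Q_general \<gamma> w i j n k y x * Q_general \<gamma> w i' j' n' k' y x
      = - (Q_general \<gamma> w i j n k x y * Q_general \<gamma> w i' j' n' k' x y)) \<or>
    (\<forall>x y. Q_general \<gamma> w i j n k (- x) (- y) * Q_general \<gamma> w i' j' n' k' (- x) (- y)
      = - (Q_general \<gamma> w i j n k x y * Q_general \<gamma> w i' j' n' k' x y))"
  proof (cases "i = i'")
    case True
    then have "(-1 :: real) ^ (i + j) * (-1) ^ (i' + j') = -1"
      using False ij 01[OF ij(1)] 01[OF ij(2)] 01[OF ij(4)] by auto
    then have "Q_general \<gamma> w i j n k (- x) (- y) * Q_general \<gamma> w i' j' n' k' (- x) (- y)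
      = - (Q_general \<gamma> w i j n k x y * Q_general \<gamma> w i' j' n' k' x y)" for x y
      unfolding Q_general_uminus by (metis mult.assoc mult.left_commute mult_minus1)
    then show ?thesis by blast
  next
    case False
    then have "(-1 :: real) ^ i * (-1) ^ i' = -1"
      using 01[OF ij(1)] 01[OF ij(3)] by auto
    then have "Q_general \<gamma> w i j n k y x * Q_general \<gamma> w i' j' n' k' y x
      = - (Q_general \<gamma> w i j n k x y * Q_general \<gamma> w i' j' n' k' x y)" for x y
      unfolding Q_general_swap[of \<gamma> w i j n k y x] Q_general_swap[of \<gamma> w i' j' n' k' y x]
      by (metis mult.assoc mult.left_commute mult_minus1)
    then show ?thesis by blast
  qed
  then have "square_inner \<gamma> w (Q_general \<gamma> w i j n k) (Q_general \<gamma> w i' j' n' k') = 0"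
    by (rule square_inner_antisymmetric[OF g Q_general_in_polys2[OF weight k(1)] Q_general_in_polys2[OF weight k(2)]])
  with False show ?thesis by auto
qed

lemma Q_orthonormal_basis:
  assumes g: "\<gamma> = -1/2 \<or> \<gamma> = 1/2"
  shows "orthonormal_basis_on (square_inner \<gamma> w) (orth_space \<gamma> w (2 * n))
            ({0..n} <+> {0..<n}) (case_sum (Q1_even \<gamma> w n) (Q2_even \<gamma> w n))"
    and "orthonormal_basis_on (square_inner \<gamma> w) (orth_space \<gamma> w (2 * n + 1))
            ({0..n} <+> {0..n}) (case_sum (Q1_odd \<gamma> w n) (Q2_odd \<gamma> w n))"
proof -
  define I :: "nat \<Rightarrow> (nat + nat) set" where
    "I = (\<lambda>l. if even l then {0..l div 2} <+> {0..<l div 2} else {0..l div 2} <+> {0..l div 2})"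
  define e where "e = (\<lambda>l. if even l then case_sum (Q1_even \<gamma> w (l div 2)) (Q2_even \<gamma> w (l div 2))
      else case_sum (Q1_odd \<gamma> w (l div 2)) (Q2_odd \<gamma> w (l div 2)))"
  note Q = Q_general_special[OF a_const_pos[OF g]]
  have index: "\<exists>i j n k. e l p = Q_general \<gamma> w i j n k \<and> i \<le> 1 \<and> j \<le> 1 \<and> k \<le> n \<and> l = 2 * n + i + j
      \<and> p = (if i = 0 then Inl k else Inr k)" if p: "p \<in> I l" for l p
  proof (cases "even l")
    case True
    then obtain m where m: "l = 2 * m" by blast
    from p True consider k where "p = Inl k" "k \<le> m" | k where "p = Inr k" "k < m"
      by (auto simp: I_def m)
    then show ?thesis
    proof cases
      case 1
      then have "e l p = Q_general \<gamma> w 0 0 (m) k \<and> (0::nat) \<le> 1 \<and> (0::nat) \<le> 1 \<and> k \<le> m \<and> l = 2 * (m) + 0 + 0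
          \<and> p = (if (0::nat) = 0 then Inl k else Inr k)"
        using Q(1) m by (simp add: e_def)
      then show ?thesis by blast
    next
      case 2
      then have "e l p = Q_general \<gamma> w 1 1 (m - 1) k \<and> (1::nat) \<le> 1 \<and> (1::nat) \<le> 1 \<and> k \<le> m - 1 \<and> l = 2 * (m - 1) + 1 + 1
          \<and> p = (if (1::nat) = 0 then Inl k else Inr k)"
        using Q(2) m by (auto simp: e_def)
      then show ?thesis by blast
    qed
  next
    case False
    then obtain m where m: "l = 2 * m + 1" by (elim oddE)
    from p False consider k where "p = Inl k" "k \<le> m" | k where "p = Inr k" "k \<le> m"
      by (auto simp: I_def m)
    then show ?thesis
    proof cases
      case 1
      then have "e l p = Q_general \<gamma> w 0 1 (m) k \<and> (0::nat) \<le> 1 \<and> (1::nat) \<le> 1 \<and> k \<le> m \<and> l = 2 * (m) + 0 + 1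
          \<and> p = (if (0::nat) = 0 then Inl k else Inr k)"
        using Q(3) m by (simp add: e_def)
      then show ?thesis by blast
    next
      case 2
      then have "e l p = Q_general \<gamma> w 1 0 (m) k \<and> (1::nat) \<le> 1 \<and> (0::nat) \<le> 1 \<and> k \<le> m \<and> l = 2 * (m) + 1 + 0
          \<and> p = (if (1::nat) = 0 then Inl k else Inr k)"
        using Q(4) m by (simp add: e_def)
      then show ?thesis by blast
    qed
  qed
  have basis: "orthonormal_basis_on (square_inner \<gamma> w) (orth_space \<gamma> w m) (I m) (e m)" for m
  proof (rule graded_orthonormal_basis[OF g])
    show "finite (I l)" for l by (simp add: I_def)
    show "card (I l) = l + 1" for l
      by (cases "even l") (auto simp: I_def card_Plus elim!: evenE oddE)
    show "e l p \<in> polys2 l" if "p \<in> I l" for l p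
      using index[OF that] Q_general_in_polys2[OF weight] by metis
    fix l p l' p' assume p: "p \<in> I l" and p': "p' \<in> I l'"
    obtain i j n k where 1: "e l p = Q_general \<gamma> w i j n k" "i \<le> 1" "j \<le> 1" "k \<le> n" "l = 2 * n + i + j"
      "p = (if i = 0 then Inl k else Inr k)" using index[OF p] by blast
    obtain i' j' n' k' where 2: "e l' p' = Q_general \<gamma> w i' j' n' k'" "i' \<le> 1" "j' \<le> 1" "k' \<le> n'" "l' = 2 * n' + i' + j'"
      "p' = (if i' = 0 then Inl k' else Inr k')" using index[OF p'] by blast
    have "l = l' \<and> p = p' \<longleftrightarrow> i = i' \<and> j = j' \<and> k = k' \<and> n = n'"
    proof
      assume eq: "l = l' \<and> p = p'"
      then have "i = i'" "k = k'" using 1(2,6) 2(2,6) by (auto split: if_splits)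
      moreover from this eq have "2 * n + j = 2 * n' + j'" using 1(5) 2(5) by simp
      then have "n = n'" "j = j'" using 1(3) 2(3) by presburger+
      ultimately show "i = i' \<and> j = j' \<and> k = k' \<and> n = n'" by simp
    qed (use 1(5,6) 2(5,6) in simp)
    then show "square_inner \<gamma> w (e l p) (e l' p') = (if l = l' \<and> p = p' then 1 else 0)"
      unfolding 1(1) 2(1) using Q_general_orthonormal[OF g 1(4) 2(4) 1(2,3) 2(2,3)] by simp
  qed
  show "orthonormal_basis_on (square_inner \<gamma> w) (orth_space \<gamma> w (2 * n))
            ({0..n} <+> {0..<n}) (case_sum (Q1_even \<gamma> w n) (Q2_even \<gamma> w n))"
    using basis[of "2 * n"] by (simp add: I_def e_def)
  show "orthonormal_basis_on (square_inner \<gamma> w) (orth_space \<gamma> w (2 * n + 1))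
            ({0..n} <+> {0..n}) (case_sum (Q1_odd \<gamma> w n) (Q2_odd \<gamma> w n))"
    using basis[of "2 * n + 1"] by (simp add: I_def e_def)
qed

end

section \<open>From Borel to Lebesgue measurable weights\<close>

text \<open>The relation under which all objects of the theorem are invariant; it replaces a Lebesgue
  measurable weight by a Borel measurable one.\<close>

definition ae_equal_weights :: "(real \<Rightarrow> real) \<Rightarrow> (real \<Rightarrow> real) \<Rightarrow> bool" where
  "ae_equal_weights w w' \<longleftrightarrow> (AE x in lborel. x \<in> {-1..1} \<longrightarrow> w x = w' x)"

text \<open>Lebesgue measure is complete, so that \<open>f\<close> and \<open>g\<close> are either
  both measurable or both not, and in the latter case both integrals are zero by convention.\<close>

lemma lebesgue_integral_cong_AE:
  fixes f g :: "'a::euclidean_space \<Rightarrow> real"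
  assumes ae: "AE x in lebesgue. f x = g x"
  shows "integral\<^sup>L lebesgue f = integral\<^sup>L lebesgue g"
proof (cases "f \<in> borel_measurable lebesgue")
  case True
  then have "g \<in> borel_measurable lebesgue" using ae by (rule borel_measurable_AE)
  with True ae show ?thesis by (intro integral_cong_AE)
next
  case False
  have "g \<notin> borel_measurable lebesgue"
  proof
    assume "g \<in> borel_measurable lebesgue"
    moreover have "AE x in lebesgue. g x = f x" using ae by eventually_elim simp
    ultimately show False using False borel_measurable_AE by blast
  qed
  with False show ?thesis
    by (metis borel_measurable_integrable not_integrable_integral_eq)
qed

lemma set_lebesgue_integral_cong_AE:
  fixes f g :: "'a::euclidean_space \<Rightarrow> real"
  assumes "AE x in lebesgue. x \<in> A \<longrightarrow> f x = g x"
  shows "(LINT x:A|lebesgue. f x) = (LINT x:A|lebesgue. g x)"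
  unfolding set_lebesgue_integral_def
proof (rule lebesgue_integral_cong_AE)
  show "AE x in lebesgue. indicat_real A x *\<^sub>R f x = indicat_real A x *\<^sub>R g x"
    using assms by eventually_elim (auto simp: indicator_def)
qed

lemma ae_equal_weights_shifted:
  assumes "ae_equal_weights w w'"
  shows "ae_equal_weights (shifted_weight i j w) (shifted_weight i j w')"
  using assms unfolding ae_equal_weights_def
proof eventually_elim
  case (elim x)
  show ?case
  proof
    assume "x \<in> {-1..1}"
    with elim have "w x = w' x" by blast
    then show "shifted_weight i j w x = shifted_weight i j w' x" by (simp only: shifted_weight_def)
  qed
qed

lemma orthonormal_poly_cong:
  assumes "ae_equal_weights w w'"
  shows "orthonormal_poly w = orthonormal_poly w'"
proof -
  have ae: "AE x in lebesgue. x \<in> {-1..1} \<longrightarrow> w x = w' x"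
    using assms by (simp add: ae_equal_weights_def AE_completion)
  have "(LINT x:{-1..1}|lebesgue. h x * w x) = (LINT x:{-1..1}|lebesgue. h x * w' x)" for h
  proof (rule set_lebesgue_integral_cong_AE)
    show "AE x in lebesgue. x \<in> {-1..1} \<longrightarrow> h x * w x = h x * w' x"
      using ae by eventually_elim simp
  qed
  from this[of "\<lambda>x. 1"] this have "is_orthonormal_sequence w p \<longleftrightarrow> is_orthonormal_sequence w' p" for p
    by (simp add: is_orthonormal_sequence_def)
  then show ?thesis by (simp add: orthonormal_poly_def)
qed

text \<open>A null set \<open>N\<close> on the line gives the null set \<open>N \<times> UNIV \<union> UNIV \<times> N\<close> in the plane.\<close>

lemma ae_equal_weights_null_cross:
  assumes "ae_equal_weights w w'"
  obtains N where "N \<in> sets borel" "\<forall>x\<in>{-1..1} - N. w x = w' x"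
    "AE z in lborel. fst z \<notin> N \<and> snd z \<notin> N"
proof -
  obtain N where N: "N \<in> null_sets lborel" "{x \<in> space lborel. \<not> (x \<in> {-1..1} \<longrightarrow> w x = w' x)} \<subseteq> N"
    using assms unfolding ae_equal_weights_def by (auto simp: eventually_ae_filter)
  have NB: "N \<in> sets borel" using N(1) by auto
  have N0: "emeasure lborel N = 0" using N by auto
  have "emeasure (lborel \<Otimes>\<^sub>M lborel) (N \<times> (UNIV :: real set)) = emeasure lborel N * emeasure lborel (UNIV :: real set)"
    "emeasure (lborel \<Otimes>\<^sub>M lborel) ((UNIV :: real set) \<times> N) = emeasure lborel (UNIV :: real set) * emeasure lborel N"
    by (rule lborel.emeasure_pair_measure_Times; simp add: NB)+
  moreover have "N \<times> (UNIV :: real set) \<in> sets (lborel \<Otimes>\<^sub>M lborel)" "(UNIV :: real set) \<times> N \<in> sets (lborel \<Otimes>\<^sub>M lborel)"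
    by (rule pair_measureI; simp add: NB)+
  ultimately have "N \<times> (UNIV :: real set) \<in> null_sets lborel" "(UNIV :: real set) \<times> N \<in> null_sets lborel"
    unfolding N0 lborel_prod mult_zero_left mult_zero_right by (auto intro: null_setsI)
  then have "N \<times> UNIV \<union> UNIV \<times> N \<in> null_sets lborel" by (rule null_sets.Un)
  then have "AE z in lborel. z \<notin> N \<times> UNIV \<union> UNIV \<times> N" by (rule AE_not_in)
  then have ae: "AE z in lborel. fst z \<notin> N \<and> snd z \<notin> N" by eventually_elim auto
  show thesis
  proof (rule that[of N, OF NB _ ae])
    show "\<forall>x\<in>{-1..1} - N. w x = w' x"
      using N(2) by auto
  qed
qed

lemma a_const_cong:
  assumes "ae_equal_weights w w'"
  shows "a_const \<gamma> w = a_const \<gamma> w'"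
proof -
  obtain N where "N \<in> sets borel"
    and N: "\<forall>x\<in>{-1..1} - N. w x = w' x" "AE z in lborel. fst z \<notin> N \<and> snd z \<notin> N"
    by (rule ae_equal_weights_null_cross[OF assms])
  have "AE z in lebesgue. fst z \<notin> N \<and> snd z \<notin> N" by (rule AE_completion[OF N(2)])
  then have "AE z in lebesgue. z \<in> {-1..1} \<times> {-1..1} \<longrightarrow> (case z of (x, y) \<Rightarrow> w x * w y * \<bar>x - y\<bar> powr (2 * \<gamma> + 1))
      = (case z of (x, y) \<Rightarrow> w' x * w' y * \<bar>x - y\<bar> powr (2 * \<gamma> + 1))"
    by eventually_elim (use N(1) in auto)
  then show ?thesis
    unfolding a_const_def by (intro arg_cong[where f = inverse] set_lebesgue_integral_cong_AE)
qed

lemma P_gamma_cong: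
  assumes "ae_equal_weights w w'"
  shows "P_gamma \<gamma> w = P_gamma \<gamma> w'"
  unfolding P_gamma_def[abs_def] P_minus_def[abs_def] P_plus_def[abs_def]
    orthonormal_poly_cong[OF assms] a_const_cong[OF assms] ..

lemma b_const_cong:
  assumes "ae_equal_weights w w'"
  shows "b_const \<gamma> w i j = b_const \<gamma> w' i j"
  unfolding b_const_def a_const_cong[OF assms] a_const_cong[OF ae_equal_weights_shifted[OF assms]] ..

lemma Q_cong:
  assumes "ae_equal_weights w w'"
  shows "Q1_even \<gamma> w = Q1_even \<gamma> w'" "Q2_even \<gamma> w = Q2_even \<gamma> w'"
    "Q1_odd \<gamma> w = Q1_odd \<gamma> w'" "Q2_odd \<gamma> w = Q2_odd \<gamma> w'"
  by (intro ext; simp only: Q1_even_def Q2_even_def Q1_odd_def Q2_odd_def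
      b_const_cong[OF assms] P_gamma_cong[OF assms] P_gamma_cong[OF ae_equal_weights_shifted[OF assms]])+

text \<open>The two weights on the square may differ only where one of the roots meets the exceptional set
  \<open>N\<close>.  By the change of variables, the indicator of this event times \<open>\<bar>x\<^sup>2 - y\<^sup>2\<bar>\<close> integrates to
  the integral of \<open>\<bar>s - t\<bar>\<close> over a null set.  The factor \<open>\<bar>x\<^sup>2 - y\<^sup>2\<bar>\<close> is also part of the weights, so
  its zeros do no harm.\<close>

lemma square_inner_cong:
  assumes "ae_equal_weights w w'"
  shows "square_inner \<gamma> w = square_inner \<gamma> w'"
proof -
  obtain N where [measurable]: "N \<in> sets borel"
    and N: "\<forall>x\<in>{-1..1} - N. w x = w' x" "AE z in lborel. fst z \<notin> N \<and> snd z \<notin> N"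
    by (rule ae_equal_weights_null_cross[OF assms])
  \<comment> \<open>the indicator of the event that \<open>s\<close> or \<open>t\<close> is exceptional, in symmetric form\<close>
  define G :: "real \<Rightarrow> real \<Rightarrow> ennreal" where "G = (\<lambda>s t. max (indicator N s) (indicator N t))"
  have mG: "(\<lambda>(s, t). G s t) \<in> borel_measurable borel"
  proof -
    have ind: "(indicator N :: real \<Rightarrow> ennreal) \<in> borel_measurable borel" by simp
    have "(\<lambda>z :: real \<times> real. indicator N (fst z) :: ennreal) \<in> borel_measurable borel"
      "(\<lambda>z :: real \<times> real. indicator N (snd z) :: ennreal) \<in> borel_measurable borel"
      by (rule measurable_compose[OF _ ind]; intro borel_measurable_continuous_onI continuous_intros)+
    then show ?thesis unfolding G_def case_prod_beta' by (intro borel_measurable_max)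
  qed
  let ?F = "\<lambda>z. (case z of (x, y) \<Rightarrow> G (large_root x y) (small_root x y) * ennreal \<bar>x\<^sup>2 - y\<^sup>2\<bar>) * indicator square z"
  have "(\<integral>\<^sup>+z\<in>square. (case z of (s, t) \<Rightarrow> G s t * ennreal \<bar>s - t\<bar>) \<partial>lborel) = (\<integral>\<^sup>+z. 0 \<partial>(lborel :: (real \<times> real) measure))"
  proof (rule nn_integral_cong_AE)
    show "AE z in lborel. (case z of (s, t) \<Rightarrow> G s t * ennreal \<bar>s - t\<bar>) * indicator square z = 0"
      using N(2) by eventually_elim (auto simp: G_def)
  qed
  moreover have "2 * (\<integral>\<^sup>+z. ?F z \<partial>lborel) = (\<integral>\<^sup>+z\<in>square. (case z of (s, t) \<Rightarrow> G s t * ennreal \<bar>s - t\<bar>) \<partial>lborel)"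
    by (rule nn_integral_square_roots[OF mG]) (simp add: G_def max.commute)
  ultimately have "(\<integral>\<^sup>+z. ?F z \<partial>lborel) = 0" by simp
  moreover have "?F \<in> borel_measurable lborel"
  proof -
    have "(\<lambda>z. (\<lambda>(s, t). G s t) (case_prod large_root z, case_prod small_root z)) \<in> borel_measurable borel"
      by (rule measurable_compose[OF _ mG]) measurable
    then have [measurable]: "(\<lambda>z. G (large_root (fst z) (snd z)) (small_root (fst z) (snd z))) \<in> borel_measurable borel"
      by (simp add: case_prod_beta)
    show ?thesis unfolding case_prod_beta' by measurable
  qed
  ultimately have "AE z in lborel. ?F z = 0" by (simp add: nn_integral_0_iff_AE)
  then have ae: "AE z in lebesgue. ?F z = 0" by (rule AE_completion)
  have weights_eq: "square_weight \<gamma> w x y = square_weight \<gamma> w' x y"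
    if xy: "(x, y) \<in> square" and F: "?F (x, y) = 0" for x y
  proof (cases "x\<^sup>2 = y\<^sup>2")
    case True
    then show ?thesis by (simp add: square_weight_def)
  next
    case False
    let ?s = "large_root x y" and ?t = "small_root x y"
    have "G ?s ?t = 0" using F xy False by (simp add: indicator_def)
    then have nN: "?s \<notin> N" "?t \<notin> N" by (auto simp: G_def max_def indicator_def split: if_splits)
    have range: "?s \<in> {-1..1} \<and> ?t \<in> {-1..1}"
    proof -
      obtain a b where ab: "a \<in> {0..pi}" "x = cos a" "b \<in> {0..pi}" "y = cos b"
        using xy by (metis arccos_lbound arccos_ubound atLeastAtMost_iff cos_arccos mem_Sigma_iff)
      then show ?thesis using roots_cos[OF ab(1,3)] by simp
    qed
    then show ?thesis
      unfolding square_weight_eq[OF xy] a_const_cong[OF assms] using N(1) nN by simp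
  qed
  show ?thesis
    unfolding square_inner_def
  proof (intro ext set_lebesgue_integral_cong_AE)
    fix f g :: "real \<Rightarrow> real \<Rightarrow> real"
    show "AE z in lebesgue. z \<in> square \<longrightarrow> (case z of (x, y) \<Rightarrow> f x y * g x y * square_weight \<gamma> w x y)
        = (case z of (x, y) \<Rightarrow> f x y * g x y * square_weight \<gamma> w' x y)"
      using ae
    proof eventually_elim
      case (elim z)
      then show ?case using weights_eq[of "fst z" "snd z"] by (cases z) auto
    qed
  qed
qed

text \<open>A function that is measurable for the completed measure agrees almost everywhere with a Borel
  function; its positive part still agrees with the nonnegative \<open>w\<close> on \<open>[-1, 1]\<close> and is
  nonnegative everywhere.\<close>

lemma ex_borel_weight:
  assumes w: "weight_function w"
  obtains w' where "borel_weight w'" "ae_equal_weights w w'"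
proof -
  have int: "integrable lebesgue (\<lambda>x. indicator {-1..1} x *\<^sub>R w x)"
    using weight_integrable_poly[OF w, of 1] by (simp add: set_integrable_def)
  obtain v where [measurable]: "v \<in> borel_measurable lborel" and v: "AE x in lborel. indicator {-1..1} x *\<^sub>R w x = v x"
    using completion_ex_borel_measurable_real[OF borel_measurable_integrable[OF int]] by blast
  define w' where "w' = (\<lambda>x. max 0 (v x))"
  have eq: "ae_equal_weights w w'"
    unfolding ae_equal_weights_def using v
  proof eventually_elim
    case (elim x)
    show ?case
    proof
      assume x: "x \<in> {-1..1}"
      then have "0 \<le> w x" using w by (simp add: weight_function_def)
      then show "w x = w' x" using elim x by (simp add: w'_def)
    qed
  qed
  then have ae: "AE x in lebesgue. x \<in> {-1..1} \<longrightarrow> w x = w' x"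
    by (simp add: ae_equal_weights_def AE_completion)
  have m: "w' \<in> borel_measurable borel" unfolding w'_def by measurable
  have "weight_function w'"
    unfolding weight_function_def
  proof (intro conjI ballI allI)
    show "0 \<le> w' x" for x by (simp add: w'_def)
    fix n
    have meas: "(\<lambda>x. indicat_real {-1..1} x *\<^sub>R (x ^ n * w' x)) \<in> borel_measurable lebesgue"
      using m by (intro measurable_completion) measurable
    have int_n: "integrable lebesgue (\<lambda>x. indicat_real {-1..1} x *\<^sub>R (x ^ n * w x))"
      using w by (simp add: weight_function_def set_integrable_def)
    have "AE x in lebesgue. indicat_real {-1..1} x *\<^sub>R (x ^ n * w x) = indicat_real {-1..1} x *\<^sub>R (x ^ n * w' x)"
      using ae by eventually_elim (auto simp: indicator_def)
    then show "set_integrable lebesgue {-1..1} (\<lambda>x. x ^ n * w' x)"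
      unfolding set_integrable_def by (rule integrable_cong_AE_imp[OF int_n meas])
    show "0 < (LINT x:{-1..1}|lebesgue. w' x)"
      unfolding set_lebesgue_integral_cong_AE[OF ae, symmetric] using w by (simp only: weight_function_def)
  qed
  with m have "borel_weight w'" by (rule borel_weight.intro)
  from that[OF this eq] show thesis .
qed

section \<open>Orthonormal bases and their explicit form\<close>

theorem corollary4p5:
  fixes \<gamma> :: real and w :: "real \<Rightarrow> real"
  assumes "\<gamma> = -1/2 \<or> \<gamma> = 1/2"
    and "weight_function w"
  shows
    "(\<forall>n. orthonormal_basis_on (square_inner \<gamma> w) (orth_space \<gamma> w (2 * n))
            ({0..n} <+> {0..<n}) (case_sum (Q1_even \<gamma> w n) (Q2_even \<gamma> w n))) \<and>
     (\<forall>n. orthonormal_basis_on (square_inner \<gamma> w) (orth_space \<gamma> w (2 * n + 1))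
            ({0..n} <+> {0..n}) (case_sum (Q1_odd \<gamma> w n) (Q2_odd \<gamma> w n))) \<and>
     (\<forall>w' \<in> {w, shifted_weight 0 1 w, shifted_weight 1 0 w, shifted_weight 1 1 w}.
      \<forall>n k. \<forall>\<theta>\<in>{0..pi}. \<forall>\<phi>\<in>{0..pi}. \<forall>x y.
        k \<le> n \<and> x = cos \<theta> \<and> y = cos \<phi> \<longrightarrow>
        P_gamma (-1/2) w' k n (2 * x * y) (x\<^sup>2 + y\<^sup>2 - 1) =
          (if k = n then 1 / sqrt 2 else 1) *
          (1 / sqrt 2 *
            (orth_eval w' n (cos (\<theta> - \<phi>)) * orth_eval w' k (cos (\<theta> + \<phi>)) +
             orth_eval w' k (cos (\<theta> - \<phi>)) * orth_eval w' n (cos (\<theta> + \<phi>)))) \<and>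
        (sin \<theta> * sin \<phi> \<noteq> 0 \<longrightarrow>
         P_gamma (1/2) w' k n (2 * x * y) (x\<^sup>2 + y\<^sup>2 - 1) =
          sqrt (a_const (-1/2) w' / (2 * a_const (1/2) w')) *
          ((orth_eval w' (n + 1) (cos (\<theta> - \<phi>)) * orth_eval w' k (cos (\<theta> + \<phi>)) -
            orth_eval w' k (cos (\<theta> - \<phi>)) * orth_eval w' (n + 1) (cos (\<theta> + \<phi>)))
           / (2 * sin \<theta> * sin \<phi>))))"
proof (intro conjI)
  obtain v where v: "borel_weight v" and eq: "ae_equal_weights w v"
    using ex_borel_weight[OF assms(2)] by blast
  interpret borel_weight v by (rule v)
  have space: "orth_space \<gamma> w m = orth_space \<gamma> v m" for m
    unfolding orth_space_def square_inner_cong[OF eq] ..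
  show "\<forall>n. orthonormal_basis_on (square_inner \<gamma> w) (orth_space \<gamma> w (2 * n))
            ({0..n} <+> {0..<n}) (case_sum (Q1_even \<gamma> w n) (Q2_even \<gamma> w n))"
    unfolding space square_inner_cong[OF eq] Q_cong[OF eq] using Q_orthonormal_basis(1)[OF assms(1)] by blast
  show "\<forall>n. orthonormal_basis_on (square_inner \<gamma> w) (orth_space \<gamma> w (2 * n + 1))
            ({0..n} <+> {0..n}) (case_sum (Q1_odd \<gamma> w n) (Q2_odd \<gamma> w n))"
    unfolding space square_inner_cong[OF eq] Q_cong[OF eq] using Q_orthonormal_basis(2)[OF assms(1)] by blast
next
  have weights: "weight_function w'"
    if "w' \<in> {w, shifted_weight 0 1 w, shifted_weight 1 0 w, shifted_weight 1 1 w}" for w'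
    using that assms(2) weight_function_shifted by blast
  show "\<forall>w' \<in> {w, shifted_weight 0 1 w, shifted_weight 1 0 w, shifted_weight 1 1 w}.
      \<forall>n k. \<forall>\<theta>\<in>{0..pi}. \<forall>\<phi>\<in>{0..pi}. \<forall>x y.
        k \<le> n \<and> x = cos \<theta> \<and> y = cos \<phi> \<longrightarrow>
        P_gamma (-1/2) w' k n (2 * x * y) (x\<^sup>2 + y\<^sup>2 - 1) =
          (if k = n then 1 / sqrt 2 else 1) *
          (1 / sqrt 2 *
            (orth_eval w' n (cos (\<theta> - \<phi>)) * orth_eval w' k (cos (\<theta> + \<phi>)) +
             orth_eval w' k (cos (\<theta> - \<phi>)) * orth_eval w' n (cos (\<theta> + \<phi>)))) \<and>
        (sin \<theta> * sin \<phi> \<noteq> 0 \<longrightarrow>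
         P_gamma (1/2) w' k n (2 * x * y) (x\<^sup>2 + y\<^sup>2 - 1) =
          sqrt (a_const (-1/2) w' / (2 * a_const (1/2) w')) *
          ((orth_eval w' (n + 1) (cos (\<theta> - \<phi>)) * orth_eval w' k (cos (\<theta> + \<phi>)) -
            orth_eval w' k (cos (\<theta> - \<phi>)) * orth_eval w' (n + 1) (cos (\<theta> + \<phi>)))
           / (2 * sin \<theta> * sin \<phi>)))"
  proof (intro ballI allI impI conjI; elim conjE)
    fix w' and n k :: nat and \<theta> \<phi> x y :: real
    assume w': "w' \<in> {w, shifted_weight 0 1 w, shifted_weight 1 0 w, shifted_weight 1 1 w}"
      and k: "k \<le> n" and x: "x = cos \<theta>" and y: "y = cos \<phi>"
    show "P_gamma (-1/2) w' k n (2 * x * y) (x\<^sup>2 + y\<^sup>2 - 1) =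
          (if k = n then 1 / sqrt 2 else 1) *
          (1 / sqrt 2 *
            (orth_eval w' n (cos (\<theta> - \<phi>)) * orth_eval w' k (cos (\<theta> + \<phi>)) +
             orth_eval w' k (cos (\<theta> - \<phi>)) * orth_eval w' n (cos (\<theta> + \<phi>))))"
      unfolding x y by (rule P_gamma_minus_trig[OF weights[OF w'] k])
    assume "sin \<theta> * sin \<phi> \<noteq> 0"
    then show "P_gamma (1/2) w' k n (2 * x * y) (x\<^sup>2 + y\<^sup>2 - 1) =
          sqrt (a_const (-1/2) w' / (2 * a_const (1/2) w')) *
          ((orth_eval w' (n + 1) (cos (\<theta> - \<phi>)) * orth_eval w' k (cos (\<theta> + \<phi>)) -
            orth_eval w' k (cos (\<theta> - \<phi>)) * orth_eval w' (n + 1) (cos (\<theta> + \<phi>)))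
           / (2 * sin \<theta> * sin \<phi>))"
      unfolding x y by (rule P_gamma_plus_trig[OF weights[OF w'] k])
  qed
qed

end
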